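(* Suppose there is a countable family of pairs $(S_j,T_j)$, $j\in\mathbb{N}$, of $\mathbb{G}$-stopping times such that (1) each $T_j$ is an $\mathbb{F}$-stopping time; (2) $(\tau,\infty)\subset\bigcup_{j\in\mathbb{N}}(S_j,T_j)$ (as subsets of $\mathbb{R}_+\times\Omega$); and for each $j$ there exists an $s\mathcal{H}$-measure $\mathbb{Q}_j$ over $(S_j,T_j]$. Then $(\tau,\infty)\in\mathcal{L}^o$. If condition (2) is replaced by (2') $[\tau,\infty)\cap((0,\infty)\times\Omega)\subset\bigcup_{j\in\mathbb{N}}(S_j,T_j)$, then the global optional splitting formula holds at $\tau$ with respect to $\mathbb{F}$.
   Context: Let $(\Omega,\mathcal{A},\mathbb{Q})$ be a probability space with a right-continuous filtration $\mathbb{F}=(\mathcal{F}_t)_{t\ge0}$ such that $\mathcal{F}_0$ contains $\mathcal{N}^{\mathcal{F}_\infty}$, where for a $\sigma$-algebra $\mathcal{T}\subset\mathcal{A}$, $\mathcal{N}^{\mathcal{T}}$ denotes the $\sigma$-algebra generated by all subsets of $\mathcal{T}$-measurable $\mathbb{Q}$-null sets. Let $\tau$ be a random variable with values in $[0,\infty]$, let $\mathcal{N}=\mathcal{N}^{\sigma(\tau)\vee\mathcal{F}_\infty}$, and let $\mathbb{G}=(\mathcal{G}_t)_{t\ge0}$ with $\mathcal{G}_t=\mathcal{N}\vee\bigcap_{s>t}(\mathcal{F}_s\vee\sigma(\tau\wedge s))$. Identities are understood up to indistinguishability outside an $\mathcal{N}$-measurable $\mathbb{Q}$-null set. A $\mathbb{G}$-optional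 process $Y$ satisfies the optional splitting formula on a $\mathbb{G}$-optional set $A$ if there exist $Y'\in\mathcal{O}(\mathbb{F})$ and a $\mathcal{B}[0,\infty]\otimes\mathcal{O}(\mathbb{F})$-measurable $Y''$ on $[0,\infty]\times(\mathbb{R}_+\times\Omega)$ with $Y\mathbf{1}_A=(Y'\mathbf{1}_{[0,\tau)}+Y''(\tau)\mathbf{1}_{[\tau,\infty)})\mathbf{1}_A$, where $Y''(\tau)(t,\omega)=Y''(\tau(\omega),t,\omega)$; $\mathcal{L}^o$ is the family of $\mathbb{G}$-optional sets on which every $\mathbb{G}$-optional process satisfies it, and the global optional splitting formula means $\mathbb{R}_+\times\Omega\in\mathcal{L}^o$. For $\mathbb{G}$-stopping times $S,T$, a probability measure $\mathbb{Q}'$ on $\mathcal{G}_\infty$ is an $s\mathcal{H}$-measure over $(S,T]$ if $\mathbb{Q}'$ is equivalent to $\mathbb{Q}$ on $\mathcal{G}_\infty$ and, for every $(\mathbb{Q},\mathbb{F})$-local martingale $X$, the process $X^{(S,T]}_t=X_{(S\vee T)\wedge t}-X_{S\wedge t}$, $t\ge0$, is a $(\mathbb{Q}',\mathbb{G})$-local martingale. *)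

theory Defs
  imports "HOL-Probability.Probability"
begin

definition os_join :: "'a set \<Rightarrow> 'a set set \<Rightarrow> 'a set set \<Rightarrow> 'a set set" where
  "os_join \<Omega> A B = sigma_sets \<Omega> (A \<union> B)"

definition os_null_gen :: "'a measure \<Rightarrow> 'a set set \<Rightarrow> 'a set set" where
  "os_null_gen M T = sigma_sets (space M)
     {N. \<exists>B\<in>T. N \<subseteq> B \<and> B \<in> sets M \<and> emeasure M B = 0}"

definition os_gen_by :: "'a set \<Rightarrow> ('a \<Rightarrow> 'b::topological_space) \<Rightarrow> 'a set set" where
  "os_gen_by \<Omega> f = sigma_sets \<Omega> {f -` B \<inter> \<Omega> | B. B \<in> sets borel}"

definition os_Finf :: "'a set \<Rightarrow> (real \<Rightarrow> 'a set set) \<Rightarrow> 'a set set" where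
  "os_Finf \<Omega> F = sigma_sets \<Omega> (\<Union>t\<in>{0..}. F t)"

definition os_filtration :: "'a measure \<Rightarrow> (real \<Rightarrow> 'a set set) \<Rightarrow> bool" where
  "os_filtration M F \<longleftrightarrow>
     (\<forall>t\<ge>0. sigma_algebra (space M) (F t) \<and> F t \<subseteq> sets M) \<and>
     (\<forall>s t. 0 \<le> s \<longrightarrow> s \<le> t \<longrightarrow> F s \<subseteq> F t)"

definition os_right_continuous :: "(real \<Rightarrow> 'a set set) \<Rightarrow> bool" where
  "os_right_continuous F \<longleftrightarrow> (\<forall>t\<ge>0. F t = (\<Inter>s\<in>{t<..}. F s))"

definition os_N :: "'a measure \<Rightarrow> (real \<Rightarrow> 'a set set) \<Rightarrow> ('a \<Rightarrow> ennreal) \<Rightarrow> 'a set set" where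
  "os_N M F \<tau> = os_null_gen M (os_join (space M) (os_gen_by (space M) \<tau>) (os_Finf (space M) F))"

definition os_G :: "'a measure \<Rightarrow> (real \<Rightarrow> 'a set set) \<Rightarrow> ('a \<Rightarrow> ennreal) \<Rightarrow> real \<Rightarrow> 'a set set" where
  "os_G M F \<tau> t = os_join (space M) (os_N M F \<tau>)
     (\<Inter>s\<in>{t<..}. os_join (space M) (F s) (os_gen_by (space M) (\<lambda>\<omega>. min (\<tau> \<omega>) (ennreal s))))"

definition os_Ginf :: "'a measure \<Rightarrow> (real \<Rightarrow> 'a set set) \<Rightarrow> ('a \<Rightarrow> ennreal) \<Rightarrow> 'a set set" where
  "os_Ginf M F \<tau> = os_Finf (space M) (os_G M F \<tau>)"

definition os_stopping_time :: "'a set \<Rightarrow> (real \<Rightarrow> 'a set set) \<Rightarrow> ('a \<Rightarrow> ennreal) \<Rightarrow> bool" where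
  "os_stopping_time \<Omega> H T \<longleftrightarrow> (\<forall>t\<ge>0. {\<omega>\<in>\<Omega>. T \<omega> \<le> ennreal t} \<in> H t)"

definition os_adapted :: "'a set \<Rightarrow> (real \<Rightarrow> 'a set set) \<Rightarrow> (real \<Rightarrow> 'a \<Rightarrow> real) \<Rightarrow> bool" where
  "os_adapted \<Omega> H X \<longleftrightarrow> (\<forall>t\<ge>0. \<forall>B\<in>sets borel. {\<omega>\<in>\<Omega>. X t \<omega> \<in> B} \<in> H t)"

definition os_cadlag :: "'a set \<Rightarrow> (real \<Rightarrow> 'a \<Rightarrow> real) \<Rightarrow> bool" where
  "os_cadlag \<Omega> X \<longleftrightarrow> (\<forall>\<omega>\<in>\<Omega>. \<forall>t\<ge>0.
      ((\<lambda>s. X s \<omega>) \<longlongrightarrow> X t \<omega>) (at_right t) \<and>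
      (t > 0 \<longrightarrow> (\<exists>l. ((\<lambda>s. X s \<omega>) \<longlongrightarrow> l) (at_left t))))"

definition os_optional_sets :: "'a set \<Rightarrow> (real \<Rightarrow> 'a set set) \<Rightarrow> (real \<times> 'a) set set" where
  "os_optional_sets \<Omega> H = sigma_sets ({0..} \<times> \<Omega>)
     {{(t,\<omega>) \<in> {0..} \<times> \<Omega>. X t \<omega> \<in> B} | (X :: real \<Rightarrow> 'a \<Rightarrow> real) B.
        os_adapted \<Omega> H X \<and> os_cadlag \<Omega> X \<and> B \<in> sets borel}"

definition os_optional_proc :: "'a set \<Rightarrow> (real \<Rightarrow> 'a set set) \<Rightarrow> (real \<times> 'a \<Rightarrow> real) \<Rightarrow> bool" where
  "os_optional_proc \<Omega> H Y \<longleftrightarrow>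
     (\<forall>B\<in>sets borel. {p \<in> {0..} \<times> \<Omega>. Y p \<in> B} \<in> os_optional_sets \<Omega> H)"

definition os_param_optional :: "'a set \<Rightarrow> (real \<Rightarrow> 'a set set) \<Rightarrow> (ennreal \<Rightarrow> real \<times> 'a \<Rightarrow> real) \<Rightarrow> bool" where
  "os_param_optional \<Omega> H Y'' \<longleftrightarrow>
     (\<forall>B\<in>sets borel. {q \<in> UNIV \<times> ({0..} \<times> \<Omega>). Y'' (fst q) (snd q) \<in> B} \<in>
        sigma_sets (UNIV \<times> ({0..} \<times> \<Omega>))
          {C \<times> D | C D. C \<in> sets (borel :: ennreal measure) \<and> D \<in> os_optional_sets \<Omega> H})"

definition os_after :: "'a set \<Rightarrow> ('a \<Rightarrow> ennreal) \<Rightarrow> (real \<times> 'a) set" where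
  "os_after \<Omega> \<tau> = {(t,\<omega>) \<in> {0..} \<times> \<Omega>. \<tau> \<omega> < ennreal t}"

definition os_from_pos :: "'a set \<Rightarrow> ('a \<Rightarrow> ennreal) \<Rightarrow> (real \<times> 'a) set" where
  "os_from_pos \<Omega> \<tau> = {(t,\<omega>) \<in> {0<..} \<times> \<Omega>. \<tau> \<omega> \<le> ennreal t}"

definition os_open_int :: "'a set \<Rightarrow> ('a \<Rightarrow> ennreal) \<Rightarrow> ('a \<Rightarrow> ennreal) \<Rightarrow> (real \<times> 'a) set" where
  "os_open_int \<Omega> S T = {(t,\<omega>) \<in> {0..} \<times> \<Omega>. S \<omega> < ennreal t \<and> ennreal t < T \<omega>}"

definition os_splitting :: "'a measure \<Rightarrow> (real \<Rightarrow> 'a set set) \<Rightarrow> ('a \<Rightarrow> ennreal)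
     \<Rightarrow> (real \<times> 'a \<Rightarrow> real) \<Rightarrow> (real \<times> 'a) set \<Rightarrow> bool" where
  "os_splitting M F \<tau> Y A \<longleftrightarrow>
     (\<exists>Y' Y''. os_optional_proc (space M) F Y' \<and> os_param_optional (space M) F Y'' \<and>
       (\<exists>Z. Z \<in> os_N M F \<tau> \<and> Z \<in> sets M \<and> emeasure M Z = 0 \<and>
          (\<forall>\<omega>\<in>space M - Z. \<forall>t\<ge>0. (t,\<omega>) \<in> A \<longrightarrow>
              Y (t,\<omega>) = (if ennreal t < \<tau> \<omega> then Y' (t,\<omega>) else Y'' (\<tau> \<omega>) (t,\<omega>)))))"

definition os_Lo :: "'a measure \<Rightarrow> (real \<Rightarrow> 'a set set) \<Rightarrow> ('a \<Rightarrow> ennreal) \<Rightarrow> (real \<times> 'a) set \<Rightarrow> bool" where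
  "os_Lo M F \<tau> A \<longleftrightarrow> A \<in> os_optional_sets (space M) (os_G M F \<tau>) \<and>
     (\<forall>Y. os_optional_proc (space M) (os_G M F \<tau>) Y \<longrightarrow> os_splitting M F \<tau> Y A)"

definition os_martingale :: "'a measure \<Rightarrow> (real \<Rightarrow> 'a set set) \<Rightarrow> (real \<Rightarrow> 'a \<Rightarrow> real) \<Rightarrow> bool" where
  "os_martingale M H X \<longleftrightarrow> os_adapted (space M) H X \<and> (\<forall>t\<ge>0. integrable M (X t)) \<and>
     (\<forall>s t A. 0 \<le> s \<longrightarrow> s \<le> t \<longrightarrow> A \<in> H s \<longrightarrow>
        (LINT \<omega>:A|M. X t \<omega>) = (LINT \<omega>:A|M. X s \<omega>))"

definition os_stopped :: "(real \<Rightarrow> 'a \<Rightarrow> real) \<Rightarrow> ('a \<Rightarrow> ennreal) \<Rightarrow> real \<Rightarrow> 'a \<Rightarrow> real" where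
  "os_stopped X T t \<omega> = X (if ennreal t \<le> T \<omega> then t else enn2real (T \<omega>)) \<omega>"

definition os_local_martingale :: "'a measure \<Rightarrow> (real \<Rightarrow> 'a set set) \<Rightarrow> (real \<Rightarrow> 'a \<Rightarrow> real) \<Rightarrow> bool" where
  "os_local_martingale M H X \<longleftrightarrow> os_adapted (space M) H X \<and> os_cadlag (space M) X \<and>
     (\<exists>Tn :: nat \<Rightarrow> 'a \<Rightarrow> ennreal.
        (\<forall>n. os_stopping_time (space M) H (Tn n)) \<and>
        (\<forall>n. \<forall>\<omega>\<in>space M. Tn n \<omega> \<le> Tn (Suc n) \<omega>) \<and>
        (AE \<omega> in M. ((\<lambda>n. Tn n \<omega>) \<longlongrightarrow> \<infinity>) sequentially) \<and>
        (\<forall>n. os_martingale M H (os_stopped X (Tn n))))"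

definition os_incr :: "(real \<Rightarrow> 'a \<Rightarrow> real) \<Rightarrow> ('a \<Rightarrow> ennreal) \<Rightarrow> ('a \<Rightarrow> ennreal) \<Rightarrow> real \<Rightarrow> 'a \<Rightarrow> real" where
  "os_incr X S T t \<omega> = os_stopped X (\<lambda>\<omega>. max (S \<omega>) (T \<omega>)) t \<omega> - os_stopped X S t \<omega>"

definition os_sH_measure :: "'a measure \<Rightarrow> (real \<Rightarrow> 'a set set) \<Rightarrow> ('a \<Rightarrow> ennreal)
     \<Rightarrow> ('a \<Rightarrow> ennreal) \<Rightarrow> ('a \<Rightarrow> ennreal) \<Rightarrow> 'a measure \<Rightarrow> bool" where
  "os_sH_measure M F \<tau> S T Q' \<longleftrightarrow>
     prob_space Q' \<and> space Q' = space M \<and> sets Q' = os_Ginf M F \<tau> \<and>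
     (\<forall>A\<in>os_Ginf M F \<tau>. emeasure Q' A = 0 \<longleftrightarrow> emeasure M A = 0) \<and>
     (\<forall>X. os_local_martingale M F X \<longrightarrow> os_local_martingale Q' (os_G M F \<tau>) (os_incr X S T))"

end

(* Idea.  It suffices to split the indicators of [R, oo) for G-stopping times R, because these sets
   generate the G-optional sigma-algebra.  A bounded martingale P(E | H_t) is positive for all t on the
   event E.  Hence, with M^q the martingale of the event {q < R}, one has R <= t if and only if M^q_t <= 0
   for all rational q >= t, outside a null set and simultaneously for all t; this replaces
   section theorems and the Doob-Meyer decomposition.
   On (S_j, T_j), after tau and under the measure Q_j, the G-martingale of an event
   {tau in B} & C & {s < T_j} with C in F_s is 1_B(tau) X_t, where X is the F-martingale of C & {s < T_j}:
   this is the sH-property.  Doob's maximal inequality and a Dynkin argument extend the representation to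
   all events {q < R, q < T_j}.  Before tau and at time 0 the sigma-algebras G_t and F_t have the same
   traces, and F-martingales suffice.  The pieces are glued along {S_j < t < T_j}: the first inequality
   defines an event measurable in (tau, t, omega), and T_j is an F-stopping time. *)

theory Submission
  imports Defs "HOL-Library.Sublist"
begin

text \<open>Every almost sure statement must hold at all times simultaneously, outside one null set
  of \<open>os_N\<close>. It is proved for countably many rational times and carried over by
  right-continuity, hence the work with cadlag versions; bounded oscillation along rational times
  provides them. The exceptional sets fall into \<open>os_N\<close> because all measures live on
  \<open>Ginf\<close>. An sH-measure controls an F-martingale only between S and T. It yields a
  conditional probability under Q only if the event is decided before T: the F-martingale of
  \<open>C\<close> and \<open>s < T\<close> has reached its terminal value at T, so its increment
  from t to T is the indicator minus its value at t. Hence the cut by \<open>s < T\<close> in each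
  generator and by \<open>q < T\<close> in each tested event. Past tau, the factor 1_B(tau) is known
  to G. Right-continuity of G costs room: a set of \<open>G q\<close> is described by
  \<open>F s\<close> and tau \<and> s only for s > q, up to a null set. The gap is closed by limsups
  of sets (right-continuity, traces), by exhausting \<open>q < T\<close> with
  \<open>q + 1/n < T\<close>, or by rational pairs q < s (gluing).\<close>

section \<open>One-sided limits from bounded oscillation\<close>

text \<open>Counting moves of size \<open>e\<close> from an anchor that is reset at each move, instead of upcrossings,
  lets the orthogonality of martingale increments alone bound the count.\<close>

fun gcount :: "real \<Rightarrow> real \<Rightarrow> real list \<Rightarrow> nat" where
  "gcount e a [] = 0"
| "gcount e a (x # xs) = (if e \<le> \<bar>x - a\<bar> then Suc (gcount e x xs) else gcount e a xs)"

fun osc :: "real \<Rightarrow> real list \<Rightarrow> bool" where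
  "osc e [] = True"
| "osc e [x] = False"
| "osc e (x # y # zs) = (2 * e \<le> \<bar>x - y\<bar> \<and> osc e zs)"

text \<open>Two values at distance 2 * e cannot both be within e of the same anchor, so every pair
  of the chain costs at least one move. The second conjunct is the state in the middle of a pair: y
  is still to come and is far from the current anchor. Whichever value causes the next reset pays
  for this pair, and the remaining pairs are counted from the new anchor.\<close>

lemma osc_length_le_gcount_aux:
  "(subseq qs ts \<longrightarrow> osc e qs \<longrightarrow> length qs \<le> 2 * gcount e a ts) \<and>
   (subseq (y # qs) ts \<longrightarrow> osc e qs \<longrightarrow> e \<le> \<bar>y - a\<bar> \<longrightarrow> length qs + 2 \<le> 2 * gcount e a ts)"
proof (induction ts arbitrary: qs a y)
  case Nil
  then show ?case by auto
next
  case (Cons x ts)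
  have 1: "length qs \<le> 2 * gcount e b ts" if "subseq qs ts" "osc e qs" for qs b
    using Cons that by blast
  have 2: "length qs + 2 \<le> 2 * gcount e b ts"
    if "subseq (y # qs) ts" "osc e qs" "e \<le> \<bar>y - b\<bar>" for qs b y
    using Cons that by blast
  show ?case
  proof (intro conjI impI)
    assume s: "subseq qs (x # ts)" and o: "osc e qs"
    show "length qs \<le> 2 * gcount e a (x # ts)"
    proof (cases "subseq qs ts")
      case True
      show ?thesis using 1[OF True o, of x] 1[OF True o, of a] by auto
    next
      case False
      then obtain y zs where qs: "qs = x # y # zs" and *: "2 * e \<le> \<bar>x - y\<bar>" "osc e zs"
        using s o by (cases qs; cases "tl qs") (auto simp: subseq_Cons2_iff split: if_splits)
      have sy: "subseq (y # zs) ts" using s False unfolding qs by (auto simp: subseq_Cons2_iff)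
      have y: "e \<le> \<bar>y - x\<bar>" using * by (smt (verit))
      show ?thesis
      proof (cases "e \<le> \<bar>x - a\<bar>")
        case True
        then show ?thesis using 2[OF sy *(2), of x] y by (simp add: qs)
      next
        case False
        then have "e \<le> \<bar>y - a\<bar>" using * by (smt (verit))
        then show ?thesis using 2[OF sy *(2), of a] False by (simp add: qs)
      qed
    qed
  next
    assume s: "subseq (y # qs) (x # ts)" and o: "osc e qs" and y: "e \<le> \<bar>y - a\<bar>"
    show "length qs + 2 \<le> 2 * gcount e a (x # ts)"
    proof (cases "e \<le> \<bar>x - a\<bar>")
      case True
      have "subseq qs ts" using s by (metis list.sel(3) subseq_Cons' subseq_Cons2_iff)
      then show ?thesis using 1[of qs x] o True by simp
    next
      case False
      then have "subseq (y # qs) ts" using s y by (auto simp: subseq_Cons2_iff split: if_splits)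
      then show ?thesis using 2[OF _ o y] False by simp
    qed
  qed
qed

lemma osc_length_le_gcount: "subseq qs ts \<Longrightarrow> osc e qs \<Longrightarrow> length qs \<le> 2 * gcount e a ts"
  using osc_length_le_gcount_aux by blast

section \<open>Oscillation chains along rational times\<close>

abbreviation nnrat :: "real set" where "nnrat \<equiv> \<rat> \<inter> {0..}"

definition osc_chain :: "(real \<Rightarrow> real) \<Rightarrow> real \<Rightarrow> real list \<Rightarrow> bool" where
  "osc_chain f e qs \<longleftrightarrow> sorted_wrt (<) qs \<and> set qs \<subseteq> nnrat \<and> osc e (map f qs)"

text \<open>Countably many thresholds reach every positive one through \<open>osc_mono\<close>, and
  they make the set of good paths a countable combination of events
  (\<open>good_eq\<close>).\<close>

definition osc_bounded :: "(real \<Rightarrow> real) \<Rightarrow> bool" where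
  "osc_bounded f \<longleftrightarrow> (\<forall>n::nat. \<exists>k. \<forall>qs. osc_chain f (1 / Suc n) qs \<longrightarrow> length qs \<le> k)"

lemma osc_mono: "osc e xs \<Longrightarrow> d \<le> e \<Longrightarrow> osc d xs"
  by (induction d xs rule: osc.induct) auto

lemma osc_boundedD:
  assumes "osc_bounded f" "e > 0"
  shows "\<exists>k. \<forall>qs. osc_chain f e qs \<longrightarrow> length qs \<le> k"
proof -
  obtain n :: nat where n: "1 / Suc n < e" using assms(2) nat_approx_posE by blast
  obtain k where "\<forall>qs. osc_chain f (1 / Suc n) qs \<longrightarrow> length qs \<le> k"
    using assms(1) unfolding osc_bounded_def by blast
  then show ?thesis using n osc_mono unfolding osc_chain_def by (meson less_imp_le)
qed

lemma osc_chain_Cons2: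
  assumes "osc_chain f e qs" "a \<in> nnrat" "b \<in> nnrat" "a < b" "\<forall>q\<in>set qs. b < q" "2 * e \<le> \<bar>f a - f b\<bar>"
  shows "osc_chain f e (a # b # qs)"
  using assms unfolding osc_chain_def by auto

lemma rat_seq_right:
  fixes t u :: real assumes "0 \<le> t" "t < u"
  obtains r where "\<And>n. r n \<in> nnrat" "\<And>n. t < r n" "\<And>n. r n < u" "r \<longlonglongrightarrow> t"
proof -
  have "\<exists>q\<in>\<rat>. t < q \<and> q < min u (t + 1 / Suc n)" for n :: nat
    by (rule Rats_dense_in_real) (use assms in auto)
  then obtain r where r: "\<And>n. r n \<in> \<rat>" "\<And>n. t < r n" "\<And>n. r n < min u (t + 1 / Suc n)" by metis
  have "r \<longlonglongrightarrow> t"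
  proof (rule tendsto_sandwich[of "\<lambda>n. t" _ _ "\<lambda>n. t + 1 / Suc n"])
    show "(\<lambda>n. t + 1 / real (Suc n)) \<longlonglongrightarrow> t"
      using tendsto_add[OF tendsto_const LIMSEQ_inverse_real_of_nat, of t] by (simp add: inverse_eq_divide)
  qed (use r in \<open>auto intro!: always_eventually less_imp_le\<close>)
  moreover have "r n \<in> nnrat" for n using r(1,2)[of n] assms by auto
  ultimately show thesis using that[of r] r by (auto simp: min_less_iff_conj)
qed

lemma filterlim_at_right_rat:
  assumes "\<And>n. r n \<in> nnrat" "\<And>n. t < r n" "r \<longlonglongrightarrow> t"
  shows "filterlim r (at t within (nnrat \<inter> {t<..})) sequentially"
  using assms by (auto simp: filterlim_at intro!: always_eventually)

text \<open>The Cauchy condition compares ordered points only, the form in which its failure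
  supplies a new pair for a chain.\<close>

lemma tendsto_of_cauchy_within:
  fixes f :: "real \<Rightarrow> real"
  assumes nb: "at t within S \<noteq> bot"
    and C: "\<And>e. e > 0 \<Longrightarrow> \<exists>d>0. \<forall>q\<in>S. \<forall>q'\<in>S. dist q t < d \<longrightarrow> dist q' t < d \<longrightarrow> q < q' \<longrightarrow> \<bar>f q - f q'\<bar> < e"
    and t: "t \<notin> S"
  shows "\<exists>l. (f \<longlongrightarrow> l) (at t within S)"
proof -
  have C2: "\<exists>d>0. \<forall>q\<in>S. \<forall>q'\<in>S. dist q t < d \<longrightarrow> dist q' t < d \<longrightarrow> \<bar>f q - f q'\<bar> < e" if "e > 0" for e
  proof -
    obtain d where d: "d > 0" "\<forall>q\<in>S. \<forall>q'\<in>S. dist q t < d \<longrightarrow> dist q' t < d \<longrightarrow> q < q' \<longrightarrow> \<bar>f q - f q'\<bar> < e"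
      using C[OF \<open>e > 0\<close>] by blast
    have "\<bar>f q - f q'\<bar> < e" if "q \<in> S" "q' \<in> S" "dist q t < d" "dist q' t < d" for q q'
      using d(2) that \<open>e > 0\<close> by (cases q q' rule: linorder_cases) (force simp: abs_minus_commute)+
    then show ?thesis using d(1) by blast
  qed
  have "cauchy_filter (filtermap f (at t within S))"
    unfolding cauchy_filter_metric
  proof (intro allI impI)
    fix e :: real assume "e > 0"
    then obtain d where d: "d > 0" "\<forall>q\<in>S. \<forall>q'\<in>S. dist q t < d \<longrightarrow> dist q' t < d \<longrightarrow> \<bar>f q - f q'\<bar> < e"
      using C2 by blast
    have "eventually (\<lambda>x. x \<in> f ` {q\<in>S. dist q t < d}) (filtermap f (at t within S))"
      unfolding eventually_filtermap eventually_at using d(1) by blast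
    then show "\<exists>P. eventually P (filtermap f (at t within S)) \<and> (\<forall>x y. P x \<and> P y \<longrightarrow> dist x y < e)"
      using d(2) by (intro exI[of _ "\<lambda>x. x \<in> f ` {q\<in>S. dist q t < d}"]) (auto simp: dist_real_def)
  qed
  then obtain l where "filtermap f (at t within S) \<le> nhds l"
    using complete_UNIV[where 'a=real] nb unfolding complete_uniform
    by (metis UNIV_I filtermap_bot_iff principal_UNIV top_greatest)
  then show ?thesis unfolding filterlim_def by blast
qed

lemma at_right_rat_nonbot: "0 \<le> t \<Longrightarrow> at t within (nnrat \<inter> {t<..}) \<noteq> bot"
proof -
  assume "0 \<le> t"
  then obtain r where "\<And>n. r n \<in> nnrat" "\<And>n. t < r n" "r \<longlonglongrightarrow> t"
    using rat_seq_right[of t "t+1"] by (metis less_add_one)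
  then have "filterlim r (at t within (nnrat \<inter> {t<..})) sequentially" by (rule filterlim_at_right_rat)
  then show ?thesis unfolding filterlim_def by (metis filtermap_bot_iff le_bot sequentially_bot)
qed

text \<open>If the Cauchy condition fails to the right of t, pairs with a move of at least e exist
  arbitrarily close to t. Each new pair is taken closer to t than all earlier ones and goes in
  front, so chains would become arbitrarily long.\<close>

lemma osc_bounded_right_limit:
  assumes ob: "osc_bounded f" and t: "0 \<le> t"
  shows "\<exists>l. (f \<longlongrightarrow> l) (at t within (nnrat \<inter> {t<..}))"
proof (rule tendsto_of_cauchy_within[OF at_right_rat_nonbot[OF t]])
  fix e :: real assume e: "e > 0"
  show "\<exists>d>0. \<forall>q\<in>nnrat \<inter> {t<..}. \<forall>q'\<in>nnrat \<inter> {t<..}. dist q t < d \<longrightarrow> dist q' t < d \<longrightarrow> q < q' \<longrightarrow> \<bar>f q - f q'\<bar> < e"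
  proof (rule ccontr)
    assume neg: "\<not> ?thesis"
    have chains: "\<exists>qs. osc_chain f (e/2) qs \<and> length qs = 2 * k \<and> (\<forall>q\<in>set qs. t < q)" for k
    proof (induction k)
      case 0
      then show ?case by (intro exI[of _ "[]"]) (auto simp: osc_chain_def)
    next
      case (Suc k)
      then obtain qs where qs: "osc_chain f (e/2) qs" "length qs = 2 * k" "\<forall>q\<in>set qs. t < q" by blast
      \<comment> \<open>The new pair must precede the whole chain; the element 1 covers the empty
        chain.\<close>
      define d where "d = Min (insert 1 ((\<lambda>q. q - t) ` set qs))"
      have d: "d > 0" "\<forall>q\<in>set qs. d \<le> q - t" unfolding d_def using qs by auto
      obtain q q' where "q\<in>nnrat \<inter> {t<..}" "q'\<in>nnrat \<inter> {t<..}" "dist q t < d" "dist q' t < d" "q < q'" "\<bar>f q - f q'\<bar> \<ge> e"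
        using neg d(1) by (meson linorder_not_le)
      then have "osc_chain f (e/2) (q # q' # qs)" "\<forall>r\<in>set (q # q' # qs). t < r"
        using d qs by (auto intro!: osc_chain_Cons2 simp: dist_real_def)
      then show ?case using qs(2) by (intro exI[of _ "q # q' # qs"]) auto
    qed
    obtain k where k: "\<forall>qs. osc_chain f (e/2) qs \<longrightarrow> length qs \<le> k" using osc_boundedD[OF ob, of "e/2"] e by auto
    then show False using chains[of "Suc k"] by fastforce
  qed
qed auto

text \<open>On this side a chain runs towards t: its front pair is chosen first and the rest lies
  between that pair and t. The induction is therefore generalized over the left end a.\<close>

lemma osc_bounded_left_limit:
  assumes ob: "osc_bounded f" and t: "0 < t"
  shows "\<exists>l. (f \<longlongrightarrow> l) (at t within (nnrat \<inter> {..<t}))"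
proof (rule tendsto_of_cauchy_within)
  show "at t within (nnrat \<inter> {..<t}) \<noteq> bot"
    unfolding trivial_limit_within not_not islimpt_approachable
  proof (intro allI impI)
    fix e :: real assume "e > 0"
    then obtain q where "q \<in> \<rat>" "max 0 (t - e) < q" "q < t" using Rats_dense_in_real[of "max 0 (t-e)" t] t by auto
    then show "\<exists>x'\<in>nnrat \<inter> {..<t}. x' \<noteq> t \<and> dist x' t < e"
      by (intro bexI[of _ q]) (auto simp: dist_real_def)
  qed
  fix e :: real assume e: "e > 0"
  show "\<exists>d>0. \<forall>q\<in>nnrat \<inter> {..<t}. \<forall>q'\<in>nnrat \<inter> {..<t}. dist q t < d \<longrightarrow> dist q' t < d \<longrightarrow> q < q' \<longrightarrow> \<bar>f q - f q'\<bar> < e"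
  proof (rule ccontr)
    assume neg: "\<not> ?thesis"
    have chains: "\<exists>qs. osc_chain f (e/2) qs \<and> length qs = 2 * k \<and> (\<forall>q\<in>set qs. a < q \<and> q < t)" if "a < t" for k a
      using that
    proof (induction k arbitrary: a)
      case 0
      then show ?case by (intro exI[of _ "[]"]) (auto simp: osc_chain_def)
    next
      case (Suc k)
      have "t - a > 0" using Suc by simp
      then obtain q q' where q: "q\<in>nnrat \<inter> {..<t}" "q'\<in>nnrat \<inter> {..<t}" "dist q t < t - a" "dist q' t < t - a" "q < q'" "\<bar>f q - f q'\<bar> \<ge> e"
        using neg by (meson linorder_not_le)
      obtain qs where "osc_chain f (e/2) qs" "length qs = 2 * k" "\<forall>r\<in>set qs. q' < r \<and> r < t" using Suc.IH[of q'] q by auto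
      with q have "osc_chain f (e/2) (q # q' # qs)" "\<forall>r\<in>set (q # q' # qs). a < r \<and> r < t" "length (q # q' # qs) = 2 * Suc k"
        by (auto intro!: osc_chain_Cons2 simp: dist_real_def)
      then show ?case by blast
    qed
    obtain k where k: "\<forall>qs. osc_chain f (e/2) qs \<longrightarrow> length qs \<le> k" using osc_boundedD[OF ob, of "e/2"] e by auto
    then show False using chains[OF t, of "Suc k"] by fastforce
  qed
qed auto

section \<open>From right limits along rationals to cadlag paths\<close>

lemma right_limits_right_continuous:
  fixes L :: "real \<Rightarrow> real"
  assumes L: "\<And>t. 0 \<le> t \<Longrightarrow> (f \<longlongrightarrow> L t) (at t within (nnrat \<inter> {t<..}))" and t: "0 \<le> t"
  shows "(L \<longlongrightarrow> L t) (at_right t)"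
proof (rule tendstoI)
  fix e :: real assume "e > 0"
  then have "\<forall>\<^sub>F q in at t within (nnrat \<inter> {t<..}). dist (f q) (L t) < e/2"
    using L[OF t] by (intro tendstoD) auto
  then obtain d where d: "d > 0" "\<And>q. q \<in> nnrat \<Longrightarrow> t < q \<Longrightarrow> q < t + d \<Longrightarrow> dist (f q) (L t) < e/2"
    unfolding eventually_at by (auto simp: dist_real_def)
  have "dist (L s) (L t) < e" if st: "t < s" "s < t + d" for s
  proof -
    have s: "0 \<le> s" using t st by simp
    \<comment> \<open>The value L s is a limit of values of f in (s, t + d), where f is already
      close to L t.\<close>
    obtain r where r: "\<And>n. r n \<in> nnrat" "\<And>n. s < r n" "\<And>n. r n < t + d" "r \<longlonglongrightarrow> s"
      using rat_seq_right[OF s st(2)] by metis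
    have "(\<lambda>n. f (r n)) \<longlonglongrightarrow> L s"
      by (rule filterlim_compose[OF L[OF s] filterlim_at_right_rat]) (use r in auto)
    then have "(\<lambda>n. dist (f (r n)) (L t)) \<longlonglongrightarrow> dist (L s) (L t)" by (intro tendsto_intros)
    moreover have "dist (f (r n)) (L t) \<le> e/2" for n
      using d(2)[of "r n"] r(1)[of n] r(2)[of n] r(3)[of n] st(1) by (intro less_imp_le) auto
    ultimately have "dist (L s) (L t) \<le> e/2" by (intro LIMSEQ_le_const2[where X="\<lambda>n. dist (f (r n)) (L t)"]) auto
    then show ?thesis using \<open>e > 0\<close> by simp
  qed
  then show "\<forall>\<^sub>F x in at_right t. dist (L x) (L t) < e"
    unfolding eventually_at_right_field using d(1) by (intro exI[of _ "t+d"]) auto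
qed

lemma right_limits_left_limit:
  fixes L :: "real \<Rightarrow> real"
  assumes L: "\<And>t. 0 \<le> t \<Longrightarrow> (f \<longlongrightarrow> L t) (at t within (nnrat \<inter> {t<..}))" and t: "0 < t"
    and l: "(f \<longlongrightarrow> l) (at t within (nnrat \<inter> {..<t}))"
  shows "(L \<longlongrightarrow> l) (at_left t)"
proof (rule tendstoI)
  fix e :: real assume "e > 0"
  then have "\<forall>\<^sub>F q in at t within (nnrat \<inter> {..<t}). dist (f q) l < e/2"
    using l by (intro tendstoD) auto
  then obtain d where d: "d > 0" "\<And>q. q \<in> nnrat \<Longrightarrow> t - d < q \<Longrightarrow> q < t \<Longrightarrow> dist (f q) l < e/2"
    unfolding eventually_at by (auto simp: dist_real_def)
  have "dist (L s) l < e" if st: "max 0 (t - d) < s" "s < t" for s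
  proof -
    have s: "0 \<le> s" using t st by simp
    obtain r where r: "\<And>n. r n \<in> nnrat" "\<And>n. s < r n" "\<And>n. r n < t" "r \<longlonglongrightarrow> s"
      using rat_seq_right[OF s st(2)] by metis
    have "(\<lambda>n. f (r n)) \<longlonglongrightarrow> L s"
      by (rule filterlim_compose[OF L[OF s] filterlim_at_right_rat]) (use r in auto)
    then have "(\<lambda>n. dist (f (r n)) l) \<longlonglongrightarrow> dist (L s) l" by (intro tendsto_intros)
    moreover have "dist (f (r n)) l \<le> e/2" for n
      using d(2)[of "r n"] r(1)[of n] r(2)[of n] r(3)[of n] st(1) by (intro less_imp_le) auto
    ultimately have "dist (L s) l \<le> e/2" by (intro LIMSEQ_le_const2[where X="\<lambda>n. dist (f (r n)) l"]) auto
    then show ?thesis using \<open>e > 0\<close> by simp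
  qed
  then show "\<forall>\<^sub>F x in at_left t. dist (L x) l < e"
    unfolding eventually_at_left_field using d(1) t by (intro exI[of _ "max 0 (t-d)"]) auto
qed

text \<open>The device that turns an identity at rational times, valid outside one null set, into an
  identity at all times.\<close>

lemma right_continuous_eq_on:
  fixes f g :: "real \<Rightarrow> real"
  assumes f: "(f \<longlongrightarrow> f t) (at_right t)" and g: "(g \<longlongrightarrow> g t) (at_right t)" and tu: "0 \<le> t" "t < u"
    and eq: "\<And>q. q \<in> nnrat \<Longrightarrow> t < q \<Longrightarrow> q < u \<Longrightarrow> f q = g q"
  shows "f t = g t"
proof -
  obtain r where r: "\<And>n. r n \<in> nnrat" "\<And>n. t < r n" "\<And>n. r n < u" "r \<longlonglongrightarrow> t" using rat_seq_right[OF tu] by blast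
  have lim: "filterlim r (at_right t) sequentially"
    using r by (auto simp: filterlim_at intro!: always_eventually)
  have "(\<lambda>n. f (r n)) \<longlonglongrightarrow> f t" "(\<lambda>n. g (r n)) \<longlonglongrightarrow> g t"
    using filterlim_compose[OF f lim] filterlim_compose[OF g lim] by auto
  moreover have "f (r n) = g (r n)" for n using eq r by blast
  ultimately show ?thesis using LIMSEQ_unique by auto
qed

section \<open>Cadlag versions of conditional probabilities\<close>

text \<open>Instances are F under \<open>M0\<close> and G under every measure on \<open>Ginf\<close>
  equivalent to M. Null sets are asked for from the terminal sigma-algebra only, which is where the
  exceptional sets of the construction lie (\<open>good_Finf\<close>).\<close>

locale usual_conditions = prob_space P for P :: "'a measure" +
  fixes H :: "real \<Rightarrow> 'a set set"
  assumes filtration: "os_filtration P H"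
    and right_continuous: "os_right_continuous H"
    and null_sets_H: "\<And>A. A \<in> os_Finf (space P) H \<Longrightarrow> emeasure P A = 0 \<Longrightarrow> A \<in> H 0"
begin

definition HM :: "real \<Rightarrow> 'a measure" where "HM t = sigma (space P) (H t)"

lemma sigma_algebra_H: "0 \<le> t \<Longrightarrow> sigma_algebra (space P) (H t)"
  using filtration unfolding os_filtration_def by simp

lemma H_sets: "0 \<le> t \<Longrightarrow> A \<in> H t \<Longrightarrow> A \<in> sets P"
  using filtration unfolding os_filtration_def by (meson subsetD)

lemma H_mono: "0 \<le> s \<Longrightarrow> s \<le> t \<Longrightarrow> A \<in> H s \<Longrightarrow> A \<in> H t"
  using filtration unfolding os_filtration_def by (meson subsetD)

lemma space_HM [simp]: "space (HM t) = space P"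
  by (simp add: HM_def space_measure_of_conv)

lemma sets_HM [simp]: "0 \<le> t \<Longrightarrow> sets (HM t) = H t"
  unfolding HM_def by (intro sigma_algebra.sets_measure_of_eq sigma_algebra_H)

lemma subalgebra_HM: "0 \<le> t \<Longrightarrow> subalgebra P (HM t)"
  unfolding subalgebra_def using H_sets by auto

lemma measurable_HM_P: "0 \<le> t \<Longrightarrow> f \<in> borel_measurable (HM t) \<Longrightarrow> f \<in> borel_measurable P"
  using measurable_from_subalg[OF subalgebra_HM] by blast

lemma measurable_HM_mono:
  assumes "0 \<le> s" "s \<le> t" "f \<in> borel_measurable (HM s)"
  shows "f \<in> borel_measurable (HM t)"
proof (rule measurable_from_subalg[OF _ assms(3)])
  show "subalgebra (HM t) (HM s)" unfolding subalgebra_def using assms H_mono by auto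
qed

lemma adapted_iff: "os_adapted (space P) H X \<longleftrightarrow> (\<forall>t\<ge>0. X t \<in> borel_measurable (HM t))"
proof -
  have "(\<forall>B\<in>sets borel. {\<omega> \<in> space P. X t \<omega> \<in> B} \<in> H t) \<longleftrightarrow> X t \<in> borel_measurable (HM t)" if "0 \<le> t" for t
    using that by (simp add: measurable_def vimage_def Int_def conj_commute)
  then show ?thesis unfolding os_adapted_def by blast
qed

lemma H_right:
  assumes "0 \<le> t" "\<And>s. t < s \<Longrightarrow> A \<in> H s"
  shows "A \<in> H t"
proof -
  have "H t = (\<Inter>s\<in>{t<..}. H s)" using right_continuous assms(1) unfolding os_right_continuous_def by blast
  then show ?thesis using assms(2) by simp
qed

lemma measurable_HM_right:
  assumes "0 \<le> t" "\<And>s. t < s \<Longrightarrow> f \<in> borel_measurable (HM s)"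
  shows "f \<in> borel_measurable (HM t)"
proof (rule measurableI)
  fix B :: "'b::topological_space set" assume B: "B \<in> sets borel"
  have "f -` B \<inter> space P \<in> H s" if "t < s" for s
    using measurable_sets[OF assms(2)[OF that] B] that assms(1) by simp
  then show "f -` B \<inter> space (HM t) \<in> sets (HM t)"
    using assms(1) H_right[OF assms(1)] by simp
qed simp

lemma Finf_sets: "A \<in> os_Finf (space P) H \<Longrightarrow> A \<in> sets P"
proof -
  have "sigma_sets (space P) (\<Union>t\<in>{0..}. H t) \<subseteq> sets P"
    by (intro sets.sigma_sets_subset subsetI) (use H_sets in auto)
  then show "A \<in> os_Finf (space P) H \<Longrightarrow> A \<in> sets P" unfolding os_Finf_def by blast
qed

lemma bounded_integrable:
  fixes f :: "'a \<Rightarrow> real"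
  assumes "f \<in> borel_measurable P" "\<And>\<omega>. \<omega> \<in> space P \<Longrightarrow> \<bar>f \<omega>\<bar> \<le> c"
  shows "integrable P f"
  by (rule integrable_const_bound[of _ c]) (simp_all add: assms AE_I2)

text \<open>A version of the conditional probability with values in [0,1] everywhere. It is tested
  against bounded functions rather than sets because the oscillation bound tests it with the
  increments of an anchor.\<close>

definition is_cond :: "'a set \<Rightarrow> real \<Rightarrow> ('a \<Rightarrow> real) \<Rightarrow> bool" where
  "is_cond E t x \<longleftrightarrow> x \<in> borel_measurable (HM t) \<and> (\<forall>\<omega>. 0 \<le> x \<omega> \<and> x \<omega> \<le> 1) \<and>
    (\<forall>g c. g \<in> borel_measurable (HM t) \<longrightarrow> (\<forall>\<omega>\<in>space P. \<bar>g \<omega>\<bar> \<le> c) \<longrightarrow>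
      (\<integral>\<omega>. g \<omega> * indicator E \<omega> \<partial>P) = (\<integral>\<omega>. g \<omega> * x \<omega> \<partial>P))"

lemma ex_is_cond:
  assumes E: "E \<in> sets P" and t: "0 \<le> t"
  shows "\<exists>x. is_cond E t x"
proof -
  interpret S: finite_measure_subalgebra P "HM t"
    by unfold_locales (rule subalgebra_HM[OF t])
  define y where "y = real_cond_exp P (HM t) (indicator E)"
  \<comment> \<open>Clamping turns the almost sure bounds into bounds at every point and changes y
    on a null set only.\<close>
  define x where "x = (\<lambda>\<omega>. max 0 (min 1 (y \<omega>)))"
  have iE: "integrable P (indicator E :: 'a \<Rightarrow> real)"
    by (rule bounded_integrable[of _ 1]) (use E in \<open>auto simp: indicator_def\<close>)
  have ym: "y \<in> borel_measurable (HM t)" unfolding y_def by simp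
  have "AE \<omega> in P. y \<omega> \<ge> 0" unfolding y_def by (rule S.real_cond_exp_ge_c[OF iE]) auto
  moreover have "AE \<omega> in P. y \<omega> \<le> 1" unfolding y_def by (rule S.real_cond_exp_le_c[OF iE]) (auto simp: indicator_def)
  ultimately have xy: "AE \<omega> in P. x \<omega> = y \<omega>" by eventually_elim (simp add: x_def)
  have xm: "x \<in> borel_measurable (HM t)" unfolding x_def using ym by measurable
  have int: "(\<integral>\<omega>. g \<omega> * indicator E \<omega> \<partial>P) = (\<integral>\<omega>. g \<omega> * x \<omega> \<partial>P)"
    if g: "g \<in> borel_measurable (HM t)" and gc: "\<forall>\<omega>\<in>space P. \<bar>g \<omega>\<bar> \<le> c" for g c
  proof -
    have gP: "g \<in> borel_measurable P" using measurable_HM_P[OF t g] .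
    have "integrable P (\<lambda>\<omega>. g \<omega> * indicator E \<omega>)"
      by (rule bounded_integrable[of _ "max c 0"]) (use gP E gc in \<open>auto simp: indicator_def max_def\<close>)
    then have "(\<integral>\<omega>. g \<omega> * indicator E \<omega> \<partial>P) = (\<integral>\<omega>. g \<omega> * y \<omega> \<partial>P)"
      unfolding y_def using S.real_cond_exp_intg(2)[OF _ g, of "indicator E"] E by simp
    also have "\<dots> = (\<integral>\<omega>. g \<omega> * x \<omega> \<partial>P)"
      by (rule integral_cong_AE) (use xy gP measurable_HM_P[OF t xm] measurable_HM_P[OF t ym] in auto)
    finally show ?thesis .
  qed
  show ?thesis
    unfolding is_cond_def
  proof (intro exI[of _ x] conjI allI impI)
    show "0 \<le> x \<omega>" "x \<omega> \<le> 1" for \<omega> by (simp_all add: x_def)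
  qed (fact xm, rule int)
qed

end

section \<open>Oscillation estimate at rational times\<close>

lemma gcount_le_length: "gcount e a xs \<le> length xs"
  by (induction e a xs rule: gcount.induct) auto

lemma borel_measurable_gcount:
  assumes "a \<in> borel_measurable M" "\<And>q. q \<in> set qs \<Longrightarrow> x q \<in> borel_measurable M"
  shows "(\<lambda>\<omega>. real (gcount e (a \<omega>) (map (\<lambda>q. x q \<omega>) qs))) \<in> borel_measurable M"
  using assms
proof (induction qs arbitrary: a)
  case (Cons q qs)
  have [measurable]: "a \<in> borel_measurable M" "x q \<in> borel_measurable M" using Cons.prems by auto
  have [measurable]: "(\<lambda>\<omega>. real (gcount e (a \<omega>) (map (\<lambda>q. x q \<omega>) qs))) \<in> borel_measurable M"
    "(\<lambda>\<omega>. real (gcount e (x q \<omega>) (map (\<lambda>q. x q \<omega>) qs))) \<in> borel_measurable M"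
    using Cons by auto
  have "(\<lambda>\<omega>. real (gcount e (a \<omega>) (map (\<lambda>q. x q \<omega>) (q # qs)))) =
    (\<lambda>\<omega>. if e \<le> \<bar>x q \<omega> - a \<omega>\<bar> then 1 + real (gcount e (x q \<omega>) (map (\<lambda>q. x q \<omega>) qs))
      else real (gcount e (a \<omega>) (map (\<lambda>q. x q \<omega>) qs)))" by auto
  then show ?case by simp
qed simp

locale rational_martingale = usual_conditions P H for P :: "'a measure" and H +
  fixes E :: "'a set" and x :: "real \<Rightarrow> 'a \<Rightarrow> real"
  assumes E: "E \<in> sets P"
    and x_cond: "\<And>q. q \<in> nnrat \<Longrightarrow> is_cond E q (x q)"
begin

lemma x_HM: "q \<in> nnrat \<Longrightarrow> x q \<in> borel_measurable (HM q)"
  using x_cond unfolding is_cond_def by blast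

lemma x_ge: "q \<in> nnrat \<Longrightarrow> 0 \<le> x q \<omega>" and x_le: "q \<in> nnrat \<Longrightarrow> x q \<omega> \<le> 1"
  using x_cond unfolding is_cond_def by blast+

lemma x_int:
  assumes q: "q \<in> nnrat" and g: "g \<in> borel_measurable (HM q)" "\<And>\<omega>. \<omega> \<in> space P \<Longrightarrow> \<bar>g \<omega>\<bar> \<le> c"
  shows "(\<integral>\<omega>. g \<omega> * indicator E \<omega> \<partial>P) = (\<integral>\<omega>. g \<omega> * x q \<omega> \<partial>P)"
  using conjunct2[OF conjunct2[OF x_cond[OF q, unfolded is_cond_def]]] g by blast

lemma x_P: "q \<in> nnrat \<Longrightarrow> x q \<in> borel_measurable P"
  using x_HM measurable_HM_P by auto

text \<open>Conditionally on the past, a reset of the anchor lowers the mean of \<open>(1\<^sub>E - a)\<^sup>2\<close> by the squared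
  size of the move.\<close>

lemma gcount_integral_le:
  assumes "sorted qs" "set qs \<subseteq> nnrat" "0 \<le> p" "\<forall>q\<in>set qs. p \<le> q" "e > 0"
    and "a \<in> borel_measurable (HM p)" "\<And>\<omega>. 0 \<le> a \<omega> \<and> a \<omega> \<le> 1"
  shows "e\<^sup>2 * (\<integral>\<omega>. gcount e (a \<omega>) (map (\<lambda>q. x q \<omega>) qs) \<partial>P) \<le> (\<integral>\<omega>. (indicator E \<omega> - a \<omega>)\<^sup>2 \<partial>P)"
  using assms
proof (induction qs arbitrary: p a)
  case Nil
  then show ?case by simp
next
  case (Cons q qs)
  have q: "q \<in> nnrat" "0 \<le> q" "p \<le> q" "0 \<le> p" using Cons.prems(2-4) by simp_all
  have am: "a \<in> borel_measurable (HM p)" by (rule Cons.prems(6))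
  note [measurable] = E
  have aq: "a \<in> borel_measurable (HM q)"
    by (rule measurable_HM_mono[OF q(4) q(3) am])
  have ab: "0 \<le> a \<omega>" "a \<omega> \<le> 1" for \<omega> using Cons.prems(7)[of \<omega>] by simp_all
  have [measurable]: "a \<in> borel_measurable P" by (rule measurable_HM_P[OF q(2) aq])
  have [measurable]: "x q \<in> borel_measurable P" by (rule x_P[OF q(1)])
  define b where "b = (\<lambda>\<omega>. if e \<le> \<bar>x q \<omega> - a \<omega>\<bar> then x q \<omega> else a \<omega>)"
  define g where "g = (\<lambda>\<omega>. if e \<le> \<bar>x q \<omega> - a \<omega>\<bar> then x q \<omega> - a \<omega> else 0)"
  define r where "r = (\<lambda>\<omega>. if e \<le> \<bar>x q \<omega> - a \<omega>\<bar> then 1 else (0::real))"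
  have [measurable]: "b \<in> borel_measurable P" "g \<in> borel_measurable P" "r \<in> borel_measurable P"
    unfolding b_def g_def r_def by measurable
  have bq: "b \<in> borel_measurable (HM q)" "g \<in> borel_measurable (HM q)"
  proof -
    note [measurable] = aq x_HM[OF q(1)]
    show "b \<in> borel_measurable (HM q)" "g \<in> borel_measurable (HM q)"
      unfolding b_def g_def by measurable
  qed
  have bb: "0 \<le> b \<omega> \<and> b \<omega> \<le> 1" for \<omega>
    using ab[of \<omega>] x_ge[OF q(1), of \<omega>] x_le[OF q(1), of \<omega>] by (simp add: b_def)
  have gb: "\<bar>g \<omega>\<bar> \<le> 1" for \<omega> unfolding g_def using ab[of \<omega>] x_ge[OF q(1), of \<omega>] x_le[OF q(1), of \<omega>] by auto
  let ?c = "\<lambda>b qs \<omega>. real (gcount e (b \<omega>) (map (\<lambda>q. x q \<omega>) qs))"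
  have split: "?c a (q # qs) \<omega> = r \<omega> + ?c b qs \<omega>" for \<omega> unfolding r_def b_def by auto
  have cm[measurable]: "?c b qs \<in> borel_measurable P"
    by (rule borel_measurable_gcount) (use x_P Cons.prems(2) in auto)
  have ci: "integrable P (?c b qs)"
    by (rule bounded_integrable[of _ "length qs"]) (use gcount_le_length[of e _ "map _ qs"] in \<open>auto simp del: gcount.simps\<close>)
  have ri: "integrable P r" by (rule bounded_integrable[of _ 1]) (auto simp: r_def)
  have IH: "e\<^sup>2 * (\<integral>\<omega>. ?c b qs \<omega> \<partial>P) \<le> (\<integral>\<omega>. (indicator E \<omega> - b \<omega>)\<^sup>2 \<partial>P)"
    by (rule Cons.IH[of q b]) (use Cons.prems q bq bb in auto)
  have i1: "integrable P (\<lambda>\<omega>. (indicator E \<omega> - b \<omega>)\<^sup>2)"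
    by (rule bounded_integrable[of _ 1])
      (use bb in \<open>auto simp: indicator_def power_le_one_iff abs_square_le_1 split: if_splits\<close>)
  have gi: "integrable P (\<lambda>\<omega>. g \<omega> * h \<omega>)" if [measurable]: "h \<in> borel_measurable P" and h: "\<And>\<omega>. \<bar>h \<omega>\<bar> \<le> 1" for h
    by (rule bounded_integrable[of _ 1]) (use gb h in \<open>auto simp: abs_mult intro!: mult_le_one\<close>)
  have i2: "integrable P (\<lambda>\<omega>. g \<omega> * indicator E \<omega>)" "integrable P (\<lambda>\<omega>. g \<omega> * x q \<omega>)" "integrable P (\<lambda>\<omega>. g \<omega> * a \<omega>)"
    using x_ge[OF q(1)] x_le[OF q(1)] ab by (auto intro!: gi simp: indicator_def)
  \<comment> \<open>Here b = a + g, and b = x q wherever g is nonzero, so (1_E - a)^2 - (1_E - b)^2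
    = g (2 1_E - x q - a). As g is known at time q, under the integral 1_E becomes x q, and g (x q -
    a) = g^2 remains.\<close>
  have "(indicator E \<omega> - a \<omega>)\<^sup>2 = (indicator E \<omega> - b \<omega>)\<^sup>2 + (2 * (g \<omega> * indicator E \<omega>) - g \<omega> * x q \<omega> - g \<omega> * a \<omega>)" for \<omega>
    unfolding b_def g_def by (auto simp: algebra_simps power2_eq_square)
  then have "(\<integral>\<omega>. (indicator E \<omega> - a \<omega>)\<^sup>2 \<partial>P) = (\<integral>\<omega>. (indicator E \<omega> - b \<omega>)\<^sup>2 \<partial>P)
      + (2 * (\<integral>\<omega>. g \<omega> * indicator E \<omega> \<partial>P) - (\<integral>\<omega>. g \<omega> * x q \<omega> \<partial>P) - (\<integral>\<omega>. g \<omega> * a \<omega> \<partial>P))"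
    using i1 i2 by simp
  also have "(\<integral>\<omega>. g \<omega> * indicator E \<omega> \<partial>P) = (\<integral>\<omega>. g \<omega> * x q \<omega> \<partial>P)"
    using x_int[OF q(1) bq(2)] gb by blast
  also have "2 * (\<integral>\<omega>. g \<omega> * x q \<omega> \<partial>P) - (\<integral>\<omega>. g \<omega> * x q \<omega> \<partial>P) - (\<integral>\<omega>. g \<omega> * a \<omega> \<partial>P) = (\<integral>\<omega>. g \<omega> * x q \<omega> - g \<omega> * a \<omega> \<partial>P)"
    using i2 by simp
  finally have eq: "(\<integral>\<omega>. (indicator E \<omega> - a \<omega>)\<^sup>2 \<partial>P) = (\<integral>\<omega>. (indicator E \<omega> - b \<omega>)\<^sup>2 \<partial>P) + (\<integral>\<omega>. g \<omega> * x q \<omega> - g \<omega> * a \<omega> \<partial>P)" .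
  have "e\<^sup>2 * r \<omega> \<le> g \<omega> * x q \<omega> - g \<omega> * a \<omega>" for \<omega>
  proof (cases "e \<le> \<bar>x q \<omega> - a \<omega>\<bar>")
    case True
    then have "e\<^sup>2 \<le> (x q \<omega> - a \<omega>)\<^sup>2" using \<open>e > 0\<close> by (metis abs_le_square_iff abs_of_pos)
    then show ?thesis using True by (simp add: r_def g_def power2_eq_square algebra_simps)
  qed (simp add: r_def g_def)
  then have "(\<integral>\<omega>. e\<^sup>2 * r \<omega> \<partial>P) \<le> (\<integral>\<omega>. g \<omega> * x q \<omega> - g \<omega> * a \<omega> \<partial>P)"
    by (intro integral_mono) (use ri i2 in auto)
  then show ?case
    unfolding split using IH ci ri eq by (simp add: distrib_left)
qed

definition bad :: "real \<Rightarrow> nat \<Rightarrow> 'a set" where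
  "bad e k = {\<omega> \<in> space P. \<exists>qs. osc_chain (\<lambda>q. x q \<omega>) e qs \<and> 2 * k \<le> length qs}"

end

section \<open>The exceptional set of unbounded oscillation\<close>

lemma sets_osc:
  assumes "\<And>q. q \<in> set qs \<Longrightarrow> x q \<in> borel_measurable N"
  shows "{\<omega> \<in> space N. osc e (map (\<lambda>q. x q \<omega> :: real) qs)} \<in> sets N"
  using assms
proof (induction qs rule: induct_list012)
  case (3 p q qs)
  have [measurable]: "x p \<in> borel_measurable N" "x q \<in> borel_measurable N" using 3 by simp_all
  have "{\<omega> \<in> space N. osc e (map (\<lambda>q. x q \<omega>) (p # q # qs))} =
    {\<omega> \<in> space N. 2 * e \<le> \<bar>x p \<omega> - x q \<omega>\<bar>} \<inter> {\<omega> \<in> space N. osc e (map (\<lambda>q. x q \<omega>) qs)}" by auto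
  moreover have "{\<omega> \<in> space N. 2 * e \<le> \<bar>x p \<omega> - x q \<omega>\<bar>} \<in> sets N" by measurable
  ultimately show ?case using 3 by auto
qed auto

lemma countable_nnrat: "countable nnrat"
  using countable_rat by auto

lemma infinite_nnrat: "infinite nnrat"
proof
  assume "finite nnrat"
  then have "finite (real ` (UNIV::nat set))" by (rule rev_finite_subset) (auto simp: image_def)
  then show False by (simp add: finite_image_iff inj_on_def)
qed

definition drat :: "nat \<Rightarrow> real" where "drat = from_nat_into nnrat"

lemma range_drat: "range drat = nnrat"
  unfolding drat_def by (rule range_from_nat_into) (use infinite_nnrat countable_nnrat in auto)

lemma drat_nnrat: "drat n \<in> nnrat"
  using range_drat by blast

lemma finite_subset_drat:
  assumes "finite A" "A \<subseteq> nnrat" shows "\<exists>n. A \<subseteq> drat ` {..<n}"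
proof -
  have "A \<subseteq> range drat" using assms range_drat by simp
  then obtain I where I: "finite I" "A = drat ` I" using finite_subset_image[OF assms(1)] by metis
  then obtain n where "I \<subseteq> {..<n}" using finite_nat_iff_bounded by auto
  then show ?thesis using I by blast
qed

context rational_martingale begin

definition good :: "'a set" where "good = {\<omega> \<in> space P. osc_bounded (\<lambda>q. x q \<omega>)}"

lemma bad_sets:
  assumes "\<And>q. q \<in> nnrat \<Longrightarrow> x q \<in> borel_measurable N" "space N = space P"
  shows "bad e k \<in> sets N"
proof -
  have "bad e k = (\<Union>qs\<in>{qs\<in>lists nnrat. sorted_wrt (<) qs \<and> 2 * k \<le> length qs}. {\<omega> \<in> space N. osc e (map (\<lambda>q. x q \<omega>) qs)})"
    unfolding bad_def osc_chain_def assms(2) by auto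
  also have "\<dots> \<in> sets N"
  proof (rule sets.countable_UN'')
    show "countable {qs\<in>lists nnrat. sorted_wrt (<) qs \<and> 2 * k \<le> length qs}"
      by (rule countable_subset[OF _ countable_lists[OF countable_nnrat]]) auto
    show "{\<omega> \<in> space N. osc e (map (\<lambda>q. x q \<omega>) qs)} \<in> sets N" if "qs \<in> {qs\<in>lists nnrat. sorted_wrt (<) qs \<and> 2 * k \<le> length qs}" for qs
      by (rule sets_osc) (use that assms(1) in auto)
  qed
  finally show ?thesis .
qed

lemma bad_measure:
  assumes e: "e > 0"
  shows "e\<^sup>2 * (real k * measure P (bad e k)) \<le> 1"
proof -
  define B where "B n = {\<omega> \<in> space P. \<exists>qs. osc_chain (\<lambda>q. x q \<omega>) e qs \<and> 2 * k \<le> length qs \<and> set qs \<subseteq> drat ` {..<n}}" for n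
  have bad: "bad e k = (\<Union>n. B n)"
  proof
    show "bad e k \<subseteq> (\<Union>n. B n)"
    proof
      fix \<omega> assume "\<omega> \<in> bad e k"
      then obtain qs where qs: "\<omega> \<in> space P" "osc_chain (\<lambda>q. x q \<omega>) e qs" "2 * k \<le> length qs" unfolding bad_def by blast
      then obtain n where "set qs \<subseteq> drat ` {..<n}" using finite_subset_drat[OF finite_set] unfolding osc_chain_def by blast
      then show "\<omega> \<in> (\<Union>n. B n)" unfolding B_def using qs by blast
    qed
    show "(\<Union>n. B n) \<subseteq> bad e k" unfolding B_def bad_def by blast
  qed
  have Bs: "B n \<in> sets P" for n
  proof -
    have "B n = (\<Union>qs\<in>{qs\<in>lists nnrat. sorted_wrt (<) qs \<and> 2 * k \<le> length qs \<and> set qs \<subseteq> drat ` {..<n}}. {\<omega> \<in> space P. osc e (map (\<lambda>q. x q \<omega>) qs)})"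
      unfolding B_def osc_chain_def by auto
    also have "\<dots> \<in> sets P"
    proof (rule sets.countable_UN'')
      show "countable {qs\<in>lists nnrat. sorted_wrt (<) qs \<and> 2 * k \<le> length qs \<and> set qs \<subseteq> drat ` {..<n}}"
        by (rule countable_subset[OF _ countable_lists[OF countable_nnrat]]) auto
      show "{\<omega> \<in> space P. osc e (map (\<lambda>q. x q \<omega>) qs)} \<in> sets P" if "qs \<in> {qs\<in>lists nnrat. sorted_wrt (<) qs \<and> 2 * k \<le> length qs \<and> set qs \<subseteq> drat ` {..<n}}" for qs
        by (rule sets_osc) (use that x_P in auto)
    qed
    finally show ?thesis .
  qed
  have inc: "incseq B"
  proof (rule incseq_SucI)
    fix n
    have "drat ` {..<n} \<subseteq> drat ` {..<Suc n}" by auto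
    then show "B n \<subseteq> B (Suc n)" unfolding B_def by blast
  qed
  have main: "e\<^sup>2 * (real k * measure P (B n)) \<le> 1" for n
  proof -
    define ts where "ts = sorted_list_of_set (drat ` {..<n})"
    have ts: "sorted ts" "set ts = drat ` {..<n}" unfolding ts_def by simp_all
    have tsp: "set ts \<subseteq> nnrat" using ts(2) drat_nnrat by auto
    let ?g = "\<lambda>\<omega>. real (gcount e 0 (map (\<lambda>q. x q \<omega>) ts))"
    have gm [measurable]: "?g \<in> borel_measurable P"
      by (rule borel_measurable_gcount) (use tsp x_P in auto)
    have gi: "integrable P ?g"
      by (rule bounded_integrable[of _ "length ts"]) (use gcount_le_length[of e _ "map _ ts"] in auto)
    have kB: "real k * indicator (B n) \<omega> \<le> ?g \<omega>" if "\<omega> \<in> space P" for \<omega>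
    proof (cases "\<omega> \<in> B n")
      case True
      then obtain qs where qs: "osc_chain (\<lambda>q. x q \<omega>) e qs" "2 * k \<le> length qs" "set qs \<subseteq> set ts"
        unfolding B_def ts(2) by blast
      have "subseq qs ts" by (rule sorted_subset_imp_subseq) (use qs ts in \<open>auto simp: osc_chain_def\<close>)
      then have "subseq (map (\<lambda>q. x q \<omega>) qs) (map (\<lambda>q. x q \<omega>) ts)" by (rule subseq_map)
      then have "length (map (\<lambda>q. x q \<omega>) qs) \<le> 2 * gcount e 0 (map (\<lambda>q. x q \<omega>) ts)"
        by (rule osc_length_le_gcount) (use qs in \<open>simp add: osc_chain_def\<close>)
      then show ?thesis using True qs(2) by simp
    qed simp
    have "real k * measure P (B n) = (\<integral>\<omega>. real k * indicator (B n) \<omega> \<partial>P)" using Bs by simp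
    also have "\<dots> \<le> (\<integral>\<omega>. ?g \<omega> \<partial>P)"
    proof (rule integral_mono[OF _ gi kB])
      show "integrable P (\<lambda>\<omega>. real k * indicator (B n) \<omega>)"
        by (rule bounded_integrable[of _ "real k"]) (use Bs[of n] in \<open>simp_all split: split_indicator\<close>)
    qed
    finally have "e\<^sup>2 * (real k * measure P (B n)) \<le> e\<^sup>2 * (\<integral>\<omega>. ?g \<omega> \<partial>P)" by (simp add: mult_left_mono)
    \<comment> \<open>Starting with anchor 0 at time 0 makes the right-hand side P(E).\<close>
    also have "\<dots> \<le> (\<integral>\<omega>. (indicator E \<omega> - 0)\<^sup>2 \<partial>P)"
      by (rule gcount_integral_le[of ts 0 e "\<lambda>_. 0"]) (use ts tsp e in auto)
    also have "\<dots> = (\<integral>\<omega>. indicator E \<omega> \<partial>P)"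
      by (rule Bochner_Integration.integral_cong) (simp_all add: indicator_def)
    also have "\<dots> = measure P E" using E by simp
    finally show ?thesis using prob_le_1[of E] by linarith
  qed
  have "(\<lambda>n. measure P (B n)) \<longlonglongrightarrow> measure P (\<Union>n. B n)"
    by (rule finite_Lim_measure_incseq) (use Bs inc in auto)
  then have "(\<lambda>n. e\<^sup>2 * (real k * measure P (B n))) \<longlonglongrightarrow> e\<^sup>2 * (real k * measure P (\<Union>n. B n))"
    by (intro tendsto_intros)
  then show ?thesis unfolding bad by (rule LIMSEQ_le_const2) (use main in auto)
qed

lemma good_eq: "space P - good = (\<Union>m. \<Inter>k. bad (1 / Suc m) k)"
proof -
  have "(\<nexists>k. \<forall>qs. osc_chain f e qs \<longrightarrow> length qs \<le> k) \<longleftrightarrow> (\<forall>k. \<exists>qs. osc_chain f e qs \<and> 2 * k \<le> length qs)" for f e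
  proof
    assume A: "\<nexists>k. \<forall>qs. osc_chain f e qs \<longrightarrow> length qs \<le> k"
    show "\<forall>k. \<exists>qs. osc_chain f e qs \<and> 2 * k \<le> length qs"
    proof
      fix k show "\<exists>qs. osc_chain f e qs \<and> 2 * k \<le> length qs" using A by (meson nat_le_linear)
    qed
  next
    assume A: "\<forall>k. \<exists>qs. osc_chain f e qs \<and> 2 * k \<le> length qs"
    show "\<nexists>k. \<forall>qs. osc_chain f e qs \<longrightarrow> length qs \<le> k"
    proof
      assume "\<exists>k. \<forall>qs. osc_chain f e qs \<longrightarrow> length qs \<le> k"
      then obtain k where k: "\<forall>qs. osc_chain f e qs \<longrightarrow> length qs \<le> k" by blast
      obtain qs where "osc_chain f e qs" "2 * Suc k \<le> length qs" using A by blast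
      then show False using k by fastforce
    qed
  qed
  note eq = this
  show ?thesis
  proof (rule set_eqI)
    fix \<omega>
    have "\<omega> \<in> space P - good \<longleftrightarrow> \<omega> \<in> space P \<and> (\<exists>m. \<nexists>k. \<forall>qs. osc_chain (\<lambda>q. x q \<omega>) (1 / real (Suc m)) qs \<longrightarrow> length qs \<le> k)"
      unfolding good_def osc_bounded_def by blast
    then show "\<omega> \<in> space P - good \<longleftrightarrow> \<omega> \<in> (\<Union>m. \<Inter>k. bad (1 / Suc m) k)"
      unfolding eq bad_def by blast
  qed
qed

text \<open>\<open>null_sets_H\<close> speaks about the terminal sigma-algebra, so measurability
  with respect to P alone would not place this set in \<open>H 0\<close>.\<close>

lemma good_Finf: "space P - good \<in> os_Finf (space P) H"
proof -
  let ?N = "sigma (space P) (os_Finf (space P) H)"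
  have sub: "(\<Union>t\<in>{0..}. H t) \<subseteq> Pow (space P)" using H_sets sets.sets_into_space by fastforce
  have "sigma_algebra (space P) (os_Finf (space P) H)"
    unfolding os_Finf_def by (rule sigma_algebra_sigma_sets[OF sub])
  then have sN: "sets ?N = os_Finf (space P) H" by (rule sigma_algebra.sets_measure_of_eq)
  have "x q \<in> borel_measurable ?N" if "q \<in> nnrat" for q
  proof (rule measurable_from_subalg[OF _ x_HM[OF that]])
    show "subalgebra ?N (HM q)" unfolding subalgebra_def
    proof
      show "space (HM q) = space ?N" by (simp add: space_measure_of_conv)
      have "H q \<subseteq> (\<Union>t\<in>{0..}. H t)" using that by auto
      then show "sets (HM q) \<subseteq> sets ?N" unfolding sN unfolding os_Finf_def using that by auto
    qed
  qed
  then have "bad e k \<in> sets ?N" for e k by (intro bad_sets) (auto simp: space_measure_of_conv)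
  then have "(\<Union>m. \<Inter>k. bad (1 / Suc m) k) \<in> sets ?N" by (intro sets.countable_UN sets.countable_INT) auto
  then show ?thesis unfolding good_eq sN .
qed

text \<open>For each of the countably many thresholds, \<open>bad_measure\<close> decays like 1 /
  k.\<close>

lemma good_null: "emeasure P (space P - good) = 0"
proof -
  have "(\<Inter>k. bad e k) \<in> null_sets P" if e: "e > 0" for e
  proof (rule null_setsI)
    have s: "bad e k \<in> sets P" for k by (rule bad_sets[OF x_P]) auto
    show "(\<Inter>k. bad e k) \<in> sets P" using s by auto
    have "measure P (\<Inter>k. bad e k) \<le> 1 / e\<^sup>2 * (1 / Suc k)" for k
    proof -
      have "e\<^sup>2 * (real (Suc k) * measure P (\<Inter>k. bad e k)) \<le> e\<^sup>2 * (real (Suc k) * measure P (bad e (Suc k)))"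
        by (intro mult_left_mono finite_measure_mono) (use s in auto)
      also have "\<dots> \<le> 1" by (rule bad_measure[OF e])
      finally have *: "(e\<^sup>2 * real (Suc k)) * measure P (\<Inter>k. bad e k) \<le> 1" by (simp only: mult.assoc)
      have "measure P (\<Inter>k. bad e k) \<le> 1 / (e\<^sup>2 * real (Suc k))"
        using * e by (subst pos_le_divide_eq) (simp_all only: mult.commute, simp)
      then show ?thesis by simp
    qed
    moreover have "(\<lambda>k. 1 / e\<^sup>2 * (1 / Suc k)) \<longlonglongrightarrow> 1 / e\<^sup>2 * 0"
      using LIMSEQ_inverse_real_of_nat by (intro tendsto_intros) (simp add: inverse_eq_divide)
    ultimately have "measure P (\<Inter>k. bad e k) \<le> 0" by (intro LIMSEQ_le_const) auto
    then show "emeasure P (\<Inter>k. bad e k) = 0" by (simp add: emeasure_eq_measure measure_le_0_iff)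
  qed
  then have "(\<Union>m. \<Inter>k. bad (1 / Suc m) k) \<in> null_sets P" by (intro null_sets_UN) auto
  then show ?thesis unfolding good_eq by auto
qed

section \<open>Right limits as an adapted cadlag process\<close>

lemma good_H: "0 \<le> t \<Longrightarrow> good \<in> H t"
proof -
  have "space P - good \<in> sets (HM 0)" using null_sets_H[OF good_Finf good_null] by simp
  then have "space (HM 0) - (space P - good) \<in> sets (HM 0)" by (rule sets.compl_sets)
  moreover have "space P - (space P - good) = good" unfolding good_def by auto
  ultimately have "good \<in> H 0" by simp
  then show "0 \<le> t \<Longrightarrow> good \<in> H t" using H_mono[of 0 t good] by simp
qed

text \<open>The limit runs over rationals strictly above t, so X may differ from x at a rational
  time; what survives is the conditional expectation property (\<open>X_int\<close>). The value 0
  off the good set keeps X adapted because \<open>good\<close> belongs to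
  \<open>H 0\<close>.\<close>

definition X :: "real \<Rightarrow> 'a \<Rightarrow> real" where
  "X t \<omega> = (if \<omega> \<in> good then Lim (at t within (nnrat \<inter> {t<..})) (\<lambda>q. x q \<omega>) else 0)"

lemma X_lim:
  assumes "\<omega> \<in> good" "0 \<le> t"
  shows "((\<lambda>q. x q \<omega>) \<longlongrightarrow> X t \<omega>) (at t within (nnrat \<inter> {t<..}))"
proof -
  obtain l where "((\<lambda>q. x q \<omega>) \<longlongrightarrow> l) (at t within (nnrat \<inter> {t<..}))"
    using osc_bounded_right_limit[OF _ assms(2)] assms(1) unfolding good_def by blast
  moreover from this have "X t \<omega> = l" unfolding X_def
    using assms tendsto_Lim[OF at_right_rat_nonbot[OF assms(2)]] by simp
  ultimately show ?thesis by simp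
qed

lemma X_seq:
  assumes "\<omega> \<in> good" "0 \<le> t" "\<And>n. r n \<in> nnrat" "\<And>n. t < r n" "r \<longlonglongrightarrow> t"
  shows "(\<lambda>n. x (r n) \<omega>) \<longlonglongrightarrow> X t \<omega>"
  by (rule filterlim_compose[OF X_lim[OF assms(1,2)] filterlim_at_right_rat[OF assms(3-5)]])

lemma X_bounds: "0 \<le> t \<Longrightarrow> 0 \<le> X t \<omega> \<and> X t \<omega> \<le> 1"
proof (cases "\<omega> \<in> good")
  case True
  assume t: "0 \<le> t"
  obtain r where r: "\<And>n. r n \<in> nnrat" "\<And>n. t < r n" "\<And>n. r n < t + 1" "r \<longlonglongrightarrow> t"
    using rat_seq_right[OF t, of "t + 1"] by (metis less_add_one)
  have l: "(\<lambda>n. x (r n) \<omega>) \<longlonglongrightarrow> X t \<omega>" by (rule X_seq[OF True t r(1,2,4)])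
  have "0 \<le> X t \<omega>" by (rule LIMSEQ_le_const[OF l]) (use x_ge r(1) in auto)
  moreover have "X t \<omega> \<le> 1" by (rule LIMSEQ_le_const2[OF l]) (use x_le r(1) in auto)
  ultimately show ?thesis by simp
qed (simp add: X_def)

text \<open>A rational sequence between t and s shows that X t is known at every s > t, which
  suffices by right-continuity of H.\<close>

lemma X_adapted: "os_adapted (space P) H X"
  unfolding adapted_iff
proof (intro allI impI)
  fix t :: real assume t: "0 \<le> t"
  show "X t \<in> borel_measurable (HM t)"
  proof (rule measurable_HM_right[OF t])
    fix s assume s: "t < s"
    obtain r where r: "\<And>n. r n \<in> nnrat" "\<And>n. t < r n" "\<And>n. r n < s" "r \<longlonglongrightarrow> t"
      using rat_seq_right[OF t s] by metis
    have "X t = (\<lambda>\<omega>. if \<omega> \<in> good then lim (\<lambda>n. x (r n) \<omega>) else 0)"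
    proof
      fix \<omega> show "X t \<omega> = (if \<omega> \<in> good then lim (\<lambda>n. x (r n) \<omega>) else 0)"
      proof (cases "\<omega> \<in> good")
        case True
        show ?thesis using limI[OF X_seq[OF True t r(1,2,4)]] True by simp
      qed (simp add: X_def)
    qed
    moreover have "(\<lambda>\<omega>. if \<omega> \<in> good then lim (\<lambda>n. x (r n) \<omega>) else 0) \<in> borel_measurable (HM s)"
    proof -
      have [measurable]: "good \<in> sets (HM s)" using good_H[of s] t s by simp
      have [measurable]: "x (r n) \<in> borel_measurable (HM s)" for n
        by (rule measurable_HM_mono[OF _ _ x_HM[OF r(1)]]) (use r(1)[of n] r(3)[of n] in auto)
      show ?thesis by measurable
    qed
    ultimately show "X t \<in> borel_measurable (HM s)" by simp
  qed
qed

lemma X_cadlag: "os_cadlag (space P) X"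
  unfolding os_cadlag_def
proof (intro ballI allI impI)
  fix \<omega> t assume w: "\<omega> \<in> space P" and t: "0 \<le> (t::real)"
  show "((\<lambda>s. X s \<omega>) \<longlongrightarrow> X t \<omega>) (at_right t) \<and> (0 < t \<longrightarrow> (\<exists>l. ((\<lambda>s. X s \<omega>) \<longlongrightarrow> l) (at_left t)))"
  proof (cases "\<omega> \<in> good")
    case True
    have L: "((\<lambda>q. x q \<omega>) \<longlongrightarrow> X t \<omega>) (at t within (nnrat \<inter> {t<..}))" if "0 \<le> t" for t
      by (rule X_lim[OF True that])
    have ob: "osc_bounded (\<lambda>q. x q \<omega>)" using True by (simp add: good_def)
    show ?thesis
      using right_limits_right_continuous[where L="\<lambda>t. X t \<omega>", OF L t]
        right_limits_left_limit[where L="\<lambda>t. X t \<omega>", OF L] osc_bounded_left_limit[OF ob] by meson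
  next
    case False
    then have "X s \<omega> = 0" for s by (simp add: X_def)
    then show ?thesis by auto
  qed
qed

text \<open>Along rationals r n > t tending to t, B belongs to every \<open>H (r n)\<close>, so all
  integrals against x (r n) equal P(E \<inter> B); dominated convergence passes to X t.\<close>

lemma X_int:
  assumes t: "0 \<le> t" and B: "B \<in> H t"
  shows "(\<integral>\<omega>. indicator B \<omega> * X t \<omega> \<partial>P) = measure P (E \<inter> B)"
proof -
  obtain r where r: "\<And>n. r n \<in> nnrat" "\<And>n. t < r n" "\<And>n. r n < t + 1" "r \<longlonglongrightarrow> t"
    using rat_seq_right[OF t, of "t + 1"] by (metis less_add_one)
  have BP [measurable]: "B \<in> sets P" using H_sets[OF t B] .
  have "X t \<in> borel_measurable (HM t)" using X_adapted t unfolding adapted_iff by blast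
  then have XP [measurable]: "X t \<in> borel_measurable P" by (rule measurable_HM_P[OF t])
  have xP [measurable]: "x (r n) \<in> borel_measurable P" for n by (rule x_P[OF r(1)])
  have "(\<lambda>n. \<integral>\<omega>. indicator B \<omega> * x (r n) \<omega> \<partial>P) \<longlonglongrightarrow> (\<integral>\<omega>. indicator B \<omega> * X t \<omega> \<partial>P)"
  proof (rule integral_dominated_convergence[where w="\<lambda>_. 1"])
    have "AE \<omega> in P. \<omega> \<in> good"
    proof (rule AE_I[where N="space P - good"])
      show "space P - good \<in> sets P" using Finf_sets good_Finf by simp
    qed (use good_null in auto)
    then show "AE \<omega> in P. (\<lambda>n. indicator B \<omega> * x (r n) \<omega>) \<longlonglongrightarrow> indicator B \<omega> * X t \<omega>"
    proof eventually_elim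
      case (elim \<omega>)
      show ?case by (intro tendsto_intros X_seq[OF elim t r(1,2,4)])
    qed
    show "AE \<omega> in P. norm (indicator B \<omega> * x (r n) \<omega>) \<le> 1" for n
      by (intro AE_I2) (use x_ge[OF r(1)[of n]] x_le[OF r(1)[of n]] in \<open>simp add: indicator_def\<close>)
  qed simp_all
  moreover have "(\<integral>\<omega>. indicator B \<omega> * x (r n) \<omega> \<partial>P) = measure P (E \<inter> B)" for n
  proof -
    have rn: "0 \<le> r n" using r(1)[of n] by simp
    have "B \<in> H (r n)" by (rule H_mono[OF t _ B]) (use r(2)[of n] in simp)
    then have "B \<in> sets (HM (r n))" by (simp only: sets_HM[OF rn])
    then have m: "(indicator B :: 'a \<Rightarrow> real) \<in> borel_measurable (HM (r n))" by (rule borel_measurable_indicator)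
    have "(\<integral>\<omega>. indicator B \<omega> * (indicator E \<omega> :: real) \<partial>P) = (\<integral>\<omega>. indicator B \<omega> * x (r n) \<omega> \<partial>P)"
      by (rule x_int[OF r(1) m, where c=1]) (auto simp: indicator_def)
    moreover have "(\<integral>\<omega>. indicator B \<omega> * (indicator E \<omega> :: real) \<partial>P) = measure P (E \<inter> B)"
    proof -
      have "(\<integral>\<omega>. indicator B \<omega> * (indicator E \<omega> :: real) \<partial>P) = (\<integral>\<omega>. indicator (E \<inter> B) \<omega> \<partial>P)"
        by (rule Bochner_Integration.integral_cong) (auto simp: indicator_def)
      also have "\<dots> = measure P (E \<inter> B)" using sets.Int[OF E BP] by simp
      finally show ?thesis .
    qed
    ultimately show ?thesis by (simp only:)
  qed
  ultimately have "(\<lambda>n::nat. measure P (E \<inter> B)) \<longlonglongrightarrow> (\<integral>\<omega>. indicator B \<omega> * X t \<omega> \<partial>P)" by (simp only:)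
  then show ?thesis by (rule LIMSEQ_unique) (rule tendsto_const)
qed

end

context usual_conditions begin

text \<open>\<open>X\<close> is a cadlag version of the martingale \<open>t \<mapsto> P(E | H\<^sub>t)\<close>.\<close>

definition cver :: "'a set \<Rightarrow> (real \<Rightarrow> 'a \<Rightarrow> real) \<Rightarrow> bool" where
  "cver E X \<longleftrightarrow> os_adapted (space P) H X \<and> os_cadlag (space P) X \<and>
    (\<forall>t\<ge>0. integrable P (X t)) \<and>
    (\<forall>t\<ge>0. \<forall>B\<in>H t. (\<integral>\<omega>. indicator B \<omega> * X t \<omega> \<partial>P) = measure P (E \<inter> B))"

text \<open>The bounds stay outside \<open>cver\<close>, which has to be closed under differences
  and sums. They are used in \<open>cver_AE_nonneg\<close> and where a local martingale must become
  a martingale.\<close>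

lemma ex_cver:
  assumes E: "E \<in> sets P"
  shows "\<exists>X. cver E X \<and> (\<forall>t \<omega>. 0 \<le> t \<longrightarrow> 0 \<le> X t \<omega> \<and> X t \<omega> \<le> 1)"
proof -
  have "\<forall>q. \<exists>x. q \<in> nnrat \<longrightarrow> is_cond E q x" using ex_is_cond[OF E] by simp
  then obtain x where x: "\<And>q. q \<in> nnrat \<Longrightarrow> is_cond E q (x q)" by metis
  interpret R: rational_martingale P H E x
    by unfold_locales (fact E, rule x)
  have "integrable P (R.X t)" if "0 \<le> t" for t
  proof (rule bounded_integrable[of _ 1])
    have "R.X t \<in> borel_measurable (HM t)" using R.X_adapted that unfolding adapted_iff by blast
    then show "R.X t \<in> borel_measurable P" by (rule measurable_HM_P[OF that])
    show "\<bar>R.X t \<omega>\<bar> \<le> 1" for \<omega> using R.X_bounds[OF that, of \<omega>] by simp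
  qed
  then have "cver E R.X" unfolding cver_def using R.X_adapted R.X_cadlag R.X_int by blast
  moreover have "\<forall>t \<omega>. 0 \<le> t \<longrightarrow> 0 \<le> R.X t \<omega> \<and> R.X t \<omega> \<le> 1" using R.X_bounds by blast
  ultimately show ?thesis by blast
qed

end

section \<open>Locality, positivity and maximal inequality for versions\<close>

context usual_conditions begin

lemma cver_HM: "cver E X \<Longrightarrow> 0 \<le> t \<Longrightarrow> X t \<in> borel_measurable (HM t)"
  unfolding cver_def adapted_iff by blast

lemma cver_P: "cver E X \<Longrightarrow> 0 \<le> t \<Longrightarrow> X t \<in> borel_measurable P"
  using measurable_HM_P cver_HM by blast

lemma cver_integrable: "cver E X \<Longrightarrow> 0 \<le> t \<Longrightarrow> integrable P (X t)"
  unfolding cver_def by blast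

lemma cver_int: "cver E X \<Longrightarrow> 0 \<le> t \<Longrightarrow> B \<in> H t \<Longrightarrow> (\<integral>\<omega>. indicator B \<omega> * X t \<omega> \<partial>P) = measure P (E \<inter> B)"
  unfolding cver_def by blast

lemma cver_right: "cver E X \<Longrightarrow> 0 \<le> t \<Longrightarrow> \<omega> \<in> space P \<Longrightarrow> ((\<lambda>s. X s \<omega>) \<longlongrightarrow> X t \<omega>) (at_right t)"
  unfolding cver_def os_cadlag_def by blast

lemma integrable_indicator_mult:
  fixes f :: "'a \<Rightarrow> real"
  assumes "integrable P f" "B \<in> sets P"
  shows "integrable P (\<lambda>\<omega>. indicator B \<omega> * f \<omega>)"
  using integrable_mult_indicator[OF assms(2,1)] by simp

lemma H_Int: "0 \<le> t \<Longrightarrow> A \<in> H t \<Longrightarrow> B \<in> H t \<Longrightarrow> A \<inter> B \<in> H t"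
  and H_Diff: "0 \<le> t \<Longrightarrow> A \<in> H t \<Longrightarrow> B \<in> H t \<Longrightarrow> A - B \<in> H t"
  and H_space: "0 \<le> t \<Longrightarrow> space P \<in> H t"
  using sets.Int[of A "HM t" B] sets.Diff[of A "HM t" B] sets.top[of "HM t"]
  by (simp_all only: sets_HM space_HM)

lemma AE_zero_of_integrals:
  fixes f :: "'a \<Rightarrow> real"
  assumes t: "0 \<le> t" and f: "f \<in> borel_measurable (HM t)" "integrable P f"
    and z: "\<And>B. B \<in> H t \<Longrightarrow> (\<integral>\<omega>. indicator B \<omega> * f \<omega> \<partial>P) = 0"
  shows "AE \<omega> in P. f \<omega> = 0"
proof -
  note [measurable] = f(1)
  have half: "AE \<omega> in P. g \<omega> \<le> 0" if g: "g \<in> borel_measurable (HM t)" "integrable P g"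
    "\<And>B. B \<in> H t \<Longrightarrow> (\<integral>\<omega>. indicator B \<omega> * g \<omega> \<partial>P) = 0" for g :: "'a \<Rightarrow> real"
  proof -
    define B where "B = {\<omega> \<in> space (HM t). 0 < g \<omega>}"
    have "B \<in> sets (HM t)" unfolding B_def using g(1) by measurable
    then have B: "B \<in> H t" using t by simp
    have i: "integrable P (\<lambda>\<omega>. indicator B \<omega> * g \<omega>)" by (rule integrable_indicator_mult[OF g(2) H_sets[OF t B]])
    have "AE \<omega> in P. indicator B \<omega> * g \<omega> = 0"
      using integral_nonneg_eq_0_iff_AE[OF i] g(3)[OF B] by (auto simp: B_def indicator_def)
    then show ?thesis
    proof (rule AE_mp, intro AE_I2 impI)
      fix \<omega> assume "\<omega> \<in> space P" "indicator B \<omega> * g \<omega> = 0"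
      then show "g \<omega> \<le> 0" unfolding B_def by (cases "0 < g \<omega>") auto
    qed
  qed
  have "AE \<omega> in P. f \<omega> \<le> 0" by (rule half[OF f z])
  moreover have "AE \<omega> in P. - f \<omega> \<le> 0"
  proof (rule half)
    show "(\<lambda>\<omega>. - f \<omega>) \<in> borel_measurable (HM t)" by measurable
    show "integrable P (\<lambda>\<omega>. - f \<omega>)" using f(2) by simp
    show "(\<integral>\<omega>. indicator B \<omega> * - f \<omega> \<partial>P) = 0" if "B \<in> H t" for B using z[OF that] by simp
  qed
  ultimately show ?thesis by eventually_elim simp
qed

text \<open>Conditional probabilities are local: on a set D of \<open>H t\<close> they are
  determined by the tests inside D. This is what allows the use of an sH-measure, whose information
  at time t is confined to one set of \<open>G t\<close>.\<close>

lemma cver_AE_eq_on: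
  assumes X: "cver E X" and t: "0 \<le> t" and D: "D \<in> H t"
    and Y: "Y \<in> borel_measurable (HM t)" "integrable P Y"
    and int: "\<And>B. B \<in> H t \<Longrightarrow> B \<subseteq> D \<Longrightarrow> (\<integral>\<omega>. indicator B \<omega> * Y \<omega> \<partial>P) = measure P (E \<inter> B)"
  shows "AE \<omega> in P. \<omega> \<in> D \<longrightarrow> X t \<omega> = Y \<omega>"
proof -
  have "AE \<omega> in P. indicator D \<omega> * (X t \<omega> - Y \<omega>) = 0"
  proof (rule AE_zero_of_integrals[OF t])
    note [measurable] = cver_HM[OF X t] Y(1)
    have [measurable]: "D \<in> sets (HM t)" using D t by simp
    show "(\<lambda>\<omega>. indicator D \<omega> * (X t \<omega> - Y \<omega>)) \<in> borel_measurable (HM t)" by measurable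
    show "integrable P (\<lambda>\<omega>. indicator D \<omega> * (X t \<omega> - Y \<omega>))"
      by (rule integrable_indicator_mult[OF _ H_sets[OF t D]]) (use cver_integrable[OF X t] Y(2) in simp)
    fix B assume B: "B \<in> H t"
    have BD: "B \<inter> D \<in> H t" by (rule H_Int[OF t B D])
    have i: "integrable P (\<lambda>\<omega>. indicator (B \<inter> D) \<omega> * X t \<omega>)" "integrable P (\<lambda>\<omega>. indicator (B \<inter> D) \<omega> * Y \<omega>)"
      by (rule integrable_indicator_mult[OF _ H_sets[OF t BD]], rule cver_integrable[OF X t] Y(2))+
    have "(\<integral>\<omega>. indicator B \<omega> * (indicator D \<omega> * (X t \<omega> - Y \<omega>)) \<partial>P) =
      (\<integral>\<omega>. indicator (B \<inter> D) \<omega> * X t \<omega> - indicator (B \<inter> D) \<omega> * Y \<omega> \<partial>P)"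
      by (rule Bochner_Integration.integral_cong) (simp_all add: indicator_inter_arith algebra_simps)
    also have "\<dots> = (\<integral>\<omega>. indicator (B \<inter> D) \<omega> * X t \<omega> \<partial>P) - (\<integral>\<omega>. indicator (B \<inter> D) \<omega> * Y \<omega> \<partial>P)"
      by (rule Bochner_Integration.integral_diff[OF i])
    also have "\<dots> = 0" using cver_int[OF X t BD] int[OF BD] by simp
    finally show "(\<integral>\<omega>. indicator B \<omega> * (indicator D \<omega> * (X t \<omega> - Y \<omega>)) \<partial>P) = 0" .
  qed
  then show ?thesis by eventually_elim auto
qed

text \<open>Source of the zeros that \<open>threshold_iff_vanishing\<close> asks for: the martingale
  of \<open>q < R\<close> vanishes once R has occurred.\<close>

lemma cver_AE_disjoint:
  assumes X: "cver E X" and t: "0 \<le> t" and D: "D \<in> H t" "measure P (E \<inter> D) = 0" and E: "E \<in> sets P"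
  shows "AE \<omega> in P. \<omega> \<in> D \<longrightarrow> X t \<omega> = 0"
proof (rule cver_AE_eq_on[OF X t D(1)])
  fix B assume B: "B \<in> H t" "B \<subseteq> D"
  have "measure P (E \<inter> B) \<le> measure P (E \<inter> D)"
    by (rule finite_measure_mono) (use B sets.Int[OF E H_sets[OF t D(1)]] in auto)
  then have "measure P (E \<inter> B) = 0" using D(2) measure_nonneg[of P "E \<inter> B"] by linarith
  then show "(\<integral>\<omega>. indicator B \<omega> * 0 \<partial>P) = measure P (E \<inter> B)" by simp
qed auto

lemma cver_AE_known:
  assumes X: "cver E X" and t: "0 \<le> t" and E: "E \<in> H t"
  shows "AE \<omega> in P. X t \<omega> = indicator E \<omega>"
proof -
  have "AE \<omega> in P. \<omega> \<in> space P \<longrightarrow> X t \<omega> = indicator E \<omega>"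
  proof (rule cver_AE_eq_on[OF X t H_space[OF t]])
    have "E \<in> sets (HM t)" using E t by simp
    then show "indicator E \<in> borel_measurable (HM t)" by simp
    show "integrable P (indicator E :: 'a \<Rightarrow> real)"
      using H_sets[OF t E] by (intro bounded_integrable[of _ 1]) (auto simp: indicator_def)
    fix B assume B: "B \<in> H t" "B \<subseteq> space P"
    have "(\<integral>\<omega>. indicator B \<omega> * indicator E \<omega> \<partial>P) = (\<integral>\<omega>. indicator (E \<inter> B) \<omega> \<partial>P :: real)"
      by (rule Bochner_Integration.integral_cong) (auto simp: indicator_def)
    also have "\<dots> = measure P (E \<inter> B)" using sets.Int[OF H_sets[OF t E] H_sets[OF t B(1)]] by simp
    finally show "(\<integral>\<omega>. indicator B \<omega> * indicator E \<omega> \<partial>P) = measure P (E \<inter> B)" .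
  qed
  then show ?thesis by (rule AE_mp) simp
qed

text \<open>Optional sampling at a first passage along finitely many times: when X first falls below
  d, the conditional probability of E is below d, and symmetrically for a passage above d. Summing
  over the disjoint passage events gives both inequalities.\<close>

lemma cver_first_passage:
  assumes X: "cver E X" and E: "E \<in> sets P"
    and "sorted qs" "set qs \<subseteq> nnrat" "0 \<le> p" "\<forall>q\<in>set qs. p \<le> q" "B \<in> H p"
  shows "measure P (E \<inter> (B \<inter> {\<omega>\<in>space P. \<exists>q\<in>set qs. X q \<omega> < d})) \<le> d * measure P (B \<inter> {\<omega>\<in>space P. \<exists>q\<in>set qs. X q \<omega> < d})"
    and "d * measure P (B \<inter> {\<omega>\<in>space P. \<exists>q\<in>set qs. d < X q \<omega>}) \<le> measure P (E \<inter> (B \<inter> {\<omega>\<in>space P. \<exists>q\<in>set qs. d < X q \<omega>}))"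
proof -
  \<comment> \<open>The sign s lets one induction serve both directions of passage.\<close>
  have gen: "(s = 1 \<longrightarrow> measure P (E \<inter> (B \<inter> {\<omega>\<in>space P. \<exists>q\<in>set qs. s * X q \<omega> < s * d})) \<le> d * measure P (B \<inter> {\<omega>\<in>space P. \<exists>q\<in>set qs. s * X q \<omega> < s * d})) \<and>
    (s = - 1 \<longrightarrow> d * measure P (B \<inter> {\<omega>\<in>space P. \<exists>q\<in>set qs. s * X q \<omega> < s * d}) \<le> measure P (E \<inter> (B \<inter> {\<omega>\<in>space P. \<exists>q\<in>set qs. s * X q \<omega> < s * d})))"
    for s :: real
    using assms(3-)
  proof (induction qs arbitrary: p B)
    case Nil
    then show ?case by simp
  next
    case (Cons q qs)
    have q: "0 \<le> q" "p \<le> q" using Cons.prems by auto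
    define A where "A = {\<omega>\<in>space (HM q). s * X q \<omega> < s * d}"
    define C where "C = {\<omega>\<in>space P. \<exists>q\<in>set qs. s * X q \<omega> < s * d}"
    have "A \<in> sets (HM q)" unfolding A_def using cver_HM[OF X q(1)] by measurable
    then have A: "A \<in> H q" using q by simp
    have Bq: "B \<in> H q" by (rule H_mono[OF _ q(2)]) (use Cons.prems in auto)
    have AB: "B \<inter> A \<in> H q" by (rule H_Int[OF q(1) Bq A])
    have BA: "B - A \<in> H q" by (rule H_Diff[OF q(1) Bq A])
    note ABs = H_sets[OF q(1) AB] and BAs = H_sets[OF q(1) BA]
    have "C = (\<Union>r\<in>set qs. {\<omega>\<in>space P. s * X r \<omega> < s * d})" unfolding C_def by auto
    also have "\<dots> \<in> sets P"
    proof (rule sets.finite_UN)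
      fix r assume "r \<in> set qs"
      then have "0 \<le> r" using Cons.prems by auto
      note [measurable] = cver_P[OF X this]
      show "{\<omega>\<in>space P. s * X r \<omega> < s * d} \<in> sets P" by measurable
    qed simp
    finally have Cs: "C \<in> sets P" .
    \<comment> \<open>Either the passage happens at q, or the rest \<open>B - A\<close>, which is
      known at q, is treated from q onwards by the induction hypothesis.\<close>
    have ev: "B \<inter> {\<omega>\<in>space P. \<exists>r\<in>set (q # qs). s * X r \<omega> < s * d} = (B \<inter> A) \<union> ((B - A) \<inter> C)"
      unfolding A_def C_def by auto
    have m1: "measure P ((B \<inter> A) \<union> ((B - A) \<inter> C)) = measure P (B \<inter> A) + measure P ((B - A) \<inter> C)"
      by (rule finite_measure_Union[OF ABs sets.Int[OF BAs Cs]]) auto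
    have "measure P ((E \<inter> (B \<inter> A)) \<union> (E \<inter> ((B - A) \<inter> C))) = measure P (E \<inter> (B \<inter> A)) + measure P (E \<inter> ((B - A) \<inter> C))"
      by (rule finite_measure_Union[OF sets.Int[OF E ABs] sets.Int[OF E sets.Int[OF BAs Cs]]]) auto
    moreover have "(E \<inter> (B \<inter> A)) \<union> (E \<inter> ((B - A) \<inter> C)) = E \<inter> ((B \<inter> A) \<union> ((B - A) \<inter> C))" by auto
    ultimately have m2: "measure P (E \<inter> ((B \<inter> A) \<union> ((B - A) \<inter> C))) = measure P (E \<inter> (B \<inter> A)) + measure P (E \<inter> ((B - A) \<inter> C))" by simp
    have dAB: "(\<integral>\<omega>. indicator (B \<inter> A) \<omega> * d \<partial>P) = d * measure P (B \<inter> A)" using ABs by simp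
    have iAB: "integrable P (\<lambda>\<omega>. indicator (B \<inter> A) \<omega> * d)" "integrable P (\<lambda>\<omega>. indicator (B \<inter> A) \<omega> * X q \<omega>)"
      by (rule integrable_indicator_mult[OF _ ABs], simp) (rule integrable_indicator_mult[OF cver_integrable[OF X q(1)] ABs])
    have IH: "(s = 1 \<longrightarrow> measure P (E \<inter> ((B - A) \<inter> C)) \<le> d * measure P ((B - A) \<inter> C)) \<and>
      (s = - 1 \<longrightarrow> d * measure P ((B - A) \<inter> C) \<le> measure P (E \<inter> ((B - A) \<inter> C)))"
      unfolding C_def by (rule Cons.IH[of q]) (use Cons.prems q BA in auto)
    show ?case unfolding ev m1 m2
    proof (intro conjI impI)
      assume s: "s = 1"
      have "measure P (E \<inter> (B \<inter> A)) \<le> d * measure P (B \<inter> A)"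
        unfolding cver_int[OF X q(1) AB, symmetric] dAB[symmetric]
        by (rule integral_mono[OF iAB(2,1)]) (auto simp: A_def s indicator_def)
      then show "measure P (E \<inter> (B \<inter> A)) + measure P (E \<inter> ((B - A) \<inter> C)) \<le> d * (measure P (B \<inter> A) + measure P ((B - A) \<inter> C))"
        using IH s by (simp add: distrib_left)
    next
      assume s: "s = - 1"
      have "d * measure P (B \<inter> A) \<le> measure P (E \<inter> (B \<inter> A))"
        unfolding cver_int[OF X q(1) AB, symmetric] dAB[symmetric]
        by (rule integral_mono[OF iAB]) (auto simp: A_def s indicator_def)
      then show "d * (measure P (B \<inter> A) + measure P ((B - A) \<inter> C)) \<le> measure P (E \<inter> (B \<inter> A)) + measure P (E \<inter> ((B - A) \<inter> C))"
        using IH s by (simp add: distrib_left)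
    qed
  qed
  show "measure P (E \<inter> (B \<inter> {\<omega>\<in>space P. \<exists>q\<in>set qs. X q \<omega> < d})) \<le> d * measure P (B \<inter> {\<omega>\<in>space P. \<exists>q\<in>set qs. X q \<omega> < d})"
    using gen[of 1] by simp
  show "d * measure P (B \<inter> {\<omega>\<in>space P. \<exists>q\<in>set qs. d < X q \<omega>}) \<le> measure P (E \<inter> (B \<inter> {\<omega>\<in>space P. \<exists>q\<in>set qs. d < X q \<omega>}))"
    using gen[of "- 1"] by simp
qed

lemma sets_ex_nnrat:
  assumes "\<And>q. q \<in> nnrat \<Longrightarrow> {\<omega>\<in>space P. Q q \<omega>} \<in> sets P" "I \<subseteq> nnrat"
  shows "{\<omega>\<in>space P. \<exists>q\<in>I. Q q \<omega>} \<in> sets P"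
proof -
  have "{\<omega>\<in>space P. \<exists>q\<in>I. Q q \<omega>} = (\<Union>q\<in>I. {\<omega>\<in>space P. Q q \<omega>})" by auto
  also have "\<dots> \<in> sets P"
    by (rule sets.countable_UN'') (use assms countable_subset[OF assms(2) countable_nnrat] in auto)
  finally show ?thesis .
qed

lemma measure_ex_nnrat:
  assumes "\<And>q. q \<in> nnrat \<Longrightarrow> {\<omega>\<in>space P. Q q \<omega>} \<in> sets P" "A \<in> sets P"
  shows "(\<lambda>n. measure P (A \<inter> {\<omega>\<in>space P. \<exists>q\<in>drat ` {..<n}. Q q \<omega>})) \<longlonglongrightarrow> measure P (A \<inter> {\<omega>\<in>space P. \<exists>q\<in>nnrat. Q q \<omega>})"
proof -
  have "A \<inter> {\<omega>\<in>space P. \<exists>q\<in>nnrat. Q q \<omega>} = (\<Union>n. A \<inter> {\<omega>\<in>space P. \<exists>q\<in>drat ` {..<n}. Q q \<omega>})"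
    unfolding range_drat[symmetric] by auto
  moreover have "A \<inter> {\<omega>\<in>space P. \<exists>q\<in>drat ` {..<n}. Q q \<omega>} \<in> sets P" for n
    by (rule sets.Int[OF assms(2) sets_ex_nnrat[OF assms(1)]]) (use drat_nnrat in auto)
  ultimately show ?thesis
    by (simp only:) (rule finite_Lim_measure_incseq, auto intro!: incseq_SucI)
qed

text \<open>By first passage, E and a rational value of X below d have joint probability at most d.
  Letting d tend to 0, X is bounded away from 0 along the rationals almost surely on E. A value X t
  \<le> 0 at a real time would, by right-continuity, produce rational values below every 1 / Suc
  n.\<close>

lemma cver_AE_pos:
  assumes X: "cver E X" and E: "E \<in> sets P"
  shows "AE \<omega> in P. \<omega> \<in> E \<longrightarrow> (\<forall>t\<ge>0. 0 < X t \<omega>)"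
proof -
  have s: "{\<omega>\<in>space P. X q \<omega> < d} \<in> sets P" if "q \<in> nnrat" for q d
  proof -
    have "0 \<le> q" using that by simp
    note [measurable] = cver_P[OF X this]
    show ?thesis by measurable
  qed
  define A where "A d = E \<inter> {\<omega>\<in>space P. \<exists>q\<in>nnrat. X q \<omega> < d}" for d
  have As: "A d \<in> sets P" for d unfolding A_def by (rule sets.Int[OF E sets_ex_nnrat[OF s]]) auto
  have le: "measure P (A d) \<le> d" if "0 < d" for d
  proof (rule LIMSEQ_le_const2)
    show "(\<lambda>n. measure P (E \<inter> {\<omega>\<in>space P. \<exists>q\<in>drat ` {..<n}. X q \<omega> < d})) \<longlonglongrightarrow> measure P (A d)"
      unfolding A_def by (rule measure_ex_nnrat[OF s E])
    have "measure P (E \<inter> {\<omega>\<in>space P. \<exists>q\<in>drat ` {..<n}. X q \<omega> < d}) \<le> d" for n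
    proof -
      let ?qs = "sorted_list_of_set (drat ` {..<n})"
      let ?V = "space P \<inter> {\<omega>\<in>space P. \<exists>q\<in>set ?qs. X q \<omega> < d}"
      have "measure P (E \<inter> ?V) \<le> d * measure P ?V"
        by (rule cver_first_passage(1)[OF X E, of _ 0]) (use drat_nnrat H_space in auto)
      also have "\<dots> \<le> d * 1" by (rule mult_left_mono[OF prob_le_1]) (use that in simp)
      finally show ?thesis by (simp add: Int_def cong: conj_cong)
    qed
    then show "\<exists>N. \<forall>n\<ge>N. measure P (E \<inter> {\<omega>\<in>space P. \<exists>q\<in>drat ` {..<n}. X q \<omega> < d}) \<le> d" by blast
  qed
  have "(\<Inter>n. A (1 / Suc n)) \<in> null_sets P"
  proof (rule null_setsI)
    show Is: "(\<Inter>n. A (1 / Suc n)) \<in> sets P" using As by auto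
    have "measure P (\<Inter>n. A (1 / Suc n)) \<le> 1 / Suc n" for n
    proof -
      have "measure P (\<Inter>n. A (1 / Suc n)) \<le> measure P (A (1 / Suc n))"
        by (rule finite_measure_mono[OF _ As]) auto
      also have "\<dots> \<le> 1 / Suc n" by (rule le) simp
      finally show ?thesis .
    qed
    moreover have "(\<lambda>n. 1 / real (Suc n)) \<longlonglongrightarrow> 0"
      using LIMSEQ_inverse_real_of_nat by (simp add: inverse_eq_divide)
    ultimately have "measure P (\<Inter>n. A (1 / Suc n)) \<le> 0" by (intro LIMSEQ_le_const) auto
    then show "emeasure P (\<Inter>n. A (1 / Suc n)) = 0" by (simp add: emeasure_eq_measure measure_le_0_iff)
  qed
  then show ?thesis
  proof (rule AE_I')
    show "{\<omega> \<in> space P. \<not> (\<omega> \<in> E \<longrightarrow> (\<forall>t\<ge>0. 0 < X t \<omega>))} \<subseteq> (\<Inter>n. A (1 / Suc n))"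
    proof
      fix \<omega> assume "\<omega> \<in> {\<omega> \<in> space P. \<not> (\<omega> \<in> E \<longrightarrow> (\<forall>t\<ge>0. 0 < X t \<omega>))}"
      then obtain t where w: "\<omega> \<in> space P" "\<omega> \<in> E" "0 \<le> t" "X t \<omega> \<le> 0" by force
      have "\<omega> \<in> A (1 / Suc n)" for n
      proof -
        have "X t \<omega> < 1 / Suc n" using w(4) by (rule le_less_trans) simp
        then have "\<forall>\<^sub>F s in at_right t. X s \<omega> < 1 / Suc n"
          by (rule order_tendstoD(2)[OF cver_right[OF X w(3,1)]])
        then obtain u where u: "t < u" "\<forall>s>t. s < u \<longrightarrow> X s \<omega> < 1 / Suc n" unfolding eventually_at_right_field by blast
        obtain q where "q \<in> \<rat>" "t < q" "q < u" using Rats_dense_in_real[OF u(1)] by blast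
        then show ?thesis unfolding A_def using w u(2) by auto
      qed
      then show "\<omega> \<in> (\<Inter>n. A (1 / Suc n))" by blast
    qed
  qed
qed

text \<open>Doob's inequality in terms of the event itself: at the first passage above d the
  conditional probability of E exceeds d, so the passage event V satisfies d P(V) \<le> P(E \<inter>
  V).\<close>

lemma cver_maximal:
  assumes X: "cver E X" and E: "E \<in> sets P"
  shows "{\<omega>\<in>space P. \<exists>q\<in>nnrat. d < X q \<omega>} \<in> sets P"
    and "d * measure P {\<omega>\<in>space P. \<exists>q\<in>nnrat. d < X q \<omega>} \<le> measure P E"
proof -
  have s: "{\<omega>\<in>space P. d < X q \<omega>} \<in> sets P" if "q \<in> nnrat" for q
  proof -
    have "0 \<le> q" using that by simp
    note [measurable] = cver_P[OF X this]
    show ?thesis by measurable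
  qed
  show "{\<omega>\<in>space P. \<exists>q\<in>nnrat. d < X q \<omega>} \<in> sets P" by (rule sets_ex_nnrat[OF s]) auto
  have "(\<lambda>n. d * measure P (space P \<inter> {\<omega>\<in>space P. \<exists>q\<in>drat ` {..<n}. d < X q \<omega>})) \<longlonglongrightarrow>
    d * measure P (space P \<inter> {\<omega>\<in>space P. \<exists>q\<in>nnrat. d < X q \<omega>})"
    by (intro tendsto_intros measure_ex_nnrat[OF s]) auto
  moreover have "d * measure P (space P \<inter> {\<omega>\<in>space P. \<exists>q\<in>drat ` {..<n}. d < X q \<omega>}) \<le> measure P E" for n
  proof -
    let ?qs = "sorted_list_of_set (drat ` {..<n})"
    let ?V = "space P \<inter> {\<omega>\<in>space P. \<exists>q\<in>set ?qs. d < X q \<omega>}"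
    have "d * measure P ?V \<le> measure P (E \<inter> ?V)"
      by (rule cver_first_passage(2)[OF X E, of _ 0]) (use drat_nnrat H_space in auto)
    also have "\<dots> \<le> measure P E" by (rule finite_measure_mono[OF _ E]) auto
    finally show ?thesis by simp
  qed
  ultimately have "d * measure P (space P \<inter> {\<omega>\<in>space P. \<exists>q\<in>nnrat. d < X q \<omega>}) \<le> measure P E"
    by (intro LIMSEQ_le_const2) auto
  moreover have "space P \<inter> {\<omega>\<in>space P. \<exists>q\<in>nnrat. d < X q \<omega>} = {\<omega>\<in>space P. \<exists>q\<in>nnrat. d < X q \<omega>}" by auto
  ultimately show "d * measure P {\<omega>\<in>space P. \<exists>q\<in>nnrat. d < X q \<omega>} \<le> measure P E" by simp
qed

text \<open>Remainders such as Z minus a partial sum are known only to satisfy \<open>cver\<close>;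
  their sign is read off from the bounded version of the same event.\<close>

lemma cver_AE_nonneg:
  assumes X: "cver E X" and E: "E \<in> sets P"
  shows "AE \<omega> in P. \<forall>q\<in>nnrat. 0 \<le> X q \<omega>"
proof -
  obtain Y where Y: "cver E Y" "\<forall>t \<omega>. 0 \<le> t \<longrightarrow> 0 \<le> Y t \<omega> \<and> Y t \<omega> \<le> 1" using ex_cver[OF E] by blast
  have "AE \<omega> in P. 0 \<le> X q \<omega>" if "q \<in> nnrat" for q
  proof -
    have q: "0 \<le> q" using that by simp
    have "AE \<omega> in P. \<omega> \<in> space P \<longrightarrow> X q \<omega> = Y q \<omega>"
      by (rule cver_AE_eq_on[OF X q H_space[OF q] cver_HM[OF Y(1) q] cver_integrable[OF Y(1) q]])
        (rule cver_int[OF Y(1) q])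
    then show ?thesis
    proof (rule AE_mp, intro AE_I2 impI)
      fix \<omega> assume "\<omega> \<in> space P" "\<omega> \<in> space P \<longrightarrow> X q \<omega> = Y q \<omega>"
      then show "0 \<le> X q \<omega>" using Y(2) q by simp
    qed
  qed
  then show ?thesis by (subst AE_ball_countable[OF countable_nnrat]) (rule ballI)
qed

section \<open>Operations on versions\<close>

lemma os_cadlag_diff:
  assumes "os_cadlag \<Omega> X" "os_cadlag \<Omega> Y" shows "os_cadlag \<Omega> (\<lambda>t \<omega>. X t \<omega> - Y t \<omega>)"
  unfolding os_cadlag_def
proof (intro ballI allI impI conjI)
  fix \<omega> t assume w: "\<omega> \<in> \<Omega>" "0 \<le> (t::real)"
  then show "((\<lambda>s. X s \<omega> - Y s \<omega>) \<longlongrightarrow> X t \<omega> - Y t \<omega>) (at_right t)"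
    using assms unfolding os_cadlag_def by (intro tendsto_diff) blast+
  assume "0 < t"
  then obtain k l where "((\<lambda>s. X s \<omega>) \<longlongrightarrow> k) (at_left t)" "((\<lambda>s. Y s \<omega>) \<longlongrightarrow> l) (at_left t)"
    using assms w unfolding os_cadlag_def by meson
  then show "\<exists>l. ((\<lambda>s. X s \<omega> - Y s \<omega>) \<longlongrightarrow> l) (at_left t)" using tendsto_diff by blast
qed

lemma cver_diff:
  assumes X: "cver E X" and Y: "cver D Y" and s: "E \<in> sets P" "D \<in> sets P" "D \<subseteq> E"
  shows "cver (E - D) (\<lambda>t \<omega>. X t \<omega> - Y t \<omega>)"
  unfolding cver_def
proof (intro conjI allI impI ballI)
  show "os_adapted (space P) H (\<lambda>t \<omega>. X t \<omega> - Y t \<omega>)"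
    unfolding adapted_iff
  proof (intro allI impI)
    fix t :: real assume t: "0 \<le> t"
    note [measurable] = cver_HM[OF X t] cver_HM[OF Y t]
    show "(\<lambda>\<omega>. X t \<omega> - Y t \<omega>) \<in> borel_measurable (HM t)" by measurable
  qed
  show "os_cadlag (space P) (\<lambda>t \<omega>. X t \<omega> - Y t \<omega>)"
    by (rule os_cadlag_diff) (use X Y in \<open>simp_all add: cver_def\<close>)
  fix t :: real assume t: "0 \<le> t"
  show "integrable P (\<lambda>\<omega>. X t \<omega> - Y t \<omega>)"
    by (rule Bochner_Integration.integrable_diff[OF cver_integrable[OF X t] cver_integrable[OF Y t]])
  fix B assume B: "B \<in> H t"
  note Bs = H_sets[OF t B]
  have "(\<integral>\<omega>. indicator B \<omega> * (X t \<omega> - Y t \<omega>) \<partial>P) = (\<integral>\<omega>. indicator B \<omega> * X t \<omega> - indicator B \<omega> * Y t \<omega> \<partial>P)"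
    by (simp add: right_diff_distrib)
  also have "\<dots> = measure P (E \<inter> B) - measure P (D \<inter> B)"
    unfolding cver_int[OF X t B, symmetric] cver_int[OF Y t B, symmetric]
    by (rule Bochner_Integration.integral_diff; rule integrable_indicator_mult[OF _ Bs], rule cver_integrable[OF X t] cver_integrable[OF Y t])
  also have "\<dots> = measure P ((E \<inter> B) - (D \<inter> B))"
    by (rule finite_measure_Diff[symmetric, OF sets.Int[OF s(1) Bs] sets.Int[OF s(2) Bs]]) (use s in auto)
  also have "(E \<inter> B) - (D \<inter> B) = (E - D) \<inter> B" by auto
  finally show "(\<integral>\<omega>. indicator B \<omega> * (X t \<omega> - Y t \<omega>) \<partial>P) = measure P ((E - D) \<inter> B)" .
qed

lemma cver_space: "cver (space P) (\<lambda>t \<omega>. 1)"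
  unfolding cver_def adapted_iff
proof (intro conjI allI impI ballI)
  show "os_cadlag (space P) (\<lambda>t \<omega>. 1)" unfolding os_cadlag_def by auto
  fix t B assume t: "0 \<le> (t::real)" and B: "B \<in> H t"
  have "space P \<inter> B = B" using sets.sets_into_space[OF H_sets[OF t B]] by blast
  then show "(\<integral>\<omega>. indicator B \<omega> * 1 \<partial>P) = measure P (space P \<inter> B)" using H_sets[OF t B] by simp
qed auto

lemma cver_null_modify:
  assumes X: "cver E X" and s: "E \<in> sets P" "D \<in> sets P" and n: "AE \<omega> in P. \<omega> \<in> E \<longleftrightarrow> \<omega> \<in> D"
  shows "cver D X"
proof -
  have "measure P (E \<inter> B) = measure P (D \<inter> B)" if "B \<in> sets P" for B
    by (rule finite_measure_eq_AE) (use n s that in auto)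
  then show ?thesis using X H_sets unfolding cver_def by simp
qed

end

section \<open>Stopping times generate the optional sets\<close>

definition after_time :: "'a set \<Rightarrow> ('a \<Rightarrow> ennreal) \<Rightarrow> (real \<times> 'a) set" where
  "after_time \<Omega> R = {(t,\<omega>) \<in> {0..} \<times> \<Omega>. R \<omega> \<le> ennreal t}"

lemma mem_after_time: "(t,\<omega>) \<in> after_time \<Omega> R \<longleftrightarrow> 0 \<le> t \<and> \<omega> \<in> \<Omega> \<and> R \<omega> \<le> ennreal t"
  unfolding after_time_def by auto

lemma os_cadlag_threshold:
  fixes R :: "'a \<Rightarrow> ennreal"
  shows "os_cadlag \<Omega> (\<lambda>t \<omega>. if R \<omega> \<le> ennreal t then 1 else 0)"
  unfolding os_cadlag_def
proof (intro ballI allI impI conjI)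
  fix \<omega> and t :: real assume t: "0 \<le> t"
  show "((\<lambda>s. if R \<omega> \<le> ennreal s then 1 else 0) \<longlongrightarrow> (if R \<omega> \<le> ennreal t then 1 else 0 :: real)) (at_right t)"
  proof (cases "R \<omega> \<le> ennreal t")
    case True
    have "R \<omega> \<le> ennreal s" if "t < s" for s
      by (rule order_trans[OF True ennreal_leI]) (use that in simp)
    then have "\<forall>\<^sub>F s in at_right t. (if R \<omega> \<le> ennreal s then 1 else 0) = (1::real)"
      unfolding eventually_at_right_field by (intro exI[of _ "t+1"]) simp
    then show ?thesis by (subst if_P[OF True]) (rule tendsto_eventually)
  next
    case False
    then have "ennreal t < R \<omega>" by simp
    then obtain u where u: "t < u" "ennreal u \<le> R \<omega>"
    proof (cases "R \<omega>")
      case (real r)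
      then show ?thesis using that[of r] \<open>ennreal t < R \<omega>\<close> t by (simp add: ennreal_less_iff)
    next
      case top
      then show ?thesis using that[of "t+1"] by simp
    qed
    have "\<forall>\<^sub>F s in at_right t. (if R \<omega> \<le> ennreal s then 1 else 0) = (0::real)"
      unfolding eventually_at_right_field
    proof (intro exI[of _ u] conjI allI impI)
      fix s assume "t < s" "s < u"
      then have "ennreal s < ennreal u" using t by (simp add: ennreal_less_iff)
      then show "(if R \<omega> \<le> ennreal s then 1 else 0) = (0::real)" using u(2) by auto
    qed (use u in simp)
    then show ?thesis by (subst if_not_P[OF False]) (rule tendsto_eventually)
  qed
  assume t0: "0 < t"
  show "\<exists>l. ((\<lambda>s. if R \<omega> \<le> ennreal s then 1 else 0 :: real) \<longlongrightarrow> l) (at_left t)"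
  proof (cases "\<exists>s<t. 0 \<le> s \<and> R \<omega> \<le> ennreal s")
    case True
    then obtain s where s: "s < t" "R \<omega> \<le> ennreal s" by blast
    have "R \<omega> \<le> ennreal r" if "s < r" for r
      by (rule order_trans[OF s(2) ennreal_leI]) (use that in simp)
    then have "\<forall>\<^sub>F s in at_left t. (if R \<omega> \<le> ennreal s then 1 else 0) = (1::real)"
      unfolding eventually_at_left_field using s(1) by (intro exI[of _ s]) simp
    then show ?thesis by (intro exI) (rule tendsto_eventually)
  next
    case False
    have "\<forall>\<^sub>F s in at_left t. (if R \<omega> \<le> ennreal s then 1 else 0) = (0::real)"
      unfolding eventually_at_left_field
      by (intro exI[of _ 0]) (use False t0 in auto)
    then show ?thesis by (intro exI) (rule tendsto_eventually)
  qed
qed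

context usual_conditions begin

text \<open>Right-continuity lets the strict inequalities decide: R \<le> t is the intersection of R
  < u over a sequence u decreasing to t.\<close>

lemma stopping_timeI:
  assumes R: "\<And>t. 0 < t \<Longrightarrow> {\<omega>\<in>space P. R \<omega> < ennreal t} \<in> H t"
  shows "os_stopping_time (space P) H R"
  unfolding os_stopping_time_def
proof (intro allI impI)
  fix t :: real assume t: "0 \<le> t"
  show "{\<omega>\<in>space P. R \<omega> \<le> ennreal t} \<in> H t"
  proof (rule H_right[OF t])
    fix s assume s: "t < s"
    \<comment> \<open>The shift by N keeps the whole sequence u below s, so that all its events lie
      in \<open>H s\<close>.\<close>
    obtain N :: nat where N: "1 / Suc N < s - t" using nat_approx_posE[of "s - t"] s by auto
    define u where "u n = t + 1 / Suc (N + n)" for n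
    have u: "t < u n" "u n \<le> s" for n
    proof -
      have "1 / real (Suc (N + n)) \<le> 1 / real (Suc N)" by (simp add: frac_le)
      then show "t < u n" "u n \<le> s" using N unfolding u_def by auto
    qed
    have ul: "u \<longlonglongrightarrow> t"
    proof -
      have "(\<lambda>n. 1 / real (Suc (n + N))) \<longlonglongrightarrow> 0"
        by (rule LIMSEQ_ignore_initial_segment) (use LIMSEQ_inverse_real_of_nat in \<open>simp add: inverse_eq_divide\<close>)
      then have "(\<lambda>n. t + 1 / real (Suc (n + N))) \<longlonglongrightarrow> t + 0" by (intro tendsto_intros)
      then show ?thesis unfolding u_def by (simp add: add.commute)
    qed
    have eq: "{\<omega>\<in>space P. R \<omega> \<le> ennreal t} = (\<Inter>n. {\<omega>\<in>space P. R \<omega> < ennreal (u n)})"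
    proof (intro equalityI subsetI)
      fix \<omega> assume w: "\<omega> \<in> {\<omega>\<in>space P. R \<omega> \<le> ennreal t}"
      have "ennreal t < ennreal (u n)" for n using u(1)[of n] t by (simp add: ennreal_less_iff)
      then show "\<omega> \<in> (\<Inter>n. {\<omega>\<in>space P. R \<omega> < ennreal (u n)})" using w le_less_trans by auto
    next
      fix \<omega> assume w: "\<omega> \<in> (\<Inter>n. {\<omega>\<in>space P. R \<omega> < ennreal (u n)})"
      have "(\<lambda>n. ennreal (u n)) \<longlonglongrightarrow> ennreal t" using ul by (rule tendsto_ennrealI)
      then have "R \<omega> \<le> ennreal t" by (rule LIMSEQ_le_const) (use w in \<open>auto intro: less_imp_le\<close>)
      then show "\<omega> \<in> {\<omega>\<in>space P. R \<omega> \<le> ennreal t}" using w by auto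
    qed
    have s0: "0 \<le> s" using s t by simp
    have "{\<omega>\<in>space P. R \<omega> < ennreal (u n)} \<in> sets (HM s)" for n
      unfolding sets_HM[OF s0] by (rule H_mono[OF _ u(2)[of n] R]) (use u(1)[of n] t in auto)
    then have "(\<Inter>n. {\<omega>\<in>space P. R \<omega> < ennreal (u n)}) \<in> sets (HM s)" by (intro sets.countable_INT) auto
    then show "{\<omega>\<in>space P. R \<omega> \<le> ennreal t} \<in> H s" unfolding eq sets_HM[OF s0] .
  qed
qed

lemma after_time_optional:
  assumes R: "os_stopping_time (space P) H R"
  shows "after_time (space P) R \<in> os_optional_sets (space P) H"
  unfolding os_optional_sets_def
proof (rule sigma_sets.Basic)
  let ?X = "\<lambda>t \<omega>. if R \<omega> \<le> ennreal t then 1 else 0 :: real"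
  have "os_adapted (space P) H ?X"
    unfolding adapted_iff
  proof (intro allI impI)
    fix t :: real assume t: "0 \<le> t"
    have [measurable]: "{\<omega>\<in>space (HM t). R \<omega> \<le> ennreal t} \<in> sets (HM t)"
      using R t unfolding os_stopping_time_def by simp
    show "(\<lambda>\<omega>. if R \<omega> \<le> ennreal t then 1 else 0 :: real) \<in> borel_measurable (HM t)" by measurable
  qed
  moreover have "os_cadlag (space P) ?X" by (rule os_cadlag_threshold)
  moreover have "after_time (space P) R = {(t,\<omega>) \<in> {0..} \<times> space P. ?X t \<omega> \<in> {1}}"
    unfolding after_time_def by auto
  ultimately have "\<exists>X B. after_time (space P) R = {(t,\<omega>) \<in> {0..} \<times> space P. X t \<omega> \<in> B} \<and>
    os_adapted (space P) H X \<and> os_cadlag (space P) X \<and> B \<in> sets borel"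
    by (intro exI[of _ ?X] exI[of _ "{1}"] conjI) simp_all
  then show "after_time (space P) R \<in> {{(t,\<omega>) \<in> {0..} \<times> space P. X t \<omega> \<in> B} | X B.
    os_adapted (space P) H X \<and> os_cadlag (space P) X \<and> B \<in> sets borel}" by (rule CollectI)
qed

text \<open>This rectangle is the interval [R, oo) of the stopping time R equal to s on C and
  infinite elsewhere.\<close>

lemma rect_optional:
  assumes s: "0 \<le> s" and C: "C \<in> H s"
  shows "{s..} \<times> C \<in> os_optional_sets (space P) H"
proof -
  have CP: "C \<subseteq> space P" using sets.sets_into_space[OF H_sets[OF s C]] .
  define R where "R \<omega> = (if \<omega> \<in> C then ennreal s else \<infinity>)" for \<omega>
  have "os_stopping_time (space P) H R" unfolding os_stopping_time_def
  proof (intro allI impI)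
    fix t :: real assume t: "0 \<le> t"
    show "{\<omega>\<in>space P. R \<omega> \<le> ennreal t} \<in> H t"
    proof (cases "s \<le> t")
      case True
      then have "{\<omega>\<in>space P. R \<omega> \<le> ennreal t} = C" using CP t unfolding R_def by (auto simp: ennreal_leI top_unique)
      then show ?thesis using H_mono[OF s True C] by simp
    next
      case False
      then have "{\<omega>\<in>space P. R \<omega> \<le> ennreal t} = {}" using s t unfolding R_def by (auto simp: top_unique)
      then show ?thesis using H_Diff[OF t H_space[OF t] H_space[OF t]] by (simp only: Diff_cancel)
    qed
  qed
  then have "after_time (space P) R \<in> os_optional_sets (space P) H" by (rule after_time_optional)
  moreover have "after_time (space P) R = {s..} \<times> C"
    unfolding after_time_def R_def using CP s by (auto simp: top_unique split: if_splits)
  ultimately show ?thesis by simp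
qed

text \<open>For a cadlag adapted X, the set X > a is a countable union of intervals [U, V). A single
  level would not do, since values of X at entrance and exit times may sit exactly on it; two
  rational levels a < c < b leave room on both sides, and a rational starting time p singles out one
  excursion.\<close>

lemma optional_subset_sigma_stopping:
  "os_optional_sets (space P) H \<subseteq> sigma_sets ({0..} \<times> space P) {after_time (space P) R | R. os_stopping_time (space P) H R}"
  (is "_ \<subseteq> sigma_sets ?\<Omega> ?S")
  unfolding os_optional_sets_def
proof (rule sigma_sets_mono, rule subsetI)
  fix D assume "D \<in> {{(t,\<omega>) \<in> {0..} \<times> space P. X t \<omega> \<in> B} | X B.
    os_adapted (space P) H X \<and> os_cadlag (space P) X \<and> B \<in> sets borel}"
  then obtain X :: "real \<Rightarrow> 'a \<Rightarrow> real" and B where D: "D = {(t,\<omega>) \<in> {0..} \<times> space P. X t \<omega> \<in> B}"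
    and X: "os_adapted (space P) H X" "os_cadlag (space P) X" and B: "B \<in> sets borel" by blast
  define O' where "O' = sigma ?\<Omega> ?S"
  have spO: "space O' = ?\<Omega>" unfolding O'_def by (simp add: space_measure_of_conv)
  have "?S \<subseteq> Pow ?\<Omega>" unfolding after_time_def by auto
  then have seO: "sets O' = sigma_sets ?\<Omega> ?S" unfolding O'_def by (rule sets_measure_of)
  have stO: "after_time (space P) R \<in> sets O'" if "os_stopping_time (space P) H R" for R
    unfolding seO by (rule sigma_sets.Basic) (use that in blast)
  have XH: "X t \<in> borel_measurable (HM t)" if "0 \<le> t" for t using X(1) that unfolding adapted_iff by blast
  have rc: "((\<lambda>s. X s \<omega>) \<longlongrightarrow> X t \<omega>) (at_right t)" if "0 \<le> t" "\<omega> \<in> space P" for t \<omega>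
    using X(2) that unfolding os_cadlag_def by blast
  have rcg: "\<exists>u>t. \<forall>s. t \<le> s \<longrightarrow> s < u \<longrightarrow> b < X s \<omega>" if h: "0 \<le> t" "\<omega> \<in> space P" "b < X t \<omega>" for t \<omega> b
  proof -
    obtain u where "t < u" "\<forall>s>t. s < u \<longrightarrow> b < X s \<omega>"
      using order_tendstoD(1)[OF rc[OF h(1,2)] h(3)] unfolding eventually_at_right_field by blast
    then show ?thesis using h(3) by (intro exI[of _ u]) (auto simp: le_less)
  qed
  have rcl: "\<exists>u>t. \<forall>s. t \<le> s \<longrightarrow> s < u \<longrightarrow> X s \<omega> < b" if h: "0 \<le> t" "\<omega> \<in> space P" "X t \<omega> < b" for t \<omega> b
  proof -
    obtain u where "t < u" "\<forall>s>t. s < u \<longrightarrow> X s \<omega> < b"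
      using order_tendstoD(2)[OF rc[OF h(1,2)] h(3)] unfolding eventually_at_right_field by blast
    then show ?thesis using h(3) by (intro exI[of _ u]) (auto simp: le_less)
  qed
  \<comment> \<open>entrance above \<open>b\<close> after \<open>p\<close>, and the next entrance below \<open>c\<close>: for \<open>c < b\<close>,
      \<open>{X > b} \<subseteq> (\<Union>p. [U p b, V p b c)) \<subseteq> {X \<ge> c}\<close>\<close>
  define U where "U p b \<omega> = Inf (ennreal ` {s. p \<le> s \<and> b < X s \<omega>})" for p b \<omega>
  define V where "V p b c \<omega> = Inf (ennreal ` {s. 0 \<le> s \<and> U p b \<omega> \<le> ennreal s \<and> X s \<omega> < c})" for p b c \<omega>
  have Hrat: "{\<omega>\<in>space P. \<exists>q\<in>I. Q q \<omega>} \<in> H t"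
    if h: "0 \<le> t" "I \<subseteq> nnrat" "\<And>q. q \<in> I \<Longrightarrow> q \<le> t" "\<And>q. q \<in> I \<Longrightarrow> {\<omega>\<in>space P. Q q \<omega>} \<in> H q" for t I Q
  proof -
    have "(\<Union>q\<in>I. {\<omega>\<in>space P. Q q \<omega>}) \<in> sets (HM t)"
    proof (rule sets.countable_UN'')
      show "countable I" using countable_subset[OF h(2) countable_nnrat] .
      fix q assume q: "q \<in> I"
      have "0 \<le> q" using q h(2) by auto
      then show "{\<omega>\<in>space P. Q q \<omega>} \<in> sets (HM t)"
        unfolding sets_HM[OF h(1)] by (rule H_mono[OF _ h(3)[OF q] h(4)[OF q]])
    qed
    moreover have "(\<Union>q\<in>I. {\<omega>\<in>space P. Q q \<omega>}) = {\<omega>\<in>space P. \<exists>q\<in>I. Q q \<omega>}" by auto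
    ultimately show ?thesis unfolding sets_HM[OF h(1)] by (simp only:)
  qed
  \<comment> \<open>The infimum need not be attained, but by right-continuity U < t is visible at
    rational times before t. \<open>stopping_timeI\<close> accepts this strict form.\<close>
  have Ust: "os_stopping_time (space P) H (U p b)" if p: "p \<in> nnrat" for p b
  proof (rule stopping_timeI)
    fix t :: real assume t: "0 < t"
    have "{\<omega>\<in>space P. U p b \<omega> < ennreal t} = {\<omega>\<in>space P. \<exists>q\<in>{q\<in>nnrat. p \<le> q \<and> q < t}. b < X q \<omega>}"
    proof (intro Collect_cong conj_cong refl)
      fix \<omega> assume w: "\<omega> \<in> space P"
      have "U p b \<omega> < ennreal t \<longleftrightarrow> (\<exists>s. p \<le> s \<and> b < X s \<omega> \<and> s < t)"
        unfolding U_def Inf_less_iff using p t by (auto simp: ennreal_less_iff)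
      also have "\<dots> \<longleftrightarrow> (\<exists>q\<in>{q\<in>nnrat. p \<le> q \<and> q < t}. b < X q \<omega>)"
      proof
        assume "\<exists>s. p \<le> s \<and> b < X s \<omega> \<and> s < t"
        then obtain s where s: "p \<le> s" "b < X s \<omega>" "s < t" by blast
        have s0: "0 \<le> s" using s p by simp
        obtain u where u: "u > s" "\<forall>r. s \<le> r \<longrightarrow> r < u \<longrightarrow> b < X r \<omega>" using rcg[OF s0 w s(2)] by blast
        obtain q where "q \<in> \<rat>" "s < q" "q < min u t" using Rats_dense_in_real[of s "min u t"] u s by auto
        then show "\<exists>q\<in>{q\<in>nnrat. p \<le> q \<and> q < t}. b < X q \<omega>" using u s s0 by (intro bexI[of _ q]) auto
      qed blast
      finally show "U p b \<omega> < ennreal t \<longleftrightarrow> (\<exists>q\<in>{q\<in>nnrat. p \<le> q \<and> q < t}. b < X q \<omega>)" .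
    qed
    also have "\<dots> \<in> H t"
    proof (rule Hrat)
      fix q assume "q \<in> {q \<in> nnrat. p \<le> q \<and> q < t}"
      then have q: "0 \<le> q" by simp
      have "{\<omega>\<in>space (HM q). b < X q \<omega>} \<in> sets (HM q)" using XH[OF q] by measurable
      then show "{\<omega>\<in>space P. b < X q \<omega>} \<in> H q" using q by simp
    qed (use t in auto)
    finally show "{\<omega>\<in>space P. U p b \<omega> < ennreal t} \<in> H t" .
  qed
  have Vst: "os_stopping_time (space P) H (V p b c)" if p: "p \<in> nnrat" for p b c
  proof (rule stopping_timeI)
    fix t :: real assume t: "0 < t"
    have "{\<omega>\<in>space P. V p b c \<omega> < ennreal t} = {\<omega>\<in>space P. \<exists>q\<in>{q\<in>nnrat. q < t}. U p b \<omega> \<le> ennreal q \<and> X q \<omega> < c}"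
    proof (intro Collect_cong conj_cong refl)
      fix \<omega> assume w: "\<omega> \<in> space P"
      have "V p b c \<omega> < ennreal t \<longleftrightarrow> (\<exists>s. 0 \<le> s \<and> U p b \<omega> \<le> ennreal s \<and> X s \<omega> < c \<and> s < t)"
        unfolding V_def Inf_less_iff using t by (auto simp: ennreal_less_iff)
      also have "\<dots> \<longleftrightarrow> (\<exists>q\<in>{q\<in>nnrat. q < t}. U p b \<omega> \<le> ennreal q \<and> X q \<omega> < c)"
      proof
        assume "\<exists>s. 0 \<le> s \<and> U p b \<omega> \<le> ennreal s \<and> X s \<omega> < c \<and> s < t"
        then obtain s where s: "0 \<le> s" "U p b \<omega> \<le> ennreal s" "X s \<omega> < c" "s < t" by blast
        obtain u where u: "u > s" "\<forall>r. s \<le> r \<longrightarrow> r < u \<longrightarrow> X r \<omega> < c" using rcl[OF s(1) w s(3)] by blast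
        obtain q where q: "q \<in> \<rat>" "s < q" "q < min u t" using Rats_dense_in_real[of s "min u t"] u s by auto
        have "U p b \<omega> \<le> ennreal q" by (rule order_trans[OF s(2)]) (use q in \<open>simp add: ennreal_leI\<close>)
        then show "\<exists>q\<in>{q\<in>nnrat. q < t}. U p b \<omega> \<le> ennreal q \<and> X q \<omega> < c" using u s q by (intro bexI[of _ q]) auto
      qed auto
      finally show "V p b c \<omega> < ennreal t \<longleftrightarrow> (\<exists>q\<in>{q\<in>nnrat. q < t}. U p b \<omega> \<le> ennreal q \<and> X q \<omega> < c)" .
    qed
    also have "\<dots> \<in> H t"
    proof (rule Hrat)
      fix q assume "q \<in> {q \<in> nnrat. q < t}"
      then have q: "0 \<le> q" by simp
      have "{\<omega>\<in>space (HM q). X q \<omega> < c} \<in> sets (HM q)" using XH[OF q] by measurable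
      then have 1: "{\<omega>\<in>space P. X q \<omega> < c} \<in> H q" using q by simp
      have 2: "{\<omega>\<in>space P. U p b \<omega> \<le> ennreal q} \<in> H q" using Ust[OF p] q unfolding os_stopping_time_def by blast
      have "{\<omega>\<in>space P. U p b \<omega> \<le> ennreal q \<and> X q \<omega> < c} = {\<omega>\<in>space P. U p b \<omega> \<le> ennreal q} \<inter> {\<omega>\<in>space P. X q \<omega> < c}" by auto
      then show "{\<omega>\<in>space P. U p b \<omega> \<le> ennreal q \<and> X q \<omega> < c} \<in> H q" using H_Int[OF q 2 1] by simp
    qed (use t in auto)
    finally show "{\<omega>\<in>space P. V p b c \<omega> < ennreal t} \<in> H t" .
  qed
  have lower: "c \<le> X t \<omega>" if "0 \<le> t" "U p b \<omega> \<le> ennreal t" "ennreal t < V p b c \<omega>" for t \<omega> p b c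
  proof (rule ccontr)
    assume "\<not> c \<le> X t \<omega>"
    then have "V p b c \<omega> \<le> ennreal t" unfolding V_def by (intro Inf_lower) (use that in auto)
    then show False using that(3) by simp
  qed
  have upper: "\<exists>p\<in>nnrat. U p b \<omega> \<le> ennreal t \<and> ennreal t < V p b c \<omega>"
    if t: "0 \<le> t" and w: "\<omega> \<in> space P" and b: "b < X t \<omega>" and cb: "c < b" for t \<omega> b c
  proof -
    \<comment> \<open>The left limit at t lies above c or below b, which gives a suitable p before
      t. If X stays above c since p, no fall below c occurs before t; if X stays below b since p,
      the entrance above b is not before t. Either way t belongs to the interval started at
      p.\<close>
    have "\<exists>p\<in>nnrat. p \<le> t \<and> ((\<forall>s. p \<le> s \<longrightarrow> s < t \<longrightarrow> c < X s \<omega>) \<or> (\<forall>s. p \<le> s \<longrightarrow> s < t \<longrightarrow> X s \<omega> < b))"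
    proof (cases "t = 0")
      case True
      then show ?thesis by (intro bexI[of _ 0]) auto
    next
      case False
      then obtain l where l: "((\<lambda>s. X s \<omega>) \<longlongrightarrow> l) (at_left t)" using X(2) w t unfolding os_cadlag_def by force
      have "c < l \<or> l < b" using cb by linarith
      then have "\<exists>a<t. (\<forall>s. a < s \<longrightarrow> s < t \<longrightarrow> c < X s \<omega>) \<or> (\<forall>s. a < s \<longrightarrow> s < t \<longrightarrow> X s \<omega> < b)"
        using order_tendstoD[OF l] unfolding eventually_at_left_field by blast
      then obtain a where a: "a < t" "(\<forall>s. a < s \<longrightarrow> s < t \<longrightarrow> c < X s \<omega>) \<or> (\<forall>s. a < s \<longrightarrow> s < t \<longrightarrow> X s \<omega> < b)" by blast
      obtain p where p: "p \<in> \<rat>" "max a 0 < p" "p < t" using Rats_dense_in_real[of "max a 0" t] a False t by auto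
      have "(\<forall>s. p \<le> s \<longrightarrow> s < t \<longrightarrow> c < X s \<omega>) \<or> (\<forall>s. p \<le> s \<longrightarrow> s < t \<longrightarrow> X s \<omega> < b)"
        using a(2) p(2) by (meson less_le_trans max_less_iff_conj)
      then show ?thesis using p by (intro bexI[of _ p]) auto
    qed
    then obtain p where p: "p \<in> nnrat" "p \<le> t" and
      alt: "(\<forall>s. p \<le> s \<longrightarrow> s < t \<longrightarrow> c < X s \<omega>) \<or> (\<forall>s. p \<le> s \<longrightarrow> s < t \<longrightarrow> X s \<omega> < b)" by blast
    have "c < X t \<omega>" using b cb by simp
    then obtain u where u: "u > t" "\<forall>s. t \<le> s \<longrightarrow> s < u \<longrightarrow> c < X s \<omega>" using rcg[OF t w] by blast
    have "U p b \<omega> \<le> ennreal t" unfolding U_def by (intro Inf_lower) (use p b in auto)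
    moreover have "ennreal u \<le> V p b c \<omega>"
      unfolding V_def
    proof (rule Inf_greatest, clarify)
      fix s assume s: "0 \<le> s" "U p b \<omega> \<le> ennreal s" "X s \<omega> < c"
      have "u \<le> s"
      proof (rule ccontr)
        assume "\<not> u \<le> s"
        then have st: "s < t" using u(2) s(3) by (metis less_asym not_le)
        from alt show False
        proof
          assume c: "\<forall>s. p \<le> s \<longrightarrow> s < t \<longrightarrow> c < X s \<omega>"
          have "ennreal p \<le> U p b \<omega>" unfolding U_def by (rule Inf_greatest) (auto intro: ennreal_leI)
          then have "ennreal p \<le> ennreal s" using s(2) by (rule order_trans)
          then have "p \<le> s" using s(1) by simp
          then show False using c st s(3) by force
        next
          assume c: "\<forall>s. p \<le> s \<longrightarrow> s < t \<longrightarrow> X s \<omega> < b"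
          have "ennreal t \<le> U p b \<omega>" unfolding U_def
          proof (rule Inf_greatest, clarify)
            fix r assume "p \<le> r" "b < X r \<omega>"
            then have "t \<le> r" using c by (meson less_asym not_le)
            then show "ennreal t \<le> ennreal r" by (rule ennreal_leI)
          qed
          then have "ennreal t \<le> ennreal s" using s(2) by (rule order_trans)
          then show False using s(1) st by simp
        qed
      qed
      then show "ennreal u \<le> ennreal s" by (rule ennreal_leI)
    qed
    moreover have "ennreal t < ennreal u" using u(1) t by (simp add: ennreal_less_iff)
    ultimately show ?thesis using p(1) by (meson less_le_trans)
  qed
  have "(\<lambda>z. X (fst z) (snd z)) \<in> borel_measurable O'"
  proof (rule borel_measurable_iff_greater[THEN iffD2], rule allI)
    fix a :: real
    define J where "J = {(b,c). b \<in> \<rat> \<and> c \<in> \<rat> \<and> a < c \<and> c < (b::real)}"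
    have "J \<subseteq> \<rat> \<times> \<rat>" unfolding J_def by auto
    then have Jc: "countable J" by (rule countable_subset) (intro countable_SIGMA countable_rat)
    have "{z \<in> space O'. a < X (fst z) (snd z)} =
      (\<Union>j\<in>J. \<Union>p\<in>nnrat. after_time (space P) (U p (fst j)) - after_time (space P) (V p (fst j) (snd j)))"
    proof (intro equalityI subsetI)
      fix z assume "z \<in> {z \<in> space O'. a < X (fst z) (snd z)}"
      then obtain t \<omega> where z: "z = (t,\<omega>)" "0 \<le> t" "\<omega> \<in> space P" "a < X t \<omega>" unfolding spO by auto
      obtain c where c: "c \<in> \<rat>" "a < c" "c < X t \<omega>" using Rats_dense_in_real[OF z(4)] by blast
      obtain b where b: "b \<in> \<rat>" "c < b" "b < X t \<omega>" using Rats_dense_in_real[OF c(3)] by blast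
      obtain p where p: "p \<in> nnrat" "U p b \<omega> \<le> ennreal t" "ennreal t < V p b c \<omega>"
        using upper[OF z(2,3) b(3,2)] by blast
      have "z \<in> after_time (space P) (U p b) - after_time (space P) (V p b c)"
        using z p by (auto simp: mem_after_time)
      moreover have "(b,c) \<in> J" unfolding J_def using b c by auto
      ultimately show "z \<in> (\<Union>j\<in>J. \<Union>p\<in>nnrat. after_time (space P) (U p (fst j)) - after_time (space P) (V p (fst j) (snd j)))"
        using p(1) by (intro UN_I[of "(b,c)"] UN_I[of p]) auto
    next
      fix z assume "z \<in> (\<Union>j\<in>J. \<Union>p\<in>nnrat. after_time (space P) (U p (fst j)) - after_time (space P) (V p (fst j) (snd j)))"
      then obtain b c p where J: "(b,c) \<in> J" and z: "z \<in> after_time (space P) (U p b) - after_time (space P) (V p b c)" by auto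
      obtain t \<omega> where z': "z = (t,\<omega>)" by (cases z)
      have "c \<le> X t \<omega>" by (rule lower[of _ p b]) (use z z' in \<open>auto simp: mem_after_time not_le\<close>)
      then show "z \<in> {z \<in> space O'. a < X (fst z) (snd z)}" unfolding spO using z z' J by (auto simp: mem_after_time J_def)
    qed
    also have "\<dots> \<in> sets O'"
      by (intro sets.countable_UN'' Jc countable_nnrat sets.Diff stO Ust Vst)
    finally show "{z \<in> space O'. a < X (fst z) (snd z)} \<in> sets O'" .
  qed
  from measurable_sets[OF this B] have "(\<lambda>z. X (fst z) (snd z)) -` B \<inter> space O' \<in> sets O'" .
  moreover have "(\<lambda>z. X (fst z) (snd z)) -` B \<inter> space O' = D" unfolding D spO by auto
  ultimately show "D \<in> sigma_sets ?\<Omega> ?S" unfolding seO by simp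
qed

end

section \<open>The progressive enlargement\<close>

text \<open>A limsup depends on tails only, so the first k sets may lie outside S. Applied to
  approximations known at t + 1/n, it yields a set known at every s > t.\<close>

lemma limsup_sigma_algebra:
  assumes "sigma_algebra \<Omega> S" and B: "\<And>n::nat. k \<le> n \<Longrightarrow> B n \<in> S"
  shows "(\<Inter>m. \<Union>n. B (m + n)) \<in> S"
proof -
  interpret sigma_algebra \<Omega> S by fact
  have "(\<Inter>m. \<Union>n. B (m + n)) = (\<Inter>m. \<Union>n. B (k + m + n))"
  proof (intro equalityI subsetI)
    fix x assume "x \<in> (\<Inter>m. \<Union>n. B (m + n))" then show "x \<in> (\<Inter>m. \<Union>n. B (k + m + n))" by blast
  next
    fix x assume x: "x \<in> (\<Inter>m. \<Union>n. B (k + m + n))"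
    show "x \<in> (\<Inter>m. \<Union>n. B (m + n))"
    proof
      fix m
      obtain n where "x \<in> B (k + m + n)" using x by blast
      then have "x \<in> B (m + (k + n))" by (simp add: add.left_commute add.assoc)
      then show "x \<in> (\<Union>n. B (m + n))" by blast
    qed
  qed
  also have "\<dots> \<in> S"
  proof (rule countable_INT)
    show "(\<lambda>m. \<Union>n. B (k + m + n)) ` UNIV \<subseteq> S"
    proof (rule image_subsetI)
      fix m
      show "(\<Union>n. B (k + m + n)) \<in> S" using B by (intro countable_UN) auto
    qed
  qed auto
  finally show ?thesis .
qed

section \<open>The sigma-algebras generated by F and tau\<close>

locale enlargement = prob_space M for M :: "'a measure" +
  fixes F :: "real \<Rightarrow> 'a set set" and \<tau> :: "'a \<Rightarrow> ennreal"
  assumes F_filtration: "os_filtration M F"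
    and F_rc: "os_right_continuous F"
    and F_null: "os_null_gen M (os_Finf (space M) F) \<subseteq> F 0"
    and \<tau>: "\<tau> \<in> borel_measurable M"
    and N_sets: "os_N M F \<tau> \<subseteq> sets M"
begin

abbreviation "\<Omega> \<equiv> space M"
abbreviation "G \<equiv> os_G M F \<tau>"
abbreviation "Ginf \<equiv> os_Ginf M F \<tau>"
definition "Tinf = os_join \<Omega> (os_gen_by \<Omega> \<tau>) (os_Finf \<Omega> F)"
text \<open>Explicitly generated, hence open to induction; \<open>Kp t\<close> is an intersection
  and has no such description. Sets of \<open>G t\<close> are therefore studied through
  representatives in \<open>K s\<close> with s > t.\<close>

definition "K s = os_join \<Omega> (F s) (os_gen_by \<Omega> (\<lambda>\<omega>. min (\<tau> \<omega>) (ennreal s)))"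
definition "Kp t = (\<Inter>s\<in>{t<..}. K s)"

lemma F_sub: "0 \<le> t \<Longrightarrow> F t \<subseteq> sets M"
  and F_sa: "0 \<le> t \<Longrightarrow> sigma_algebra \<Omega> (F t)"
  and F_mono: "0 \<le> s \<Longrightarrow> s \<le> t \<Longrightarrow> F s \<subseteq> F t"
  using F_filtration unfolding os_filtration_def by simp_all

lemma gen_by_sub:
  fixes f :: "'a \<Rightarrow> ennreal"
  assumes "f \<in> borel_measurable M" shows "os_gen_by \<Omega> f \<subseteq> sets M"
  unfolding os_gen_by_def by (rule sets.sigma_sets_subset) (use measurable_sets[OF assms] in blast)

lemma Finf_sub: "os_Finf \<Omega> F \<subseteq> sets M"
  unfolding os_Finf_def by (rule sets.sigma_sets_subset) (use F_sub in auto)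

lemma Tinf_sub: "Tinf \<subseteq> sets M"
  unfolding Tinf_def os_join_def
  by (rule sets.sigma_sets_subset) (use gen_by_sub[OF \<tau>] Finf_sub in blast)

lemma Tinf_sa: "sigma_algebra \<Omega> Tinf"
proof -
  have "os_gen_by \<Omega> \<tau> \<union> os_Finf \<Omega> F \<subseteq> Pow \<Omega>" using gen_by_sub[OF \<tau>] Finf_sub sets.sets_into_space by blast
  then show ?thesis unfolding Tinf_def os_join_def by (rule sigma_algebra_sigma_sets)
qed

lemma F_Tinf: "0 \<le> t \<Longrightarrow> F t \<subseteq> Tinf"
  unfolding Tinf_def os_join_def os_Finf_def by (intro subsetI sigma_sets.Basic UnI2) auto

lemma min_measurable: "(\<lambda>\<omega>. min (\<tau> \<omega>) (ennreal s)) \<in> borel_measurable M"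
  using \<tau> by measurable

lemma gen_min_sub_Tinf: "os_gen_by \<Omega> (\<lambda>\<omega>. min (\<tau> \<omega>) (ennreal s)) \<subseteq> Tinf"
proof -
  have "{(\<lambda>\<omega>. min (\<tau> \<omega>) (ennreal s)) -` B \<inter> \<Omega> | B. B \<in> sets borel} \<subseteq> Tinf"
  proof clarify
    fix B :: "ennreal set" assume B: "B \<in> sets borel"
    have "(\<lambda>x. min x (ennreal s)) \<in> borel_measurable (borel :: ennreal measure)" by measurable
    from measurable_sets[OF this B] have "(\<lambda>x. min x (ennreal s)) -` B \<in> sets borel" by simp
    then have "\<tau> -` ((\<lambda>x. min x (ennreal s)) -` B) \<inter> \<Omega> \<in> os_gen_by \<Omega> \<tau>"
      unfolding os_gen_by_def by (intro sigma_sets.Basic) blast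
    then show "(\<lambda>\<omega>. min (\<tau> \<omega>) (ennreal s)) -` B \<inter> \<Omega> \<in> Tinf"
      unfolding Tinf_def os_join_def by (intro sigma_sets.Basic UnI1) (simp add: vimage_def)
  qed
  then show ?thesis unfolding os_gen_by_def by (rule sigma_algebra.sigma_sets_subset[OF Tinf_sa])
qed

lemma K_Tinf: "0 \<le> s \<Longrightarrow> K s \<subseteq> Tinf"
  unfolding K_def os_join_def
  by (rule sigma_algebra.sigma_sets_subset[OF Tinf_sa]) (use F_Tinf gen_min_sub_Tinf in blast)

lemma K_sa: "0 \<le> s \<Longrightarrow> sigma_algebra \<Omega> (K s)"
proof -
  assume "0 \<le> s"
  then have "F s \<union> os_gen_by \<Omega> (\<lambda>\<omega>. min (\<tau> \<omega>) (ennreal s)) \<subseteq> Pow \<Omega>"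
    using F_sub gen_by_sub[OF min_measurable] sets.sets_into_space by blast
  then show ?thesis unfolding K_def os_join_def by (rule sigma_algebra_sigma_sets)
qed

lemma F_K: "F s \<subseteq> K s"
  unfolding K_def os_join_def by (intro subsetI sigma_sets.Basic UnI1)

lemma gen_K:
  assumes "B \<in> sets borel" shows "{\<omega>\<in>\<Omega>. min (\<tau> \<omega>) (ennreal s) \<in> B} \<in> K s"
proof -
  have "{\<omega>\<in>\<Omega>. min (\<tau> \<omega>) (ennreal s) \<in> B} = (\<lambda>\<omega>. min (\<tau> \<omega>) (ennreal s)) -` B \<inter> \<Omega>" by auto
  then have "{\<omega>\<in>\<Omega>. min (\<tau> \<omega>) (ennreal s) \<in> B} \<in> os_gen_by \<Omega> (\<lambda>\<omega>. min (\<tau> \<omega>) (ennreal s))"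
    unfolding os_gen_by_def using assms by (intro sigma_sets.Basic) blast
  then show ?thesis unfolding K_def os_join_def by (intro sigma_sets.Basic UnI2)
qed

text \<open>Merges the inductions over the join and over sigma(tau \<and> s), so that the base cases
  are the sets of \<open>F s\<close> and the preimages under tau \<and> s.\<close>

lemma K_induct:
  assumes s: "0 \<le> s" and A: "A \<in> K s"
    and F: "\<And>A. A \<in> F s \<Longrightarrow> S A"
    and gen: "\<And>B. B \<in> sets (borel::ennreal measure) \<Longrightarrow> S {\<omega>\<in>\<Omega>. min (\<tau> \<omega>) (ennreal s) \<in> B}"
    and compl: "\<And>A. S A \<Longrightarrow> S (\<Omega> - A)"
    and union: "\<And>A :: nat \<Rightarrow> 'a set. (\<And>i. S (A i)) \<Longrightarrow> S (\<Union>i. A i)"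
  shows "S A"
proof -
  let ?f = "\<lambda>\<omega>. min (\<tau> \<omega>) (ennreal s)"
  have S0: "S {}"
  proof (rule F)
    show "{} \<in> F s" using F_sa[OF s] unfolding sigma_algebra_iff2 by simp
  qed
  have S1: "S D" if "D \<in> os_gen_by \<Omega> ?f" for D
    using that unfolding os_gen_by_def
  proof induction
    case (Basic D)
    then obtain B where B: "D = ?f -` B \<inter> \<Omega>" "B \<in> sets borel" by blast
    have "D = {\<omega>\<in>\<Omega>. ?f \<omega> \<in> B}" unfolding B(1) by auto
    then show ?case using gen[OF B(2)] by simp
  qed (rule S0 compl union, assumption?)+
  show ?thesis
    using A unfolding K_def os_join_def
  proof induction
    case (Basic D)
    then show ?case using F S1 by blast
  qed (rule S0 compl union, assumption?)+
qed

lemma Kp_sa: "0 \<le> t \<Longrightarrow> sigma_algebra \<Omega> (Kp t)"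
proof -
  assume "0 \<le> t"
  then have sa: "sigma_algebra \<Omega> (K s)" if "t < s" for s using K_sa[of s] that by simp
  show ?thesis unfolding sigma_algebra_iff2
  proof (intro conjI ballI allI impI)
    have "Kp t \<subseteq> K (t + 1)" unfolding Kp_def by auto
    also have "\<dots> \<subseteq> Pow \<Omega>" using sa[of "t+1"] unfolding sigma_algebra_iff2 by simp
    finally show "Kp t \<subseteq> Pow \<Omega>" .
    have K: "{} \<in> K s" "\<forall>A\<in>K s. \<Omega> - A \<in> K s" "\<forall>A::nat \<Rightarrow> 'a set. range A \<subseteq> K s \<longrightarrow> (\<Union>i. A i) \<in> K s"
      if "t < s" for s using sa[OF that] unfolding sigma_algebra_iff2 by simp_all
    show "{} \<in> Kp t" unfolding Kp_def using K(1) by simp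
    show "\<Omega> - A \<in> Kp t" if "A \<in> Kp t" for A
      using that K(2) unfolding Kp_def by simp
    show "(\<Union>i. A i) \<in> Kp t" if A: "range A \<subseteq> Kp t" for A :: "nat \<Rightarrow> 'a set"
      unfolding Kp_def
    proof (rule INT_I)
      fix s assume "s \<in> {t<..}"
      then have s: "t < s" by simp
      have "range A \<subseteq> K s" using A s unfolding Kp_def by auto
      then show "(\<Union>i. A i) \<in> K s" using K(3)[OF s] by blast
    qed
  qed
qed

lemma Kp_Tinf: "0 \<le> t \<Longrightarrow> Kp t \<subseteq> Tinf"
  unfolding Kp_def using K_Tinf[of "t+1"] by fastforce

text \<open>The generators of \<open>os_N\<close>. Unlike \<open>os_N\<close>, which also contains
  complements, this family is closed under subsets and thus suited to estimates of exceptional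
  sets.\<close>

definition nullset :: "'a set \<Rightarrow> bool" where
  "nullset A \<longleftrightarrow> (\<exists>Z\<in>Tinf. A \<subseteq> Z \<and> emeasure M Z = 0)"

lemma nullset_subset: "nullset A \<Longrightarrow> B \<subseteq> A \<Longrightarrow> nullset B"
  unfolding nullset_def by blast

lemma nullset_UN: "(\<And>n::nat. nullset (A n)) \<Longrightarrow> nullset (\<Union>n. A n)"
proof -
  assume "\<And>n::nat. nullset (A n)"
  then obtain Z where Z: "\<And>n. Z n \<in> Tinf" "\<And>n. A n \<subseteq> Z n" "\<And>n. emeasure M (Z n) = 0"
    unfolding nullset_def by metis
  have "(\<Union>n. Z n) \<in> Tinf" using Z(1) Tinf_sa unfolding sigma_algebra_iff2 by blast
  moreover have "Z n \<in> null_sets M" for n by (rule null_setsI) (use Z Tinf_sub in auto)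
  then have "(\<Union>n. Z n) \<in> null_sets M" by (rule null_sets_UN)
  moreover have "(\<Union>n. A n) \<subseteq> (\<Union>n. Z n)" using Z(2) by blast
  ultimately show ?thesis unfolding nullset_def by (intro bexI[of _ "\<Union>n. Z n"]) auto
qed

lemma nullset_Un: "nullset A \<Longrightarrow> nullset B \<Longrightarrow> nullset (A \<union> B)"
  using nullset_UN[of "\<lambda>n. if n = 0 then A else B"] by (rule nullset_subset) (auto split: if_splits)

lemma nullset_N: "nullset A \<Longrightarrow> A \<in> os_N M F \<tau>"
  unfolding os_N_def os_null_gen_def Tinf_def[symmetric] nullset_def using Tinf_sub
  by (intro sigma_sets.Basic) blast

lemma nullset_null_sets: "nullset A \<Longrightarrow> A \<in> null_sets M"
proof -
  assume n: "nullset A"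
  then obtain Z where Z: "Z \<in> Tinf" "A \<subseteq> Z" "emeasure M Z = 0" unfolding nullset_def by blast
  have "A \<in> sets M" using nullset_N[OF n] N_sets by blast
  moreover have "Z \<in> null_sets M" by (rule null_setsI) (use Z Tinf_sub in auto)
  ultimately show ?thesis using null_sets_subset Z(2) by blast
qed

text \<open>The concrete form of a completion: sets that differ from a member of the sigma-algebra
  by a generator of \<open>os_N\<close>.\<close>

definition modnull :: "'a set set \<Rightarrow> 'a set set" where
  "modnull \<A> = {A. A \<subseteq> \<Omega> \<and> (\<exists>B\<in>\<A>. nullset ((A - B) \<union> (B - A)))}"

lemma modnull_sa:
  assumes sa: "sigma_algebra \<Omega> \<A>" shows "sigma_algebra \<Omega> (modnull \<A>)"
  unfolding sigma_algebra_iff2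
proof (intro conjI ballI allI impI)
  show "modnull \<A> \<subseteq> Pow \<Omega>" unfolding modnull_def by blast
  have "nullset {}" unfolding nullset_def using Tinf_sa unfolding sigma_algebra_iff2 by auto
  then show "{} \<in> modnull \<A>" unfolding modnull_def using sa unfolding sigma_algebra_iff2 by auto
  show "\<Omega> - A \<in> modnull \<A>" if A: "A \<in> modnull \<A>" for A
  proof -
    obtain B where B: "B \<in> \<A>" "nullset ((A - B) \<union> (B - A))" "A \<subseteq> \<Omega>" using A unfolding modnull_def by blast
    have "nullset (((\<Omega> - A) - (\<Omega> - B)) \<union> ((\<Omega> - B) - (\<Omega> - A)))" by (rule nullset_subset[OF B(2)]) blast
    moreover have "\<Omega> - B \<in> \<A>" using B sa unfolding sigma_algebra_iff2 by blast
    ultimately show ?thesis unfolding modnull_def by blast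
  qed
  show "(\<Union>i. A i) \<in> modnull \<A>" if A: "range A \<subseteq> modnull \<A>" for A :: "nat \<Rightarrow> 'a set"
  proof -
    have "\<forall>i. \<exists>B. B \<in> \<A> \<and> nullset ((A i - B) \<union> (B - A i))" using A unfolding modnull_def by blast
    then obtain B where B: "\<And>i. B i \<in> \<A>" "\<And>i. nullset ((A i - B i) \<union> (B i - A i))" by metis
    have "nullset (((\<Union>i. A i) - (\<Union>i. B i)) \<union> ((\<Union>i. B i) - (\<Union>i. A i)))"
      by (rule nullset_subset[OF nullset_UN[of "\<lambda>i. (A i - B i) \<union> (B i - A i)", OF B(2)]]) blast
    moreover have "(\<Union>i. B i) \<in> \<A>" using B(1) sa unfolding sigma_algebra_iff2 by blast
    moreover have "(\<Union>i. A i) \<subseteq> \<Omega>" using A unfolding modnull_def by blast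
    ultimately show ?thesis unfolding modnull_def by blast
  qed
qed

lemma nullset_empty: "nullset {}"
  unfolding nullset_def using Tinf_sa unfolding sigma_algebra_iff2 by auto

lemma sub_modnull:
  assumes "sigma_algebra \<Omega> \<A>" shows "\<A> \<subseteq> modnull \<A>"
proof
  fix A assume "A \<in> \<A>"
  moreover from this have "A \<subseteq> \<Omega>" using assms unfolding sigma_algebra_iff2 by blast
  ultimately show "A \<in> modnull \<A>" unfolding modnull_def using nullset_empty
    by (auto intro!: bexI[of _ A])
qed

lemma N_modnull:
  assumes "sigma_algebra \<Omega> \<A>" shows "os_N M F \<tau> \<subseteq> modnull \<A>"
  unfolding os_N_def os_null_gen_def Tinf_def[symmetric]
proof (rule sigma_algebra.sigma_sets_subset[OF modnull_sa[OF assms]], rule subsetI)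
  fix A assume "A \<in> {N. \<exists>B\<in>Tinf. N \<subseteq> B \<and> B \<in> sets M \<and> emeasure M B = 0}"
  then have n: "nullset A" unfolding nullset_def by blast
  have "A \<subseteq> \<Omega>" using nullset_null_sets[OF n] sets.sets_into_space by blast
  moreover have "{} \<in> \<A>" using assms unfolding sigma_algebra_iff2 by blast
  ultimately show "A \<in> modnull \<A>" unfolding modnull_def using n by (auto intro!: bexI[of _ "{}"])
qed

section \<open>The completed filtration G\<close>

lemma G_sa: "sigma_algebra \<Omega> (G t)" if "0 \<le> t"
proof -
  have "os_N M F \<tau> \<union> Kp t \<subseteq> Pow \<Omega>"
    using N_sets sets.sets_into_space Kp_sa[OF that] unfolding sigma_algebra_iff2 by blast
  then show ?thesis unfolding os_G_def os_join_def[of _ "os_N M F \<tau>"] K_def[symmetric] Kp_def[symmetric]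
    by (rule sigma_algebra_sigma_sets)
qed

lemma N_G: "os_N M F \<tau> \<subseteq> G t"
  unfolding os_G_def os_join_def[of _ "os_N M F \<tau>"] by (intro subsetI sigma_sets.Basic UnI1)

lemma Kp_G: "Kp t \<subseteq> G t"
  unfolding os_G_def os_join_def[of _ "os_N M F \<tau>"] K_def[symmetric] Kp_def[symmetric]
  by (intro subsetI sigma_sets.Basic UnI2)

text \<open>Replaces the generated join with the null sets by one representative in
  \<open>Kp t\<close> and one null set.\<close>

lemma G_eq: assumes t: "0 \<le> t" shows "G t = modnull (Kp t)"
proof
  show "G t \<subseteq> modnull (Kp t)"
    unfolding os_G_def os_join_def[of _ "os_N M F \<tau>"] K_def[symmetric] Kp_def[symmetric]
    by (rule sigma_algebra.sigma_sets_subset[OF modnull_sa[OF Kp_sa[OF t]]])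
      (use N_modnull[OF Kp_sa[OF t]] sub_modnull[OF Kp_sa[OF t]] in blast)
  show "modnull (Kp t) \<subseteq> G t"
  proof
    fix A assume "A \<in> modnull (Kp t)"
    then obtain B where B: "B \<in> Kp t" "nullset ((A - B) \<union> (B - A))" "A \<subseteq> \<Omega>" unfolding modnull_def by blast
    interpret sigma_algebra \<Omega> "G t" by (rule G_sa[OF t])
    have "A - B \<in> G t" "B - A \<in> G t"
      using nullset_N[OF nullset_subset[OF B(2)]] N_G by blast+
    moreover have "B \<in> G t" using B Kp_G by blast
    ultimately have "(B - (B - A)) \<union> (A - B) \<in> G t" by auto
    moreover have "(B - (B - A)) \<union> (A - B) = A" by blast
    ultimately show "A \<in> G t" by simp
  qed
qed

lemma G_mono: assumes "0 \<le> s" "s \<le> t" shows "G s \<subseteq> G t"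
proof -
  have "Kp s \<subseteq> Kp t" unfolding Kp_def using assms by auto
  then show ?thesis using G_eq[OF assms(1)] G_eq[of t] assms unfolding modnull_def by auto
qed

lemma G_sub: "0 \<le> t \<Longrightarrow> G t \<subseteq> sets M"
  unfolding os_G_def os_join_def[of _ "os_N M F \<tau>"] K_def[symmetric] Kp_def[symmetric]
  by (rule sets.sigma_sets_subset) (use N_sets Kp_Tinf Tinf_sub in blast)

text \<open>The null sets are joined after the intersection over s > t, so right-continuity needs an
  argument. The representatives of A in \<open>Kp (u n)\<close> vary with n; their limsup lies in
  every \<open>K s\<close> with s > t, and it differs from A only inside the union of the
  exceptional sets.\<close>

lemma G_right:
  assumes t: "0 \<le> t" and A: "\<And>s. t < s \<Longrightarrow> A \<in> G s" shows "A \<in> G t"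
proof -
  define u where "u n = t + 1 / Suc n" for n
  have u: "t < u n" "0 \<le> u n" for n unfolding u_def using t by auto
  have udec: "u n \<le> u m" if "m \<le> n" for m n unfolding u_def using that by (simp add: frac_le)
  have "\<forall>n. \<exists>B. B \<in> Kp (u n) \<and> nullset ((A - B) \<union> (B - A))"
    using A[OF u(1)] G_eq[OF u(2)] unfolding modnull_def by blast
  then obtain B where B: "\<And>n. B n \<in> Kp (u n)" "\<And>n. nullset ((A - B n) \<union> (B n - A))" by metis
  define L where "L = (\<Inter>m. \<Union>n. B (m + n))"
  have "L \<in> K s" if s: "t < s" for s
  proof -
    have s0: "0 \<le> s" using s t by simp
    obtain k :: nat where k: "1 / Suc k < s - t" using nat_approx_posE[of "s - t"] s by auto
    have "u n < s" if "k \<le> n" for n using udec[OF that] k unfolding u_def by linarith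
    then have "B n \<in> K s" if "k \<le> n" for n using that B(1)[of n] unfolding Kp_def by blast
    then show ?thesis unfolding L_def by (rule limsup_sigma_algebra[OF K_sa[OF s0]])
  qed
  then have "L \<in> Kp t" unfolding Kp_def by blast
  moreover have "nullset ((A - L) \<union> (L - A))"
  proof (rule nullset_subset[OF nullset_UN[OF B(2)]], rule subsetI)
    fix x assume x: "x \<in> (A - L) \<union> (L - A)"
    show "x \<in> (\<Union>n. (A - B n) \<union> (B n - A))"
    proof (cases "x \<in> A")
      case True
      then obtain m where "\<forall>n. x \<notin> B (m + n)" using x unfolding L_def by blast
      then have "x \<notin> B (m + 0)" by blast
      then show ?thesis using True by blast
    next
      case False
      then obtain n where "x \<in> B (0 + n)" using x unfolding L_def by blast
      then show ?thesis using False by blast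
    qed
  qed
  moreover have "A \<subseteq> \<Omega>" using A[OF u(1)[of 0]] G_sa[OF u(2)[of 0]] unfolding sigma_algebra_iff2 by blast
  ultimately show ?thesis unfolding G_eq[OF t] modnull_def by blast
qed

lemma F_G: "0 \<le> t \<Longrightarrow> F t \<subseteq> G t"
proof -
  assume t: "0 \<le> t"
  have "F t \<subseteq> K s" if "t < s" for s using F_mono[OF t, of s] F_K[of s] that by auto
  then have "F t \<subseteq> Kp t" unfolding Kp_def by blast
  then show ?thesis using Kp_G by blast
qed

text \<open>For s > t, the variables tau and tau \<and> s agree whenever either is at most
  t.\<close>

lemma \<tau>_le_G:
  assumes t: "0 \<le> t" and B: "B \<in> sets (borel::ennreal measure)"
  shows "{\<omega>\<in>\<Omega>. \<tau> \<omega> \<in> B \<and> \<tau> \<omega> \<le> ennreal t} \<in> G t"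
proof -
  have "{\<omega>\<in>\<Omega>. \<tau> \<omega> \<in> B \<and> \<tau> \<omega> \<le> ennreal t} \<in> K s" if s: "t < s" for s
  proof -
    have ts: "ennreal t < ennreal s" using s t by (simp add: ennreal_less_iff)
    have "B \<inter> {..ennreal t} \<in> sets borel" using B by simp
    from gen_K[OF this, of s]
    have "{\<omega>\<in>\<Omega>. min (\<tau> \<omega>) (ennreal s) \<in> B \<inter> {..ennreal t}} \<in> K s" .
    moreover have "min x (ennreal s) \<in> B \<inter> {..ennreal t} \<longleftrightarrow> x \<in> B \<and> x \<le> ennreal t" for x
      using ts by (auto simp: min_def split: if_splits)
    ultimately show ?thesis by simp
  qed
  then show ?thesis using Kp_G unfolding Kp_def by blast
qed

lemma G_filtration: "os_filtration M G"
  unfolding os_filtration_def using G_sa G_sub G_mono by blast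

lemma G_rc: "os_right_continuous G"
  unfolding os_right_continuous_def
proof (intro allI impI equalityI)
  fix t :: real assume t: "0 \<le> t"
  show "G t \<subseteq> \<Inter> (G ` {t<..})"
  proof (rule INT_greatest)
    fix s assume "s \<in> {t<..}"
    then show "G t \<subseteq> G s" using G_mono[OF t, of s] by simp
  qed
  show "\<Inter> (G ` {t<..}) \<subseteq> G t" using G_right[OF t] by blast
qed

lemma G_Ginf: "0 \<le> t \<Longrightarrow> G t \<subseteq> Ginf"
  unfolding os_Ginf_def os_Finf_def by (intro subsetI sigma_sets.Basic) auto

lemma Ginf_sa: "sigma_algebra \<Omega> Ginf"
proof -
  have "(\<Union>t\<in>{0..}. G t) \<subseteq> Pow \<Omega>"
  proof (rule UN_least)
    fix t :: real assume "t \<in> {0..}"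
    then show "G t \<subseteq> Pow \<Omega>" using G_sa[of t] unfolding sigma_algebra_iff2 by simp
  qed
  then show ?thesis unfolding os_Ginf_def os_Finf_def by (rule sigma_algebra_sigma_sets)
qed

lemma Ginf_sub: "Ginf \<subseteq> sets M"
  unfolding os_Ginf_def os_Finf_def
proof (rule sets.sigma_sets_subset, rule UN_least)
  fix t :: real assume "t \<in> {0..}"
  then show "G t \<subseteq> sets M" using G_sub[of t] by simp
qed

lemma Finf_Ginf: "os_Finf \<Omega> F \<subseteq> Ginf"
  unfolding os_Finf_def
proof (rule sigma_algebra.sigma_sets_subset[OF Ginf_sa], rule UN_least)
  fix t :: real assume "t \<in> {0..}"
  then show "F t \<subseteq> Ginf" using F_G[of t] G_Ginf[of t] by auto
qed

lemma Ginf_modnull: "Ginf \<subseteq> modnull Tinf"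
  unfolding os_Ginf_def os_Finf_def
proof (rule sigma_algebra.sigma_sets_subset[OF modnull_sa[OF Tinf_sa]], rule UN_least)
  fix t :: real assume "t \<in> {0..}"
  then have t: "0 \<le> t" by simp
  show "G t \<subseteq> modnull Tinf" unfolding G_eq[OF t] modnull_def using Kp_Tinf[OF t] by blast
qed

text \<open>The representative B of A in \<open>Tinf\<close> is covered by A and a null set of
  \<open>Tinf\<close>, hence is itself a null set of \<open>Tinf\<close>. This places the
  exceptional sets of the final formula in \<open>os_N\<close>.\<close>

lemma Ginf_nullset:
  assumes A: "A \<in> Ginf" and n: "emeasure M A = 0" shows "nullset A"
proof -
  obtain B where B: "B \<in> Tinf" "nullset ((A - B) \<union> (B - A))" using A Ginf_modnull unfolding modnull_def by blast
  obtain Z where Z: "Z \<in> Tinf" "(A - B) \<union> (B - A) \<subseteq> Z" "emeasure M Z = 0" using B(2) unfolding nullset_def by blast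
  have "A \<in> null_sets M" "Z \<in> null_sets M" using A n Z Ginf_sub Tinf_sub by (auto intro: null_setsI)
  then have AZ: "A \<union> Z \<in> null_sets M" by (rule null_sets.Un)
  have "B \<subseteq> A \<union> Z" using Z by blast
  then have "B \<in> null_sets M" using null_sets_subset[OF AZ] B(1) Tinf_sub by blast
  then have "nullset B" unfolding nullset_def using B(1) by auto
  then show ?thesis using nullset_subset[OF nullset_Un[OF _ B(2)], of B A] by blast
qed

section \<open>Measures on the terminal sigma-algebra\<close>

text \<open>Restricting to \<open>Ginf\<close> ensures that exceptional null sets lie in \<open>os_N M F \<tau>\<close>.\<close>

definition "M0 = restr_to_subalg M (sigma \<Omega> Ginf)"

lemma sets_sigma_Ginf: "sets (sigma \<Omega> Ginf) = Ginf"
  by (rule sigma_algebra.sets_measure_of_eq[OF Ginf_sa])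

lemma subalgebra_Ginf: "subalgebra M (sigma \<Omega> Ginf)"
  unfolding subalgebra_def sets_sigma_Ginf using Ginf_sub by (simp add: space_measure_of_conv)

lemma sets_M0: "sets M0 = Ginf"
  unfolding M0_def sets_restr_to_subalg[OF subalgebra_Ginf] by (rule sets_sigma_Ginf)

lemma space_M0: "space M0 = \<Omega>"
  unfolding M0_def by (rule space_restr_to_subalg)

lemma emeasure_M0: "A \<in> Ginf \<Longrightarrow> emeasure M0 A = emeasure M A"
  unfolding M0_def by (rule emeasure_restr_to_subalg[OF subalgebra_Ginf]) (simp add: sets_sigma_Ginf)

lemma prob_space_M0: "prob_space M0"
  unfolding M0_def by (rule prob_space_restr_to_subalg[OF subalgebra_Ginf]) (rule prob_space_axioms)

lemma usual_F: "usual_conditions M0 F"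
proof -
  interpret M0: prob_space M0 by (rule prob_space_M0)
  show ?thesis
  proof
    show "os_filtration M0 F"
      using F_filtration F_G G_Ginf unfolding os_filtration_def space_M0 sets_M0 by blast
    show "os_right_continuous F" by (rule F_rc)
    fix A assume A: "A \<in> os_Finf (space M0) F" "emeasure M0 A = 0"
    have A': "A \<in> os_Finf \<Omega> F" using A(1) space_M0 by simp
    have "emeasure M A = 0" using A(2) emeasure_M0 A' Finf_Ginf by auto
    moreover have "A \<in> sets M" using A' Finf_sub by blast
    ultimately have "A \<in> os_null_gen M (os_Finf \<Omega> F)"
      unfolding os_null_gen_def using A' by (intro sigma_sets.Basic) blast
    then show "A \<in> F 0" using F_null by blast
  qed
qed

text \<open>Covers \<open>M0\<close> and all sH-measures, so that one construction of G-martingales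
  serves both and almost sure statements can be moved between them.\<close>

definition equiv_measure :: "'a measure \<Rightarrow> bool" where
  "equiv_measure Q \<longleftrightarrow> prob_space Q \<and> space Q = \<Omega> \<and> sets Q = Ginf \<and>
    (\<forall>A\<in>Ginf. emeasure Q A = 0 \<longleftrightarrow> emeasure M A = 0)"

lemma equiv_M0: "equiv_measure M0"
  unfolding equiv_measure_def using prob_space_M0 space_M0 sets_M0 emeasure_M0 by auto

lemma usual_G:
  assumes Q: "equiv_measure Q" shows "usual_conditions Q G"
proof -
  have sp: "space Q = \<Omega>" and se: "sets Q = Ginf" using Q unfolding equiv_measure_def by auto
  interpret Q: prob_space Q using Q unfolding equiv_measure_def by blast
  show ?thesis
  proof
    show "os_filtration Q G"
      using G_filtration G_Ginf unfolding os_filtration_def sp se by blast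
    show "os_right_continuous G" by (rule G_rc)
    fix A assume A: "A \<in> os_Finf (space Q) G" "emeasure Q A = 0"
    have A': "A \<in> Ginf" using A(1) unfolding sp os_Ginf_def by simp
    then have "emeasure M A = 0" using A(2) Q unfolding equiv_measure_def by blast
    then have "nullset A" by (rule Ginf_nullset[OF A'])
    then show "A \<in> G 0" using nullset_N N_G by blast
  qed
qed

lemma null_sets_equiv:
  assumes Q: "equiv_measure Q" shows "null_sets Q = null_sets M0"
  using Q emeasure_M0 unfolding equiv_measure_def null_sets_def sets_M0 by auto

lemma AE_equiv:
  assumes Q: "equiv_measure Q" and AE: "AE \<omega> in Q. S \<omega>" shows "AE \<omega> in M0. S \<omega>"
proof -
  have sp: "space Q = \<Omega>" using Q unfolding equiv_measure_def by auto
  show ?thesis using AE unfolding eventually_ae_filter null_sets_equiv[OF Q] sp space_M0 .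
qed

lemma AE_equiv2:
  assumes Q: "equiv_measure Q" and AE: "AE \<omega> in M0. S \<omega>" shows "AE \<omega> in Q. S \<omega>"
proof -
  have sp: "space Q = \<Omega>" using Q unfolding equiv_measure_def by auto
  show ?thesis using AE unfolding eventually_ae_filter null_sets_equiv[OF Q] sp space_M0 .
qed

lemma AE_M0_nullset:
  assumes "nullset Z" "\<And>\<omega>. \<omega> \<in> \<Omega> - Z \<Longrightarrow> S \<omega>" shows "AE \<omega> in M0. S \<omega>"
proof (rule AE_I')
  have "Z \<in> Ginf" using nullset_N[OF assms(1)] N_G[of 0] G_Ginf[of 0] by auto
  moreover have "emeasure M Z = 0" using nullset_null_sets[OF assms(1)] by auto
  ultimately show "Z \<in> null_sets M0" using emeasure_M0 sets_M0 by (intro null_setsI) auto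
  show "{\<omega> \<in> space M0. \<not> S \<omega>} \<subseteq> Z" using assms(2) space_M0 by auto
qed

text \<open>Translates almost sure statements into the exceptional sets demanded by
  \<open>os_splitting\<close>.\<close>

lemma AE_M0_E:
  assumes "AE \<omega> in M0. S \<omega>"
  shows "\<exists>Z. Z \<in> os_N M F \<tau> \<and> Z \<in> sets M \<and> emeasure M Z = 0 \<and> (\<forall>\<omega>\<in>\<Omega> - Z. S \<omega>)"
proof -
  obtain Z where Z: "Z \<in> null_sets M0" "{\<omega> \<in> space M0. \<not> S \<omega>} \<subseteq> Z" using assms unfolding eventually_ae_filter by blast
  have ZG: "Z \<in> Ginf" using Z(1) sets_M0 by auto
  have "emeasure M Z = 0" using Z(1) emeasure_M0[OF ZG] by auto
  moreover from this have "Z \<in> os_N M F \<tau>" using nullset_N Ginf_nullset[OF ZG] by blast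
  ultimately show ?thesis using Z(2) ZG Ginf_sub space_M0 by (intro exI[of _ Z]) auto
qed

end

section \<open>Splitting before \<open>\<tau>\<close> and at time \<open>0\<close>\<close>

lemma ennreal_rat_between:
  assumes t: "0 \<le> t" and z: "ennreal t < z"
  shows "\<exists>q\<in>nnrat. t < q \<and> ennreal q < z"
proof -
  obtain u where u: "t < u" "ennreal u \<le> z"
  proof (cases z)
    case (real r)
    then show ?thesis using that[of r] z t by (simp add: ennreal_less_iff)
  next
    case top
    then show ?thesis using that[of "t+1"] by simp
  qed
  obtain q where q: "q \<in> \<rat>" "t < q" "q < u" using Rats_dense_in_real[OF u(1)] by blast
  have "ennreal q < ennreal u" using q t by (simp add: ennreal_less_iff)
  then have "ennreal q < z" using u(2) by (rule less_le_trans)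
  then show ?thesis using q t by (intro bexI[of _ q]) auto
qed

text \<open>If \<open>X q\<close> is the martingale of the event \<open>q < R\<close>, then it is positive on this event and vanishes
  from \<open>R\<close> on, so that it detects \<open>R \<le> t\<close>.\<close>

lemma threshold_iff_vanishing:
  fixes X :: "real \<Rightarrow> real \<Rightarrow> real" and R U :: ennreal
  assumes t: "0 \<le> t" "ennreal t < U"
    and rc: "\<And>q. q \<in> nnrat \<Longrightarrow> (X q \<longlongrightarrow> X q t) (at_right t)"
    and pos: "\<And>q. q \<in> nnrat \<Longrightarrow> ennreal q < R \<Longrightarrow> ennreal q < U \<Longrightarrow> 0 < X q t"
    and zero: "\<And>q r. q \<in> nnrat \<Longrightarrow> r \<in> nnrat \<Longrightarrow> r \<le> q \<Longrightarrow> R \<le> ennreal r \<Longrightarrow> ennreal r < U \<Longrightarrow> X q r = 0"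
  shows "R \<le> ennreal t \<longleftrightarrow> (\<forall>q\<in>nnrat. t \<le> q \<longrightarrow> X q t \<le> 0)"
proof
  assume R: "R \<le> ennreal t"
  show "\<forall>q\<in>nnrat. t \<le> q \<longrightarrow> X q t \<le> 0"
  proof (intro ballI impI)
    fix q assume q: "q \<in> nnrat" "t \<le> q"
    show "X q t \<le> 0"
    proof (cases "t = q")
      case True
      then show ?thesis using zero[OF q(1) q(1)] R t by simp
    next
      case False
      obtain u where u: "u \<in> nnrat" "t < u" "ennreal u < U" using ennreal_rat_between[OF t] by blast
      \<comment> \<open>Zeros are available at rational r \<le> q with r < U only, so the comparison
        interval ends at the minimum of q and u.\<close>
      have "X q t = (\<lambda>_. 0) t"
      proof (rule right_continuous_eq_on[where u="min q u" and f="X q" and g="\<lambda>_. 0"])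
        fix r assume r: "r \<in> nnrat" "t < r" "r < min q u"
        have "R \<le> ennreal r" by (rule order_trans[OF R]) (use r in \<open>simp add: ennreal_leI\<close>)
        moreover have "ennreal r < U" by (rule le_less_trans[OF _ u(3)]) (use r in \<open>simp add: ennreal_leI\<close>)
        ultimately show "X q r = 0" using zero[OF q(1) r(1)] r(3) by simp
      qed (use rc[OF q(1)] t False q u in auto)
      then show ?thesis by simp
    qed
  qed
next
  assume Z: "\<forall>q\<in>nnrat. t \<le> q \<longrightarrow> X q t \<le> 0"
  show "R \<le> ennreal t"
  proof (rule ccontr)
    assume "\<not> R \<le> ennreal t"
    then have "ennreal t < min R U" using t by simp
    then obtain q where q: "q \<in> nnrat" "t < q" "ennreal q < min R U" using ennreal_rat_between[OF t(1)] by blast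
    then have "0 < X q t" using pos[of q] by simp
    then show False using Z q by (meson less_imp_le not_le)
  qed
qed

section \<open>Representing optional sets and processes up to null sets\<close>

context enlargement begin

definition OM :: "(real \<Rightarrow> 'a set set) \<Rightarrow> (real \<times> 'a) measure" where
  "OM H = sigma ({0..} \<times> \<Omega>) (os_optional_sets \<Omega> H)"

definition PM :: "(ennreal \<times> real \<times> 'a) measure" where
  "PM = (borel :: ennreal measure) \<Otimes>\<^sub>M OM F"

lemma space_OM: "space (OM H) = {0..} \<times> \<Omega>"
  unfolding OM_def by (simp add: space_measure_of_conv)

lemma optional_sa: "sigma_algebra ({0..} \<times> \<Omega>) (os_optional_sets \<Omega> H)"
proof -
  have "{{(t, \<omega>). (t, \<omega>) \<in> {0..} \<times> \<Omega> \<and> X t \<omega> \<in> B} | (X :: real \<Rightarrow> 'a \<Rightarrow> real) B.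
    os_adapted \<Omega> H X \<and> os_cadlag \<Omega> X \<and> B \<in> sets borel} \<subseteq> Pow ({0..} \<times> \<Omega>)" by auto
  then show ?thesis unfolding os_optional_sets_def by (rule sigma_algebra_sigma_sets)
qed

lemma sets_OM: "sets (OM H) = os_optional_sets \<Omega> H"
  unfolding OM_def by (rule sigma_algebra.sets_measure_of_eq[OF optional_sa])

lemma space_PM: "space PM = UNIV \<times> {0..} \<times> \<Omega>"
  unfolding PM_def space_pair_measure space_OM by simp

lemma cadlag_adapted_OM:
  assumes "os_adapted \<Omega> H X" "os_cadlag \<Omega> X"
  shows "(\<lambda>p. X (fst p) (snd p)) \<in> borel_measurable (OM H)"
proof (rule measurableI)
  fix B :: "real set" assume B: "B \<in> sets borel"
  have "(\<lambda>p. X (fst p) (snd p)) -` B \<inter> space (OM H) = {(t,\<omega>) \<in> {0..} \<times> \<Omega>. X t \<omega> \<in> B}"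
    unfolding space_OM by auto
  also have "\<dots> \<in> os_optional_sets \<Omega> H"
    unfolding os_optional_sets_def using assms B by (intro sigma_sets.Basic) blast
  finally show "(\<lambda>p. X (fst p) (snd p)) -` B \<inter> space (OM H) \<in> sets (OM H)" unfolding sets_OM .
qed simp

lemma time_measurable_OM: assumes "\<And>t. 0 \<le> t \<Longrightarrow> sigma_algebra \<Omega> (H t)"
  shows "fst \<in> borel_measurable (OM H)"
proof -
  have "(\<lambda>p. (\<lambda>t \<omega>. t) (fst p) (snd p)) \<in> borel_measurable (OM H)"
  proof (rule cadlag_adapted_OM)
    show "os_adapted \<Omega> H (\<lambda>t \<omega>. t)" unfolding os_adapted_def
    proof (intro allI impI ballI)
      fix t :: real and B :: "real set" assume "0 \<le> t"
      then have "{} \<in> H t" "\<Omega> \<in> H t"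
        using assms[of t] sigma_algebra.sigma_sets_eq sigma_sets_top[of \<Omega> "H t"] sigma_sets.Empty[of \<Omega> "H t"] by metis+
      then show "{\<omega> \<in> \<Omega>. t \<in> B} \<in> H t" by (cases "t \<in> B") auto
    qed
    show "os_cadlag \<Omega> (\<lambda>t \<omega>. t)" unfolding os_cadlag_def
    proof (intro ballI allI impI conjI)
      fix t :: real
      show "((\<lambda>s. s) \<longlongrightarrow> t) (at_right t)" by (rule tendsto_ident_at)
      show "\<exists>l. ((\<lambda>s. s) \<longlongrightarrow> l) (at_left t)" by (intro exI) (rule tendsto_ident_at)
    qed
  qed
  then show ?thesis by simp
qed

definition agrees :: "(real \<times> 'a \<Rightarrow> 'c) \<Rightarrow> (real \<times> 'a) set \<Rightarrow> (real \<times> 'a) set \<Rightarrow> 'c set \<Rightarrow> bool" where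
  "agrees \<phi> A D W \<longleftrightarrow> (AE \<omega> in M0. \<forall>t\<ge>0. (t,\<omega>) \<in> A \<longrightarrow> ((t,\<omega>) \<in> D \<longleftrightarrow> \<phi> (t,\<omega>) \<in> W))"

text \<open>One notion for both halves of the formula: the identity into \<open>OM F\<close>
  describes sets by F-optional ones, as for Y', and the map to (tau, t, omega) into
  \<open>PM\<close> describes them as for Y''. The exceptional set of paths does not depend on
  time.\<close>

definition traced :: "(real \<times> 'a \<Rightarrow> 'c) \<Rightarrow> 'c measure \<Rightarrow> (real \<times> 'a) set \<Rightarrow> (real \<times> 'a) set set" where
  "traced \<phi> N A = {D. \<exists>W. W \<in> sets N \<and> agrees \<phi> A D W}"

lemma tracedI:
  assumes "W \<in> sets N" "AE \<omega> in M0. \<forall>t\<ge>0. (t,\<omega>) \<in> A \<longrightarrow> ((t,\<omega>) \<in> D \<longleftrightarrow> \<phi> (t,\<omega>) \<in> W)"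
  shows "D \<in> traced \<phi> N A"
  using assms unfolding traced_def agrees_def by blast

lemma tracedE:
  assumes "D \<in> traced \<phi> N A"
  obtains W where "W \<in> sets N" "agrees \<phi> A D W"
  using assms unfolding traced_def by blast

text \<open>Preimages commute with complements and countable unions, and each step meets countably
  many exceptional sets. Complements require phi to take values in the space of N.\<close>

lemma traced_sigma_sets:
  assumes \<phi>: "\<And>t \<omega>. 0 \<le> t \<Longrightarrow> \<omega> \<in> \<Omega> \<Longrightarrow> \<phi> (t,\<omega>) \<in> space N"
    and S: "S \<subseteq> traced \<phi> N A"
  shows "sigma_sets ({0..} \<times> \<Omega>) S \<subseteq> traced \<phi> N A"
proof
  fix D assume "D \<in> sigma_sets ({0..} \<times> \<Omega>) S"
  then show "D \<in> traced \<phi> N A"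
  proof induction
    case (Basic D)
    then show ?case using S by blast
  next
    case Empty
    show ?case by (rule tracedI[OF sets.empty_sets]) simp
  next
    case (Compl D)
    obtain W where W: "W \<in> sets N" "agrees \<phi> A D W"
      using Compl.IH by (rule tracedE)
    show ?case
    proof (rule tracedI[OF sets.compl_sets[OF W(1)]])
      show "AE \<omega> in M0. \<forall>t\<ge>0. (t,\<omega>) \<in> A \<longrightarrow> ((t,\<omega>) \<in> {0..} \<times> \<Omega> - D \<longleftrightarrow> \<phi> (t,\<omega>) \<in> space N - W)"
        using W(2)[unfolded agrees_def] AE_space
      proof eventually_elim
        case (elim \<omega>)
        have w: "\<omega> \<in> \<Omega>" using elim(2) unfolding space_M0 .
        show ?case
        proof (intro allI impI)
          fix t :: real assume t: "0 \<le> t" "(t,\<omega>) \<in> A"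
          have "\<phi> (t,\<omega>) \<in> space N" by (rule \<phi>[OF t(1) w])
          moreover have "(t,\<omega>) \<in> D \<longleftrightarrow> \<phi> (t,\<omega>) \<in> W" using elim(1) t by blast
          ultimately show "(t,\<omega>) \<in> {0..} \<times> \<Omega> - D \<longleftrightarrow> \<phi> (t,\<omega>) \<in> space N - W" using t w by simp
        qed
      qed
    qed
  next
    case (Union D)
    have "\<forall>i. \<exists>W. W \<in> sets N \<and> agrees \<phi> A (D i) W"
      using Union.IH unfolding traced_def by blast
    then obtain W where W: "\<And>i. W i \<in> sets N" "\<And>i. agrees \<phi> A (D i) (W i)" by metis
    show ?case
    proof (rule tracedI)
      show "(\<Union>i. W i) \<in> sets N" by (rule sets.countable_UN'') (simp_all add: W(1))
      have "AE \<omega> in M0. \<forall>i. \<forall>t\<ge>0. (t,\<omega>) \<in> A \<longrightarrow> ((t,\<omega>) \<in> D i \<longleftrightarrow> \<phi> (t,\<omega>) \<in> W i)"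
        using W(2)[unfolded agrees_def] unfolding AE_all_countable by (rule allI)
      then show "AE \<omega> in M0. \<forall>t\<ge>0. (t,\<omega>) \<in> A \<longrightarrow> ((t,\<omega>) \<in> (\<Union>i. D i) \<longleftrightarrow> \<phi> (t,\<omega>) \<in> (\<Union>i. W i))"
      proof eventually_elim
        case (elim \<omega>)
        then show ?case by simp
      qed
    qed
  qed
qed

lemma SUP_rat_below:
  fixes y :: real
  shows "(SUP q\<in>\<rat>. if q < y then ereal q else - \<infinity>) = ereal y"
proof (rule antisym)
  show "(SUP q\<in>\<rat>. if q < y then ereal q else - \<infinity>) \<le> ereal y" by (rule SUP_least) auto
  show "ereal y \<le> (SUP q\<in>\<rat>. if q < y then ereal q else - \<infinity>)"
  proof (rule dense_le)
    fix z assume "z < ereal y"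
    then obtain r where r: "z < ereal (real_of_rat r)" "ereal (real_of_rat r) < ereal y" using ereal_dense3 by blast
    have "ereal (real_of_rat r) \<le> (SUP q\<in>\<rat>. if q < y then ereal q else - \<infinity>)"
      by (rule SUP_upper2[of "real_of_rat r"]) (use r(2) in auto)
    then show "z \<le> (SUP q\<in>\<rat>. if q < y then ereal q else - \<infinity>)" using r(1) by (meson less_le_trans less_imp_le)
  qed
qed

text \<open>A Doob-Dynkin factorization up to a null set: a real number is the supremum of the
  rationals below it (\<open>SUP_rat_below\<close>), so Y is rebuilt from representatives of its
  level sets.\<close>

lemma traced_process:
  assumes Y: "\<And>q. {p \<in> {0..} \<times> \<Omega>. q < Y p} \<in> traced \<phi> N A"
  shows "\<exists>g::_ \<Rightarrow> real. g \<in> borel_measurable N \<and> (AE \<omega> in M0. \<forall>t\<ge>0. (t,\<omega>) \<in> A \<longrightarrow> Y (t,\<omega>) = g (\<phi> (t,\<omega>)))"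
proof -
  have "\<forall>q::real. \<exists>W. W \<in> sets N \<and> agrees \<phi> A {p \<in> {0..} \<times> \<Omega>. q < Y p} W"
    using Y unfolding traced_def by blast
  then obtain W where W: "\<And>q. W q \<in> sets N"
    "\<And>q::real. agrees \<phi> A {p \<in> {0..} \<times> \<Omega>. q < Y p} (W q)" by metis
  \<comment> \<open>The chosen sets \<open>W q\<close> need not be nested, so the supremum may be
    infinite at some points; \<open>real_of_ereal\<close> makes g real-valued everywhere.\<close>
  define g where "g c = real_of_ereal (SUP q\<in>\<rat>. if c \<in> W q then ereal q else - \<infinity>)" for c
  have "(\<lambda>c. SUP q\<in>\<rat>. if c \<in> W q then ereal q else - \<infinity>) \<in> borel_measurable N"
  proof (rule borel_measurable_SUP[OF countable_rat])
    fix q :: real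
    have [measurable]: "W q \<in> sets N" by (rule W(1))
    show "(\<lambda>c. if c \<in> W q then ereal q else - \<infinity>) \<in> borel_measurable N" by measurable
  qed
  then have "g \<in> borel_measurable N" unfolding g_def by (rule borel_measurable_real_of_ereal)
  moreover have "AE \<omega> in M0. \<forall>q\<in>\<rat>. \<forall>t\<ge>0. (t,\<omega>) \<in> A \<longrightarrow> ((t,\<omega>) \<in> {p \<in> {0..} \<times> \<Omega>. q < Y p} \<longleftrightarrow> \<phi> (t,\<omega>) \<in> W q)"
    by (rule AE_ball_countable'[OF W(2)[unfolded agrees_def] countable_rat])
  then have "AE \<omega> in M0. \<forall>t\<ge>0. (t,\<omega>) \<in> A \<longrightarrow> Y (t,\<omega>) = g (\<phi> (t,\<omega>))"
    using AE_space
  proof eventually_elim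
    case (elim \<omega>)
    show ?case
    proof (intro allI impI)
      fix t :: real assume t: "0 \<le> t" "(t,\<omega>) \<in> A"
      have "(SUP q\<in>\<rat>. if \<phi> (t,\<omega>) \<in> W q then ereal q else - \<infinity>) = (SUP q\<in>\<rat>. if q < Y (t,\<omega>) then ereal q else - \<infinity>)"
      proof (rule SUP_cong[OF refl])
        fix q :: real assume "q \<in> \<rat>"
        then have "(t,\<omega>) \<in> {p \<in> {0..} \<times> \<Omega>. q < Y p} \<longleftrightarrow> \<phi> (t,\<omega>) \<in> W q" using elim(1) t by blast
        then have "\<phi> (t,\<omega>) \<in> W q \<longleftrightarrow> q < Y (t,\<omega>)" using elim(2) t unfolding space_M0 by simp
        then show "(if \<phi> (t,\<omega>) \<in> W q then ereal q else - \<infinity>) = (if q < Y (t,\<omega>) then ereal q else - \<infinity>)" by simp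
      qed
      then show "Y (t,\<omega>) = g (\<phi> (t,\<omega>))" unfolding g_def SUP_rat_below by simp
    qed
  qed
  ultimately show ?thesis by blast
qed

lemma optional_process_traced:
  assumes st: "\<And>R. os_stopping_time \<Omega> G R \<Longrightarrow> after_time \<Omega> R \<in> traced \<phi> N A"
    and \<phi>: "\<And>t \<omega>. 0 \<le> t \<Longrightarrow> \<omega> \<in> \<Omega> \<Longrightarrow> \<phi> (t,\<omega>) \<in> space N"
    and Y: "os_optional_proc \<Omega> G Y"
  shows "\<exists>g::_ \<Rightarrow> real. g \<in> borel_measurable N \<and> (AE \<omega> in M0. \<forall>t\<ge>0. (t,\<omega>) \<in> A \<longrightarrow> Y (t,\<omega>) = g (\<phi> (t,\<omega>)))"
proof (rule traced_process)
  fix q :: real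
  interpret U: usual_conditions M0 G by (rule usual_G[OF equiv_M0])
  have "{p \<in> {0..} \<times> \<Omega>. Y p \<in> {q<..}} \<in> os_optional_sets \<Omega> G"
    using Y unfolding os_optional_proc_def by (rule bspec) simp
  then have "{p \<in> {0..} \<times> \<Omega>. Y p \<in> {q<..}} \<in> sigma_sets ({0..} \<times> \<Omega>) {after_time \<Omega> R | R. os_stopping_time \<Omega> G R}"
    using U.optional_subset_sigma_stopping unfolding space_M0 by blast
  moreover have "sigma_sets ({0..} \<times> \<Omega>) {after_time \<Omega> R | R. os_stopping_time \<Omega> G R} \<subseteq> traced \<phi> N A"
  proof (rule traced_sigma_sets)
    show "\<phi> (t,\<omega>) \<in> space N" if "0 \<le> t" "\<omega> \<in> \<Omega>" for t \<omega> by (rule \<phi>[OF that])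
    show "{after_time \<Omega> R | R. os_stopping_time \<Omega> G R} \<subseteq> traced \<phi> N A" using st by blast
  qed
  ultimately have "{p \<in> {0..} \<times> \<Omega>. Y p \<in> {q<..}} \<in> traced \<phi> N A" by blast
  then show "{p \<in> {0..} \<times> \<Omega>. q < Y p} \<in> traced \<phi> N A" by (simp only: greaterThan_iff)
qed

section \<open>Comparison of G with F before tau and at time zero\<close>

lemma F_limsup:
  assumes t: "0 \<le> t" and B: "\<And>n::nat. B n \<in> F (t + 1 / Suc n)"
  shows "(\<Inter>m. \<Union>n. B (m + n)) \<in> F t"
proof -
  interpret UF: usual_conditions M0 F by (rule usual_F)
  show ?thesis
  proof (rule UF.H_right[OF t])
    fix s assume s: "t < s"
    then have s0: "0 \<le> s" using t by simp
    obtain k :: nat where k: "1 / Suc k < s - t" using nat_approx_posE[of "s - t"] s by auto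
    have "B n \<in> F s" if "k \<le> n" for n
    proof -
      have "1 / real (Suc n) \<le> 1 / real (Suc k)" using that by (simp add: frac_le)
      then have "t + 1 / Suc n \<le> s" using k by linarith
      moreover have "0 \<le> t + 1 / Suc n" using t by simp
      ultimately show ?thesis using F_mono[of "t + 1 / Suc n" s] B[of n] by blast
    qed
    then show "(\<Inter>m. \<Union>n. B (m + n)) \<in> F s" by (rule limsup_sigma_algebra[OF F_sa[OF s0]])
  qed
qed

text \<open>Where \<open>\<tau> \<and> s\<close> is constant, \<open>G\<^sub>t\<close> has the same trace as \<open>F\<^sub>t\<close>.\<close>

lemma G_trace:
  assumes t: "0 \<le> t" and B: "B \<in> G t"
    and \<Lambda>: "\<And>\<omega>. \<omega> \<in> \<Lambda> \<Longrightarrow> \<exists>u>t. \<forall>s. t < s \<longrightarrow> s < u \<longrightarrow> \<omega> \<in> V s"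
    and V: "\<And>s \<omega>. \<omega> \<in> V s \<Longrightarrow> \<omega> \<in> \<Omega>" "\<And>s \<omega>. t < s \<Longrightarrow> \<omega> \<in> V s \<Longrightarrow> min (\<tau> \<omega>) (ennreal s) = c s"
  shows "\<exists>C\<in>F t. nullset {\<omega>\<in>\<Lambda>. (\<omega> \<in> B) \<noteq> (\<omega> \<in> C)}"
proof -
  obtain B0 where B0: "B0 \<in> Kp t" "nullset ((B - B0) \<union> (B0 - B))"
    using B unfolding G_eq[OF t] modnull_def by blast
  \<comment> \<open>On \<open>V s\<close> the variable tau \<and> s is the constant
    \<open>c s\<close>, so each of its preimages is there either everything or nothing.\<close>
  have tr: "\<exists>C\<in>F s. \<forall>\<omega>\<in>V s. \<omega> \<in> B0 \<longleftrightarrow> \<omega> \<in> C" if s: "t < s" for s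
  proof -
    have s0: "0 \<le> s" using s t by simp
    interpret FS: sigma_algebra \<Omega> "F s" by (rule F_sa[OF s0])
    have "B0 \<in> K s" using B0(1) s unfolding Kp_def by simp
    then show ?thesis
    proof (rule K_induct[OF s0])
      show "\<exists>C\<in>F s. \<forall>\<omega>\<in>V s. \<omega> \<in> A \<longleftrightarrow> \<omega> \<in> C" if "A \<in> F s" for A using that by blast
      show "\<exists>C\<in>F s. \<forall>\<omega>\<in>V s. \<omega> \<in> {\<omega>\<in>\<Omega>. min (\<tau> \<omega>) (ennreal s) \<in> B} \<longleftrightarrow> \<omega> \<in> C" for B :: "ennreal set"
      proof (cases "c s \<in> B")
        case True
        then have "\<forall>\<omega>\<in>V s. \<omega> \<in> {\<omega>\<in>\<Omega>. min (\<tau> \<omega>) (ennreal s) \<in> B} \<longleftrightarrow> \<omega> \<in> \<Omega>" using V s by auto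
        then show ?thesis using FS.top by blast
      next
        case False
        then have "\<forall>\<omega>\<in>V s. \<omega> \<in> {\<omega>\<in>\<Omega>. min (\<tau> \<omega>) (ennreal s) \<in> B} \<longleftrightarrow> \<omega> \<in> {}" using V s by auto
        then show ?thesis using FS.empty_sets by blast
      qed
      show "\<exists>C\<in>F s. \<forall>\<omega>\<in>V s. \<omega> \<in> \<Omega> - A \<longleftrightarrow> \<omega> \<in> C" if A: "\<exists>C\<in>F s. \<forall>\<omega>\<in>V s. \<omega> \<in> A \<longleftrightarrow> \<omega> \<in> C" for A
      proof -
        obtain C where "C \<in> F s" "\<forall>\<omega>\<in>V s. \<omega> \<in> A \<longleftrightarrow> \<omega> \<in> C" using A by blast
        then have "\<Omega> - C \<in> F s" "\<forall>\<omega>\<in>V s. \<omega> \<in> \<Omega> - A \<longleftrightarrow> \<omega> \<in> \<Omega> - C" by auto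
        then show ?thesis by blast
      qed
      show "\<exists>C\<in>F s. \<forall>\<omega>\<in>V s. \<omega> \<in> (\<Union>i. A i) \<longleftrightarrow> \<omega> \<in> C"
        if A: "\<And>i. \<exists>C\<in>F s. \<forall>\<omega>\<in>V s. \<omega> \<in> A i \<longleftrightarrow> \<omega> \<in> C" for A :: "nat \<Rightarrow> 'a set"
      proof -
        have "\<forall>i. \<exists>C. C \<in> F s \<and> (\<forall>\<omega>\<in>V s. \<omega> \<in> A i \<longleftrightarrow> \<omega> \<in> C)" using A by blast
        then obtain C where C: "\<And>i. C i \<in> F s" "\<And>i. \<forall>\<omega>\<in>V s. \<omega> \<in> A i \<longleftrightarrow> \<omega> \<in> C i" by metis
        have "(\<Union>i. C i) \<in> F s" using C(1) by auto
        moreover have "\<forall>\<omega>\<in>V s. \<omega> \<in> (\<Union>i. A i) \<longleftrightarrow> \<omega> \<in> (\<Union>i. C i)" using C(2) by blast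
        ultimately show ?thesis by blast
      qed
    qed
  qed
  have u: "t < t + 1 / Suc n" for n :: nat by simp
  have "\<forall>n::nat. \<exists>C. C \<in> F (t + 1 / Suc n) \<and> (\<forall>\<omega>\<in>V (t + 1 / Suc n). \<omega> \<in> B0 \<longleftrightarrow> \<omega> \<in> C)"
    using tr[OF u] by blast
  then obtain C where C: "\<And>n. C n \<in> F (t + 1 / Suc n)" "\<And>n. \<forall>\<omega>\<in>V (t + 1 / Suc n). \<omega> \<in> B0 \<longleftrightarrow> \<omega> \<in> C n"
    by metis
  \<comment> \<open>The F-set found for B0 depends on s = t + 1/n. A point of
    \<open>\<Lambda>\<close> lies in \<open>V s\<close> for all s close to t, so its membership in
    \<open>C n\<close> is eventually correct, and the limsup reads this off.\<close>
  define L where "L = (\<Inter>m. \<Union>n. C (m + n))"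
  have L: "L \<in> F t" unfolding L_def by (rule F_limsup[OF t C(1)])
  have "\<omega> \<in> B0 \<longleftrightarrow> \<omega> \<in> L" if w: "\<omega> \<in> \<Lambda>" for \<omega>
  proof -
    obtain u where u: "u > t" "\<forall>s. t < s \<longrightarrow> s < u \<longrightarrow> \<omega> \<in> V s" using \<Lambda>[OF w] by blast
    obtain k :: nat where k: "1 / Suc k < u - t" using nat_approx_posE[of "u - t"] u by auto
    have eq: "\<omega> \<in> B0 \<longleftrightarrow> \<omega> \<in> C n" if "k \<le> n" for n
    proof -
      have "1 / real (Suc n) \<le> 1 / real (Suc k)" using that by (simp add: frac_le)
      then have "t + 1 / Suc n < u" using k by linarith
      then have "\<omega> \<in> V (t + 1 / Suc n)" using u(2) by simp
      then show ?thesis using C(2) by blast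
    qed
    show ?thesis
    proof
      assume "\<omega> \<in> B0"
      then have "\<omega> \<in> C (m + k)" for m using eq[of "m + k"] by simp
      then show "\<omega> \<in> L" unfolding L_def by blast
    next
      assume "\<omega> \<in> L"
      then obtain n where "\<omega> \<in> C (k + n)" unfolding L_def by blast
      then show "\<omega> \<in> B0" using eq[of "k + n"] by simp
    qed
  qed
  then have "nullset {\<omega>\<in>\<Lambda>. (\<omega> \<in> B) \<noteq> (\<omega> \<in> L)}" by (intro nullset_subset[OF B0(2)]) blast
  then show ?thesis using L by blast
qed

text \<open>If t < tau, then tau \<and> s equals s for all s > t close enough to t.\<close>

lemma G_trace_before:
  assumes t: "0 \<le> t" and B: "B \<in> G t"
  shows "\<exists>C\<in>F t. nullset {\<omega>\<in>\<Omega>. ennreal t < \<tau> \<omega> \<and> (\<omega> \<in> B) \<noteq> (\<omega> \<in> C)}"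
proof -
  have "\<exists>C\<in>F t. nullset {\<omega>\<in>{\<omega>\<in>\<Omega>. ennreal t < \<tau> \<omega>}. (\<omega> \<in> B) \<noteq> (\<omega> \<in> C)}"
  proof (rule G_trace[OF t B, where V="\<lambda>s. {\<omega>\<in>\<Omega>. ennreal s \<le> \<tau> \<omega>}" and c=ennreal])
    fix \<omega> assume w: "\<omega> \<in> {\<omega>\<in>\<Omega>. ennreal t < \<tau> \<omega>}"
    obtain u where u: "u \<in> nnrat" "t < u" "ennreal u < \<tau> \<omega>" using ennreal_rat_between[OF t, of "\<tau> \<omega>"] w by blast
    have "ennreal s \<le> \<tau> \<omega>" if "s < u" for s
      by (rule order_trans[OF _ less_imp_le[OF u(3)]]) (use that in \<open>simp add: ennreal_leI\<close>)
    then show "\<exists>u>t. \<forall>s. t < s \<longrightarrow> s < u \<longrightarrow> \<omega> \<in> {\<omega>\<in>\<Omega>. ennreal s \<le> \<tau> \<omega>}" using u w by blast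
  qed (auto simp: min_def)
  then show ?thesis by simp
qed

lemma G_trace_zero:
  assumes B: "B \<in> G 0"
  shows "\<exists>C\<in>F 0. nullset {\<omega>\<in>\<Omega>. \<tau> \<omega> = 0 \<and> (\<omega> \<in> B) \<noteq> (\<omega> \<in> C)}"
proof -
  have "\<exists>C\<in>F 0. nullset {\<omega>\<in>{\<omega>\<in>\<Omega>. \<tau> \<omega> = 0}. (\<omega> \<in> B) \<noteq> (\<omega> \<in> C)}"
  proof (rule G_trace[OF order_refl B, where V="\<lambda>s. {\<omega>\<in>\<Omega>. \<tau> \<omega> = 0}" and c="\<lambda>_. 0"])
    fix \<omega> assume "\<omega> \<in> {\<omega>\<in>\<Omega>. \<tau> \<omega> = 0}"
    then show "\<exists>u>0::real. \<forall>s. 0 < s \<longrightarrow> s < u \<longrightarrow> \<omega> \<in> {\<omega>\<in>\<Omega>. \<tau> \<omega> = 0}" by (intro exI[of _ 1]) simp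
  qed (auto simp: min_def)
  then show ?thesis by simp
qed

text \<open>\<open>threshold_iff_vanishing\<close> with horizon tau, applied to F-martingales. The
  event R \<le> r need not lie in \<open>F r\<close>, but its trace before tau comes from some C in
  \<open>F r\<close>. This C meets \<open>E q\<close> in a null set for r \<le> q, so the
  F-martingale of \<open>E q\<close> vanishes on C at time r.\<close>

lemma after_time_before:
  assumes R: "os_stopping_time \<Omega> G R"
  shows "after_time \<Omega> R \<in> traced (\<lambda>p. p) (OM F) {(t,\<omega>). ennreal t < \<tau> \<omega>}"
proof -
  interpret UF: usual_conditions M0 F by (rule usual_F)
  define E where "E q = {\<omega>\<in>\<Omega>. ennreal q < R \<omega> \<and> ennreal q < \<tau> \<omega>}" for q :: real
  have E: "E q \<in> sets M0" if "q \<in> nnrat" for q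
  proof -
    have q: "0 \<le> q" using that by simp
    interpret sigma_algebra \<Omega> "G q" by (rule G_sa[OF q])
    have "{\<omega>\<in>\<Omega>. R \<omega> \<le> ennreal q} \<in> G q" using R q unfolding os_stopping_time_def by blast
    moreover have "{\<omega>\<in>\<Omega>. \<tau> \<omega> \<le> ennreal q} \<in> G q" using \<tau>_le_G[OF q, of UNIV] by simp
    ultimately have "\<Omega> - ({\<omega>\<in>\<Omega>. R \<omega> \<le> ennreal q} \<union> {\<omega>\<in>\<Omega>. \<tau> \<omega> \<le> ennreal q}) \<in> G q" by blast
    moreover have "\<Omega> - ({\<omega>\<in>\<Omega>. R \<omega> \<le> ennreal q} \<union> {\<omega>\<in>\<Omega>. \<tau> \<omega> \<le> ennreal q}) = E q"
      unfolding E_def by auto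
    ultimately show ?thesis unfolding sets_M0 using G_Ginf[OF q] by auto
  qed
  have "\<forall>q. \<exists>X. q \<in> nnrat \<longrightarrow> UF.cver (E q) X" using UF.ex_cver E by blast
  then obtain X where X: "\<And>q. q \<in> nnrat \<Longrightarrow> UF.cver (E q) (X q)" by metis
  define W where "W = {p \<in> space (OM F). \<forall>q\<in>nnrat. fst p \<le> q \<longrightarrow> X q (fst p) (snd p) \<le> 0}"
  have "W \<in> sets (OM F)"
  proof -
    have [measurable]: "fst \<in> borel_measurable (OM F)" by (rule time_measurable_OM[OF F_sa])
    have "W = space (OM F) \<inter> (\<Inter>q\<in>nnrat. {p \<in> space (OM F). fst p \<le> q \<longrightarrow> X q (fst p) (snd p) \<le> 0})" unfolding W_def by auto
    also have "\<dots> \<in> sets (OM F)"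
    proof (intro sets.Int sets.top sets.countable_INT' image_subsetI)
      show "countable nnrat" by (rule countable_nnrat)
      show "nnrat \<noteq> {}" using infinite_nnrat by auto
      fix q assume q: "q \<in> nnrat"
      have [measurable]: "(\<lambda>p. X q (fst p) (snd p)) \<in> borel_measurable (OM F)"
        by (rule cadlag_adapted_OM) (use X[OF q] in \<open>simp_all add: UF.cver_def space_M0\<close>)
      show "{p \<in> space (OM F). fst p \<le> q \<longrightarrow> X q (fst p) (snd p) \<le> 0} \<in> sets (OM F)" by measurable
    qed
    finally show ?thesis .
  qed
  then show ?thesis
  proof (rule tracedI)
    have "AE \<omega> in M0. \<omega> \<in> E q \<longrightarrow> (\<forall>t\<ge>0. 0 < X q t \<omega>)" if "q \<in> nnrat" for q
      by (rule UF.cver_AE_pos[OF X[OF that] E[OF that]])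
    then have pos: "AE \<omega> in M0. \<forall>q\<in>nnrat. \<omega> \<in> E q \<longrightarrow> (\<forall>t\<ge>0. 0 < X q t \<omega>)"
      by (intro AE_ball_countable' countable_nnrat)
    have zero1: "AE \<omega> in M0. r \<le> q \<longrightarrow> R \<omega> \<le> ennreal r \<longrightarrow> ennreal r < \<tau> \<omega> \<longrightarrow> X q r \<omega> = 0"
      if q: "q \<in> nnrat" and r: "r \<in> nnrat" for q r
    proof (cases "r \<le> q")
      case True
      have r0: "0 \<le> r" using r by simp
      have "{\<omega>\<in>\<Omega>. R \<omega> \<le> ennreal r} \<in> G r" using R r0 unfolding os_stopping_time_def by blast
      then obtain C where C: "C \<in> F r" "nullset {\<omega>\<in>\<Omega>. ennreal r < \<tau> \<omega> \<and> (\<omega> \<in> {\<omega>\<in>\<Omega>. R \<omega> \<le> ennreal r}) \<noteq> (\<omega> \<in> C)}" (is "nullset ?Z")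
        using G_trace_before[OF r0] by blast
      have rq: "ennreal r \<le> ennreal q" using True by (rule ennreal_leI)
      \<comment> \<open>On \<open>E q\<close> both R and tau exceed q \<ge> r, so a point of C there
        contradicts the trace property and lies in its exceptional set.\<close>
      have "E q \<inter> C \<subseteq> ?Z"
      proof
        fix \<omega> assume "\<omega> \<in> E q \<inter> C"
        then have w: "\<omega> \<in> \<Omega>" "ennreal q < R \<omega>" "ennreal q < \<tau> \<omega>" "\<omega> \<in> C" unfolding E_def by auto
        have "ennreal r < \<tau> \<omega>" "ennreal r < R \<omega>" using rq w(2,3) le_less_trans by blast+
        then show "\<omega> \<in> ?Z" using w by auto
      qed
      then have "nullset (E q \<inter> C)" by (rule nullset_subset[OF C(2)])
      then have nn: "emeasure M (E q \<inter> C) = 0" "E q \<inter> C \<in> Ginf"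
        using nullset_null_sets nullset_N N_G[of 0] G_Ginf[of 0] by auto
      then have "measure M0 (E q \<inter> C) = 0" unfolding measure_def using emeasure_M0 by simp
      from UF.cver_AE_disjoint[OF X[OF q] r0 C(1) this E[OF q]]
      have "AE \<omega> in M0. \<omega> \<in> C \<longrightarrow> X q r \<omega> = 0" .
      moreover have "AE \<omega> in M0. \<omega> \<notin> ?Z" by (rule AE_M0_nullset[OF C(2)]) blast
      ultimately show ?thesis using AE_space
      proof eventually_elim
        case (elim \<omega>)
        then show ?case unfolding space_M0 by auto
      qed
    qed simp
    have zero: "AE \<omega> in M0. \<forall>q\<in>nnrat. \<forall>r\<in>nnrat. r \<le> q \<longrightarrow> R \<omega> \<le> ennreal r \<longrightarrow> ennreal r < \<tau> \<omega> \<longrightarrow> X q r \<omega> = 0"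
      by (intro AE_ball_countable' countable_nnrat zero1)
    show "AE \<omega> in M0. \<forall>t\<ge>0. (t,\<omega>) \<in> {(t,\<omega>). ennreal t < \<tau> \<omega>} \<longrightarrow> ((t,\<omega>) \<in> after_time \<Omega> R \<longleftrightarrow> (t,\<omega>) \<in> W)"
      using pos zero AE_space
    proof eventually_elim
      case (elim \<omega>)
      have w: "\<omega> \<in> \<Omega>" using elim(3) unfolding space_M0 .
      show ?case
      proof (intro allI impI)
        fix t :: real assume t: "0 \<le> t" and "(t,\<omega>) \<in> {(t,\<omega>). ennreal t < \<tau> \<omega>}"
        then have tt: "ennreal t < \<tau> \<omega>" by simp
        have "R \<omega> \<le> ennreal t \<longleftrightarrow> (\<forall>q\<in>nnrat. t \<le> q \<longrightarrow> X q t \<omega> \<le> 0)"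
        proof (rule threshold_iff_vanishing[OF t tt, where X="\<lambda>q s. X q s \<omega>"])
          fix q assume q: "q \<in> nnrat"
          show "((\<lambda>s. X q s \<omega>) \<longlongrightarrow> X q t \<omega>) (at_right t)"
            by (rule UF.cver_right[OF X[OF q] t]) (simp add: space_M0 w)
          assume "ennreal q < R \<omega>" "ennreal q < \<tau> \<omega>"
          then have "\<omega> \<in> E q" using w unfolding E_def by simp
          then show "0 < X q t \<omega>" using elim(1) q t by blast
        qed (use elim(2) in blast)
        then show "(t,\<omega>) \<in> after_time \<Omega> R \<longleftrightarrow> (t,\<omega>) \<in> W"
          unfolding mem_after_time W_def space_OM using t w by simp
      qed
    qed
  qed
qed

text \<open>At t = tau = 0 the formula is in its second branch, yet the point is outside
  \<open>os_from_pos\<close>, so the covering assumption gives nothing there. The trace of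
  \<open>G 0\<close> on tau = 0 takes its place.\<close>

lemma after_time_at_zero:
  assumes R: "os_stopping_time \<Omega> G R"
  shows "after_time \<Omega> R \<in> traced (\<lambda>p. p) (OM F) {(t,\<omega>). t = 0 \<and> \<tau> \<omega> = 0}"
proof -
  interpret UF: usual_conditions M0 F by (rule usual_F)
  have "{\<omega>\<in>\<Omega>. R \<omega> \<le> ennreal 0} \<in> G 0" using R unfolding os_stopping_time_def by blast
  then obtain C where C: "C \<in> F 0" "nullset {\<omega>\<in>\<Omega>. \<tau> \<omega> = 0 \<and> (\<omega> \<in> {\<omega>\<in>\<Omega>. R \<omega> \<le> ennreal 0}) \<noteq> (\<omega> \<in> C)}" (is "nullset ?Z")
    using G_trace_zero by blast
  have "{0..} \<times> C \<in> sets (OM F)" using UF.rect_optional[OF order_refl C(1)] unfolding space_M0 sets_OM .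
  then show ?thesis
  proof (rule tracedI)
    have "AE \<omega> in M0. \<omega> \<notin> ?Z" by (rule AE_M0_nullset[OF C(2)]) blast
    then show "AE \<omega> in M0. \<forall>t\<ge>0. (t,\<omega>) \<in> {(t,\<omega>). t = 0 \<and> \<tau> \<omega> = 0} \<longrightarrow> ((t,\<omega>) \<in> after_time \<Omega> R \<longleftrightarrow> (t,\<omega>) \<in> {0..} \<times> C)"
      using AE_space
    proof eventually_elim
      case (elim \<omega>)
      then show ?case unfolding space_M0 by (auto simp: mem_after_time)
    qed
  qed
qed

end

section \<open>Splitting after \<open>\<tau>\<close> on \<open>(S, T)\<close>\<close>

context usual_conditions begin

text \<open>A disjoint union is the complement of a difference of a complement, so
  \<open>cver_diff\<close> applied three times suffices.\<close>

lemma cver_Un: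
  assumes X: "cver E X" and Y: "cver D Y" and s: "E \<in> sets P" "D \<in> sets P" "E \<inter> D = {}"
  shows "cver (E \<union> D) (\<lambda>t \<omega>. X t \<omega> + Y t \<omega>)"
proof -
  have Es: "E \<subseteq> space P" and Ds: "D \<subseteq> space P" using s sets.sets_into_space by blast+
  have 1: "cver (space P - E) (\<lambda>t \<omega>. 1 - X t \<omega>)"
    by (rule cver_diff[OF cver_space X sets.top s(1) Es])
  have 2: "cver ((space P - E) - D) (\<lambda>t \<omega>. (1 - X t \<omega>) - Y t \<omega>)"
    by (rule cver_diff[OF 1 Y sets.compl_sets[OF s(1)] s(2)]) (use Ds s(3) in blast)
  have 3: "cver (space P - ((space P - E) - D)) (\<lambda>t \<omega>. 1 - ((1 - X t \<omega>) - Y t \<omega>))"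
    by (rule cver_diff[OF cver_space 2 sets.top]) (use s in auto)
  have "space P - ((space P - E) - D) = E \<union> D" using Es Ds by blast
  moreover have "(\<lambda>t \<omega>. 1 - ((1 - X t \<omega>) - Y t \<omega>)) = (\<lambda>t \<omega>. X t \<omega> + Y t \<omega>)" by (intro ext) simp
  ultimately show ?thesis using 3 by (simp only:)
qed

lemma cver_empty: "cver {} (\<lambda>t \<omega>. 0)"
  using cver_diff[OF cver_space cver_space sets.top sets.top subset_refl] by simp

lemma cver_sum:
  fixes A :: "nat \<Rightarrow> 'a set"
  assumes X: "\<And>i. cver (A i) (X i)" and s: "\<And>i. A i \<in> sets P" and d: "disjoint_family A"
  shows "cver (\<Union>i<n. A i) (\<lambda>t \<omega>. \<Sum>i<n. X i t \<omega>)"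
proof (induction n)
  case 0
  show ?case unfolding lessThan_0 UN_empty sum.empty by (rule cver_empty)
next
  case (Suc n)
  have "A i \<inter> A n = {}" if "i < n" for i
    by (rule disjoint_family_onD[OF d]) (use that in auto)
  then have dis: "(\<Union>i<n. A i) \<inter> A n = {}" by blast
  have us: "(\<Union>i<n. A i) \<in> sets P" by (rule sets.finite_UN) (use s in blast)+
  have "cver ((\<Union>i<n. A i) \<union> A n) (\<lambda>t \<omega>. (\<Sum>i<n. X i t \<omega>) + X n t \<omega>)"
    by (rule cver_Un[OF Suc X[of n] us s dis])
  moreover have "(\<Union>i<Suc n. A i) = (\<Union>i<n. A i) \<union> A n" by (auto simp: less_Suc_eq)
  ultimately show ?case by (simp only: sum.lessThan_Suc)
qed

lemma right_limit_le:
  fixes f :: "real \<Rightarrow> real"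
  assumes f: "(f \<longlongrightarrow> f t) (at_right t)" and t: "0 \<le> t" and le: "\<And>q. q \<in> nnrat \<Longrightarrow> f q \<le> c"
  shows "f t \<le> c"
proof -
  obtain r where r: "\<And>n. r n \<in> nnrat" "\<And>n. t < r n" "\<And>n. r n < t + 1" "r \<longlonglongrightarrow> t"
    using rat_seq_right[OF t, of "t+1"] by (metis less_add_one)
  have "filterlim r (at_right t) sequentially"
    using r by (auto simp: filterlim_at intro!: always_eventually)
  then have "(\<lambda>n. f (r n)) \<longlonglongrightarrow> f t" by (rule filterlim_compose[OF f])
  then show ?thesis by (rule LIMSEQ_le_const2) (use le r(1) in blast)
qed

text \<open>The maximal inequality makes the partial sums converge uniformly along paths.\<close>

lemma cver_sum_converges:
  fixes A :: "nat \<Rightarrow> 'a set"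
  assumes X: "\<And>i. cver (A i) (X i)" and s: "\<And>i. A i \<in> sets P" and d: "disjoint_family A"
    and Z: "cver (\<Union>i. A i) Z"
  shows "AE \<omega> in P. \<forall>t\<ge>0. (\<lambda>n. \<Sum>i<n. X i t \<omega>) \<longlonglongrightarrow> Z t \<omega>"
proof -
  \<comment> \<open>Y n is the martingale of the tail event \<open>E n\<close>, whose probability
    tends to 0; the maximal inequality bounds its supremum over rational times.\<close>
  define Y where "Y n t \<omega> = Z t \<omega> - (\<Sum>i<n. X i t \<omega>)" for n t \<omega>
  define E where "E n = (\<Union>i. A i) - (\<Union>i<n. A i)" for n
  have Us: "(\<Union>i. A i) \<in> sets P" using s by auto
  have us: "(\<Union>i<n. A i) \<in> sets P" for n using s by auto
  have Es: "E n \<in> sets P" for n unfolding E_def using s by auto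
  have Y: "cver (E n) (Y n)" for n
    unfolding E_def Y_def by (rule cver_diff[OF Z cver_sum[OF X s d] Us us]) blast
  have "(\<lambda>n. measure P (E n)) \<longlonglongrightarrow> measure P (\<Inter>n. E n)"
    by (rule finite_Lim_measure_decseq) (use Es in \<open>auto simp: E_def decseq_def\<close>)
  moreover have "(\<Inter>n. E n) = {}" unfolding E_def by auto
  ultimately have lim: "(\<lambda>n. measure P (E n)) \<longlonglongrightarrow> 0" by simp
  define B where "B d n = {\<omega>\<in>space P. \<exists>q\<in>nnrat. d < Y n q \<omega>}" for d n
  have Bs: "B d n \<in> sets P" for d n unfolding B_def by (rule cver_maximal(1)[OF Y Es])
  have "(\<Inter>n. B d n) \<in> null_sets P" if d: "0 < d" for d
  proof (rule null_setsI)
    show Is: "(\<Inter>n. B d n) \<in> sets P" using Bs by auto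
    have "d * measure P (\<Inter>n. B d n) \<le> measure P (E n)" for n
    proof -
      have "measure P (\<Inter>n. B d n) \<le> measure P (B d n)" by (rule finite_measure_mono[OF _ Bs]) auto
      then have "d * measure P (\<Inter>n. B d n) \<le> d * measure P (B d n)" using d by simp
      also have "\<dots> \<le> measure P (E n)" unfolding B_def by (rule cver_maximal(2)[OF Y Es])
      finally show ?thesis .
    qed
    then have "d * measure P (\<Inter>n. B d n) \<le> 0" by (intro LIMSEQ_le_const[OF lim]) auto
    then have "measure P (\<Inter>n. B d n) \<le> 0" using d by (simp add: mult_le_0_iff)
    then show "emeasure P (\<Inter>n. B d n) = 0" by (simp add: emeasure_eq_measure measure_le_0_iff)
  qed
  then have "AE \<omega> in P. \<omega> \<notin> (\<Inter>n. B d n)" if "0 < d" for d using that AE_not_in by blast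
  then have ae1: "AE \<omega> in P. \<forall>k::nat. \<omega> \<notin> (\<Inter>n. B (1 / Suc k) n)" unfolding AE_all_countable by simp
  have ae2: "AE \<omega> in P. \<forall>i. \<forall>q\<in>nnrat. 0 \<le> X i q \<omega>" unfolding AE_all_countable using cver_AE_nonneg[OF X s] by blast
  have ae3: "AE \<omega> in P. \<forall>n. \<forall>q\<in>nnrat. 0 \<le> Y n q \<omega>" unfolding AE_all_countable using cver_AE_nonneg[OF Y Es] by blast
  show ?thesis using ae1 ae2 ae3 AE_space
  proof eventually_elim
    case (elim \<omega>)
    have w: "\<omega> \<in> space P" by fact
    show ?case
    proof (intro allI impI)
      fix t :: real assume t: "0 \<le> t"
      show "(\<lambda>n. \<Sum>i<n. X i t \<omega>) \<longlonglongrightarrow> Z t \<omega>"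
      proof (rule LIMSEQ_I)
        fix e :: real assume "0 < e"
        then obtain k :: nat where k: "1 / Suc k < e" using nat_approx_posE by blast
        \<comment> \<open>The exclusion from the intersection gives one index N only. Since the
          summands are nonnegative at rational times, Y decreases in n there, and the bound extends
          to all n \<ge> N.\<close>
        obtain N where N: "\<forall>q\<in>nnrat. Y N q \<omega> \<le> 1 / Suc k"
          using elim(1)[rule_format, of k] w unfolding B_def by (auto simp: not_less)
        have "norm ((\<Sum>i<n. X i t \<omega>) - Z t \<omega>) < e" if n: "N \<le> n" for n
        proof -
          have "Y n q \<omega> \<le> 1 / Suc k" if q: "q \<in> nnrat" for q
          proof -
            have "(\<Sum>i<N. X i q \<omega>) \<le> (\<Sum>i<n. X i q \<omega>)"
              by (rule sum_mono2) (use n elim(2) q in auto)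
            then have "Y n q \<omega> \<le> Y N q \<omega>" unfolding Y_def by simp
            then show ?thesis using N q by force
          qed
          then have up: "Y n t \<omega> \<le> 1 / Suc k"
            by (intro right_limit_le[where f="\<lambda>s. Y n s \<omega>", OF cver_right[OF Y t w] t])
          have "((\<lambda>s. - Y n s \<omega>) \<longlongrightarrow> - Y n t \<omega>) (at_right t)"
            by (intro tendsto_minus cver_right[OF Y t w])
          then have "- Y n t \<omega> \<le> 0"
            by (rule right_limit_le[where f="\<lambda>s. - Y n s \<omega>", OF _ t]) (use elim(3) in simp)
          then show ?thesis using up k unfolding Y_def by simp
        qed
        then show "\<exists>no. \<forall>n\<ge>no. norm ((\<Sum>i<n. X i t \<omega>) - Z t \<omega>) < e" by blast
      qed
    qed
  qed
qed

text \<open>The stopped processes share the bound c, so dominated convergence along the localizing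
  sequence removes the localization.\<close>

lemma bounded_local_martingale:
  fixes Z :: "real \<Rightarrow> 'a \<Rightarrow> real"
  assumes lm: "os_local_martingale P H Z" and b: "\<And>t \<omega>. 0 \<le> t \<Longrightarrow> \<omega> \<in> space P \<Longrightarrow> \<bar>Z t \<omega>\<bar> \<le> c"
    and st: "0 \<le> s" "s \<le> t" and A: "A \<in> H s"
  shows "(\<integral>\<omega>. indicator A \<omega> * Z t \<omega> \<partial>P) = (\<integral>\<omega>. indicator A \<omega> * Z s \<omega> \<partial>P)"
proof -
  obtain Tn :: "nat \<Rightarrow> 'a \<Rightarrow> ennreal" where
    Tn: "AE \<omega> in P. ((\<lambda>n. Tn n \<omega>) \<longlongrightarrow> \<infinity>) sequentially" "\<And>n. os_martingale P H (os_stopped Z (Tn n))"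
    using lm unfolding os_local_martingale_def by blast
  have As [measurable]: "A \<in> sets P" by (rule H_sets[OF st(1) A])
  have lim: "(\<lambda>n. \<integral>\<omega>. indicator A \<omega> * os_stopped Z (Tn n) u \<omega> \<partial>P) \<longlonglongrightarrow> (\<integral>\<omega>. indicator A \<omega> * Z u \<omega> \<partial>P)"
    if u: "0 \<le> u" for u
  proof (rule integral_dominated_convergence[where w="\<lambda>_. c"])
    have "os_adapted (space P) H Z" using lm unfolding os_local_martingale_def by blast
    then have "Z u \<in> borel_measurable (HM u)" using u unfolding adapted_iff by blast
    then have [measurable]: "Z u \<in> borel_measurable P" by (rule measurable_HM_P[OF u])
    show "(\<lambda>\<omega>. indicator A \<omega> * Z u \<omega>) \<in> borel_measurable P" by measurable
    fix n
    have "os_adapted (space P) H (os_stopped Z (Tn n))" using Tn(2) unfolding os_martingale_def by blast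
    then have "os_stopped Z (Tn n) u \<in> borel_measurable (HM u)" using u unfolding adapted_iff by blast
    then have [measurable]: "os_stopped Z (Tn n) u \<in> borel_measurable P" by (rule measurable_HM_P[OF u])
    show "(\<lambda>\<omega>. indicator A \<omega> * os_stopped Z (Tn n) u \<omega>) \<in> borel_measurable P" by measurable
    have "\<bar>indicator A \<omega> * os_stopped Z (Tn n) u \<omega>\<bar> \<le> c" if w: "\<omega> \<in> space P" for \<omega>
    proof -
      have "\<bar>os_stopped Z (Tn n) u \<omega>\<bar> \<le> c" unfolding os_stopped_def by (rule b[OF _ w]) (use u in simp)
      then show ?thesis by (cases "\<omega> \<in> A") auto
    qed
    then show "AE \<omega> in P. norm (indicator A \<omega> * os_stopped Z (Tn n) u \<omega>) \<le> c" by (intro AE_I2) simp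
  next
    show "AE \<omega> in P. (\<lambda>n. indicator A \<omega> * os_stopped Z (Tn n) u \<omega>) \<longlonglongrightarrow> indicator A \<omega> * Z u \<omega>"
      using Tn(1)
    proof eventually_elim
      case (elim \<omega>)
      have "\<forall>\<^sub>F n in sequentially. ennreal u < Tn n \<omega>" by (rule order_tendstoD(1)[OF elim]) simp
      then have "\<forall>\<^sub>F n in sequentially. indicator A \<omega> * os_stopped Z (Tn n) u \<omega> = indicator A \<omega> * Z u \<omega>"
        by eventually_elim (simp add: os_stopped_def less_imp_le)
      then show ?case by (rule tendsto_eventually)
    qed
  qed simp
  have t: "0 \<le> t" using st by simp
  have "(LINT \<omega>:A|P. os_stopped Z (Tn n) t \<omega>) = (LINT \<omega>:A|P. os_stopped Z (Tn n) s \<omega>)" for n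
    using Tn(2)[of n] st A unfolding os_martingale_def by blast
  then have "(\<integral>\<omega>. indicator A \<omega> * os_stopped Z (Tn n) t \<omega> \<partial>P) = (\<integral>\<omega>. indicator A \<omega> * os_stopped Z (Tn n) s \<omega> \<partial>P)" for n
    unfolding set_lebesgue_integral_def real_scaleR_def .
  then show ?thesis using LIMSEQ_unique[OF lim[OF t]] lim[OF st(1)] by simp
qed

end

context enlargement begin

text \<open>The sH-property quantifies over local martingales under M, whereas X is built over
  \<open>M0\<close>. The integrals agree because the integrands are \<open>Ginf\<close>-measurable;
  the localizing times are infinite.\<close>

lemma cver_local_martingale:
  assumes X: "usual_conditions.cver M0 F E X"
  shows "os_local_martingale M F X"
proof -
  interpret UF: usual_conditions M0 F by (rule usual_F)
  have ad: "os_adapted \<Omega> F X" and cl: "os_cadlag \<Omega> X" using X unfolding UF.cver_def space_M0 by blast+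
  have stop: "os_stopped X (\<lambda>_. \<infinity>) = X" by (intro ext) (simp add: os_stopped_def)
  have int: "(LINT \<omega>:A|M. X t \<omega>) = measure M0 (E \<inter> A)" if t: "0 \<le> t" and A: "A \<in> F t" for t A
  proof -
    have [measurable]: "A \<in> sets M0" "X t \<in> borel_measurable M0" by (rule UF.H_sets[OF t A], rule UF.cver_P[OF X t])
    have "(\<lambda>\<omega>. indicator A \<omega> * X t \<omega>) \<in> borel_measurable M0" by measurable
    then have "(\<lambda>\<omega>. indicator A \<omega> * X t \<omega>) \<in> borel_measurable (sigma \<Omega> Ginf)"
      unfolding M0_def by (rule measurable_in_subalg'[OF subalgebra_Ginf])
    from integral_subalgebra2[OF subalgebra_Ginf this]
    have "(\<integral>\<omega>. indicator A \<omega> * X t \<omega> \<partial>M) = (\<integral>\<omega>. indicator A \<omega> * X t \<omega> \<partial>M0)" unfolding M0_def by simp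
    then show ?thesis unfolding set_lebesgue_integral_def real_scaleR_def UF.cver_int[OF X t A] .
  qed
  have mart: "os_martingale M F X"
    unfolding os_martingale_def
  proof (intro conjI allI impI ad)
    fix t :: real assume t: "0 \<le> t"
    show "integrable M (X t)"
      by (rule integrable_from_subalg[OF subalgebra_Ginf]) (use UF.cver_integrable[OF X t] in \<open>simp add: M0_def\<close>)
  next
    fix s t :: real and A assume h: "0 \<le> s" "s \<le> t" "A \<in> F s"
    have t: "0 \<le> t" using h by simp
    have "A \<in> F t" using F_mono[OF h(1,2)] h(3) by blast
    then show "(LINT \<omega>:A|M. X t \<omega>) = (LINT \<omega>:A|M. X s \<omega>)" using int[OF t] int[OF h(1,3)] by simp
  qed
  show ?thesis
    unfolding os_local_martingale_def
  proof (intro conjI ad cl exI[of _ "\<lambda>_ _. \<infinity>"] allI ballI)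
    show "os_stopping_time \<Omega> F (\<lambda>_. \<infinity>)" unfolding os_stopping_time_def
    proof (intro allI impI)
      fix t :: real assume "0 \<le> t"
      then have "{} \<in> F t" using F_sa[of t] unfolding sigma_algebra_iff2 by simp
      then show "{\<omega> \<in> \<Omega>. \<infinity> \<le> ennreal t} \<in> F t" by (simp add: top_unique)
    qed
    show "os_martingale M F (os_stopped X (\<lambda>_. \<infinity>))" unfolding stop by (rule mart)
  qed auto
qed

end

section \<open>Consequences of one sH-measure\<close>

locale enlargement_sH = enlargement M F \<tau> for M :: "'a measure" and F \<tau> +
  fixes S T :: "'a \<Rightarrow> ennreal" and Q :: "'a measure"
  assumes S: "os_stopping_time (space M) (os_G M F \<tau>) S"
    and T: "os_stopping_time (space M) F T"
    and sH: "os_sH_measure M F \<tau> S T Q"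
begin

lemma equiv_Q: "equiv_measure Q"
  using sH unfolding os_sH_measure_def equiv_measure_def by blast

lemma space_Q: "space Q = \<Omega>" and sets_Q: "sets Q = Ginf"
  using equiv_Q unfolding equiv_measure_def by blast+

sublocale UF: usual_conditions M0 F by (rule usual_F)
sublocale UQ: usual_conditions Q G by (rule usual_G[OF equiv_Q])

text \<open>The instants from which X^(S,T] moves with X stopped at T (\<open>os_incr_act\<close>).
  Once true, the condition persists until T, so identities can be approached from the right within
  it.\<close>

abbreviation act :: "real \<Rightarrow> 'a \<Rightarrow> bool" where
  "act t \<omega> \<equiv> \<tau> \<omega> \<le> ennreal t \<and> S \<omega> \<le> ennreal t \<and> ennreal t < T \<omega>"

lemma T_F: "0 \<le> t \<Longrightarrow> {\<omega>\<in>\<Omega>. T \<omega> \<le> ennreal t} \<in> F t"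
  using T unfolding os_stopping_time_def by blast

lemma T_F_less: "0 \<le> t \<Longrightarrow> {\<omega>\<in>\<Omega>. ennreal t < T \<omega>} \<in> F t"
proof -
  assume t: "0 \<le> t"
  have "\<Omega> - {\<omega>\<in>\<Omega>. T \<omega> \<le> ennreal t} \<in> F t"
    using UF.H_Diff[OF t UF.H_space[OF t] T_F[OF t]] unfolding space_M0 .
  moreover have "\<Omega> - {\<omega>\<in>\<Omega>. T \<omega> \<le> ennreal t} = {\<omega>\<in>\<Omega>. ennreal t < T \<omega>}" by auto
  ultimately show ?thesis by simp
qed

lemma act_G: "0 \<le> t \<Longrightarrow> {\<omega>\<in>\<Omega>. act t \<omega>} \<in> G t"
proof -
  assume t: "0 \<le> t"
  have "{\<omega>\<in>\<Omega>. \<tau> \<omega> \<le> ennreal t} \<in> G t" using \<tau>_le_G[OF t, of UNIV] by simp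
  moreover have "{\<omega>\<in>\<Omega>. S \<omega> \<le> ennreal t} \<in> G t" using S t unfolding os_stopping_time_def by blast
  moreover have "{\<omega>\<in>\<Omega>. ennreal t < T \<omega>} \<in> G t" using T_F_less[OF t] F_G[OF t] by blast
  ultimately have "{\<omega>\<in>\<Omega>. \<tau> \<omega> \<le> ennreal t} \<inter> ({\<omega>\<in>\<Omega>. S \<omega> \<le> ennreal t} \<inter> {\<omega>\<in>\<Omega>. ennreal t < T \<omega>}) \<in> G t"
    by (intro UQ.H_Int[OF t])
  moreover have "{\<omega>\<in>\<Omega>. \<tau> \<omega> \<le> ennreal t} \<inter> ({\<omega>\<in>\<Omega>. S \<omega> \<le> ennreal t} \<inter> {\<omega>\<in>\<Omega>. ennreal t < T \<omega>}) = {\<omega>\<in>\<Omega>. act t \<omega>}" by auto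
  ultimately show ?thesis by simp
qed

text \<open>The class for the Dynkin argument: events whose G-martingale under Q is, during
  \<open>act\<close>, a measurable function of (tau, t, omega). The identity is stated under
  \<open>M0\<close>, which has the same null sets as Q.\<close>

definition dsplit :: "'a set \<Rightarrow> bool" where
  "dsplit E \<longleftrightarrow> E \<in> Ginf \<and> (\<exists>X w. UQ.cver E X \<and> w \<in> borel_measurable PM \<and>
    (AE \<omega> in M0. \<forall>t\<ge>0. act t \<omega> \<longrightarrow> X t \<omega> = w (\<tau> \<omega>, t, \<omega>)))"

lemma dsplitE:
  assumes "dsplit E"
  obtains X w where "E \<in> sets Q" "UQ.cver E X" "w \<in> borel_measurable PM"
    "AE \<omega> in M0. \<forall>t\<ge>0. act t \<omega> \<longrightarrow> X t \<omega> = w (\<tau> \<omega>, t, \<omega>)"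
  using assms unfolding dsplit_def sets_Q by blast

lemma PM_process:
  assumes "UF.cver E X" shows "(\<lambda>p. X (fst (snd p)) (snd (snd p))) \<in> borel_measurable PM"
proof -
  have "(\<lambda>p. X (fst p) (snd p)) \<in> borel_measurable (OM F)"
    by (rule cadlag_adapted_OM) (use assms in \<open>simp_all add: UF.cver_def space_M0\<close>)
  moreover have "snd \<in> measurable PM (OM F)" unfolding PM_def by measurable
  ultimately show ?thesis using measurable_compose[of snd PM "OM F" "\<lambda>p. X (fst p) (snd p)" borel] by blast
qed

text \<open>The martingale \<open>P(C, s < T | F\<^sub>t)\<close> takes its terminal value at \<open>T\<close>, so that the
  defining property of the measure applies to it.\<close>

lemma stopped_terminal_value:
  assumes s: "0 \<le> s" and C: "C \<in> F s" and X: "UF.cver {\<omega>\<in>C. ennreal s < T \<omega>} X"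
  shows "AE \<omega> in M0. \<forall>u\<ge>s. X (if ennreal u \<le> T \<omega> then u else enn2real (T \<omega>)) \<omega> = indicator {\<omega>\<in>C. ennreal s < T \<omega>} \<omega>"
proof -
  let ?D = "{\<omega>\<in>C. ennreal s < T \<omega>}"
  have CO: "C \<subseteq> \<Omega>" using sets.sets_into_space[OF UF.H_sets[OF s C]] unfolding space_M0 .
  have D: "?D \<in> F s"
  proof -
    have "C \<inter> {\<omega>\<in>\<Omega>. ennreal s < T \<omega>} \<in> F s" by (rule UF.H_Int[OF s C T_F_less[OF s]])
    moreover have "C \<inter> {\<omega>\<in>\<Omega>. ennreal s < T \<omega>} = ?D" using CO by auto
    ultimately show ?thesis by simp
  qed
  have "AE \<omega> in M0. s \<le> q \<longrightarrow> X q \<omega> = indicator ?D \<omega>" if q: "q \<in> nnrat" for q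
  proof (cases "s \<le> q")
    case True
    have Dq: "?D \<in> F q" using F_mono[OF s True] D by blast
    have "AE \<omega> in M0. X q \<omega> = indicator ?D \<omega>" by (rule UF.cver_AE_known[OF X _ Dq]) (use q in simp)
    then show ?thesis by eventually_elim simp
  qed simp
  then have ae1: "AE \<omega> in M0. \<forall>q\<in>nnrat. s \<le> q \<longrightarrow> X q \<omega> = indicator ?D \<omega>"
    by (intro AE_ball_countable' countable_nnrat)
  have "AE \<omega> in M0. T \<omega> \<le> ennreal q \<longrightarrow> T \<omega> \<le> ennreal s \<longrightarrow> X q \<omega> = 0" if q: "q \<in> nnrat" for q
  proof -
    have q0: "0 \<le> q" and m0: "0 \<le> min q s" using q s by auto
    \<comment> \<open>The minimum serves both orders of q and s: the event is known at q, and it is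
      disjoint from \<open>s < T\<close>.\<close>
    have "{\<omega>\<in>\<Omega>. T \<omega> \<le> ennreal (min q s)} \<in> F (min q s)" by (rule T_F[OF m0])
    then have A: "{\<omega>\<in>\<Omega>. T \<omega> \<le> ennreal (min q s)} \<in> F q" using F_mono[OF m0, of q] by auto
    have "ennreal (min q s) \<le> ennreal s" by (rule ennreal_leI) simp
    then have "?D \<inter> {\<omega>\<in>\<Omega>. T \<omega> \<le> ennreal (min q s)} = {}" by (auto dest: order_trans simp: not_le[symmetric])
    then have "AE \<omega> in M0. \<omega> \<in> {\<omega>\<in>\<Omega>. T \<omega> \<le> ennreal (min q s)} \<longrightarrow> X q \<omega> = 0"
      by (intro UF.cver_AE_disjoint[OF X q0 A _ UF.H_sets[OF s D]]) simp
    then show ?thesis using AE_space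
    proof eventually_elim
      case (elim \<omega>)
      then show ?case unfolding space_M0 by (simp add: min_def)
    qed
  qed
  then have ae2: "AE \<omega> in M0. \<forall>q\<in>nnrat. T \<omega> \<le> ennreal q \<longrightarrow> T \<omega> \<le> ennreal s \<longrightarrow> X q \<omega> = 0"
    by (intro AE_ball_countable' countable_nnrat)
  show ?thesis using ae1 ae2 AE_space
  proof eventually_elim
    case (elim \<omega>)
    have w: "\<omega> \<in> space M0" by fact
    have 1: "X t \<omega> = indicator ?D \<omega>" if t: "s \<le> t" for t
    proof -
      have t0: "0 \<le> t" using t s by simp
      show ?thesis
        by (rule right_continuous_eq_on[where f="\<lambda>t. X t \<omega>" and g="\<lambda>_. indicator ?D \<omega>" and u="t+1", OF UF.cver_right[OF X t0 w]])
          (use elim(1) t t0 in auto)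
    qed
    have 2: "X t \<omega> = 0" if t: "0 \<le> t" "T \<omega> \<le> ennreal t" "T \<omega> \<le> ennreal s" for t
    proof (rule right_continuous_eq_on[where f="\<lambda>t. X t \<omega>" and g="\<lambda>_. 0" and u="t+1", OF UF.cver_right[OF X t(1) w]])
      fix q assume q: "q \<in> nnrat" "t < q" "q < t + 1"
      have "T \<omega> \<le> ennreal q" by (rule order_trans[OF t(2)]) (use q in \<open>simp add: ennreal_leI\<close>)
      then show "X q \<omega> = 0" using elim(2) q(1) t(3) by blast
    qed (use t in auto)
    show ?case
    proof (intro allI impI)
      fix u assume u: "s \<le> u"
      \<comment> \<open>The time v is u stopped at T. It is at least s if s < T, where X already
        equals the indicator, and at least T otherwise, where X already vanishes.\<close>
      define v where "v = (if ennreal u \<le> T \<omega> then u else enn2real (T \<omega>))"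
      have v0: "0 \<le> v" unfolding v_def using u s by simp
      show "X v \<omega> = indicator ?D \<omega>"
      proof (cases "ennreal s < T \<omega>")
        case True
        have "s \<le> v"
        proof (cases "ennreal u \<le> T \<omega>")
          case False
          then have "T \<omega> < \<infinity>" by (auto simp: not_le less_top[symmetric])
          then have "ennreal (enn2real (T \<omega>)) = T \<omega>" by simp
          then have "ennreal s < ennreal (enn2real (T \<omega>))" using True by simp
          then show ?thesis using False s by (simp add: v_def ennreal_less_iff)
        qed (simp add: v_def u)
        then show ?thesis by (rule 1)
      next
        case False
        then have Ts: "T \<omega> \<le> ennreal s" by simp
        have "T \<omega> \<le> ennreal v"
        proof (cases "ennreal u \<le> T \<omega>")
          case True
          then show ?thesis using order_trans[OF Ts ennreal_leI[OF u]] by (simp add: v_def)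
        next
          case False
          then have "T \<omega> < \<infinity>" by (auto simp: not_le less_top[symmetric])
          then show ?thesis using False by (simp add: v_def)
        qed
        then have "X v \<omega> = 0" by (rule 2[OF v0 _ Ts])
        then show ?thesis using False by (simp add: indicator_def)
      qed
    qed
  qed
qed

text \<open>From t \<ge> S on, the part stopped at S is constant and cancels in the
  increment.\<close>

lemma os_incr_act:
  assumes t: "0 \<le> t" "S \<omega> \<le> ennreal t" "ennreal t < T \<omega>" and u: "t \<le> u"
  shows "os_incr X S T u \<omega> - os_incr X S T t \<omega> = X (if ennreal u \<le> T \<omega> then u else enn2real (T \<omega>)) \<omega> - X t \<omega>"
proof -
  have ST: "max (S \<omega>) (T \<omega>) = T \<omega>" using order_trans[OF t(2) less_imp_le[OF t(3)]] by (simp add: max_def)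
  have S1: "(if ennreal v \<le> S \<omega> then v else enn2real (S \<omega>)) = enn2real (S \<omega>)" if v: "t \<le> v" for v
  proof (cases "ennreal v \<le> S \<omega>")
    case True
    have "ennreal t \<le> ennreal v" using v by (rule ennreal_leI)
    then have "S \<omega> = ennreal v" using True t(2) by (meson antisym order_trans)
    then show ?thesis using v t(1) by simp
  qed simp
  have "ennreal t \<le> T \<omega>" using t(3) by simp
  then show ?thesis unfolding os_incr_def os_stopped_def ST S1[OF u] S1[OF order_refl] by simp
qed

text \<open>The increment process of X is a bounded G-local martingale under Q, hence a martingale.
  On A its increment from t to u is the indicator of the event minus X t, by
  \<open>stopped_terminal_value\<close>. So X t, computed from F under M, also acts as the
  conditional probability given \<open>G t\<close> under Q.\<close>

lemma sH_conditional:
  assumes s: "0 \<le> s" and C: "C \<in> F s" and X: "UF.cver {\<omega>\<in>C. ennreal s < T \<omega>} X"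
    and b: "\<And>t \<omega>. 0 \<le> t \<Longrightarrow> 0 \<le> X t \<omega> \<and> X t \<omega> \<le> 1"
    and t: "0 \<le> t" and A: "A \<in> G t" "\<And>\<omega>. \<omega> \<in> A \<Longrightarrow> act t \<omega>"
  shows "(\<integral>\<omega>. indicator A \<omega> * X t \<omega> \<partial>Q) = measure Q ({\<omega>\<in>C. ennreal s < T \<omega>} \<inter> A)"
proof -
  let ?D = "{\<omega>\<in>C. ennreal s < T \<omega>}"
  let ?Z = "os_incr X S T"
  \<comment> \<open>At least s, so that the terminal value has been reached, and at least t, so that
    the martingale property applies from t.\<close>
  define u where "u = max s t"
  have u: "t \<le> u" "s \<le> u" "0 \<le> u" unfolding u_def using s by auto
  have CO: "C \<subseteq> \<Omega>" using sets.sets_into_space[OF UF.H_sets[OF s C]] unfolding space_M0 .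
  have Ds: "?D \<in> sets Q"
  proof -
    have "C \<inter> {\<omega>\<in>\<Omega>. ennreal s < T \<omega>} \<in> F s" by (rule UF.H_Int[OF s C T_F_less[OF s]])
    moreover have "C \<inter> {\<omega>\<in>\<Omega>. ennreal s < T \<omega>} = ?D" using CO by auto
    ultimately show ?thesis using F_G[OF s] G_Ginf[OF s] unfolding sets_Q by auto
  qed
  have As [measurable]: "A \<in> sets Q" using UQ.H_sets[OF t A(1)] .
  have lm: "os_local_martingale Q G ?Z"
    using sH cver_local_martingale[OF X] unfolding os_sH_measure_def by blast
  have Zb: "\<bar>?Z v \<omega>\<bar> \<le> 1" if v: "0 \<le> v" for v \<omega>
  proof -
    have "0 \<le> os_stopped X R v \<omega> \<and> os_stopped X R v \<omega> \<le> 1" for R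
      unfolding os_stopped_def by (rule b) (use v in simp)
    from this[of "\<lambda>\<omega>. max (S \<omega>) (T \<omega>)"] this[of S] show ?thesis unfolding os_incr_def by linarith
  qed
  have ad: "os_adapted (space Q) G ?Z" using lm unfolding os_local_martingale_def by blast
  have Zm: "?Z v \<in> borel_measurable Q" if v: "0 \<le> v" for v
    using ad v unfolding UQ.adapted_iff by (intro UQ.measurable_HM_P[OF v]) blast
  have Zi: "integrable Q (\<lambda>\<omega>. indicator A \<omega> * ?Z v \<omega>)" if v: "0 \<le> v" for v
    by (rule UQ.integrable_indicator_mult[OF UQ.bounded_integrable[OF Zm[OF v] Zb[OF v]] As])
  have AF: "X t \<in> borel_measurable Q"
  proof -
    have "subalgebra Q M0" unfolding subalgebra_def sets_Q sets_M0 space_Q space_M0 by simp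
    then show ?thesis by (rule measurable_from_subalg[OF _ UF.cver_P[OF X t]])
  qed
  have Xi: "integrable Q (\<lambda>\<omega>. indicator A \<omega> * X t \<omega>)"
    by (rule UQ.integrable_indicator_mult[OF UQ.bounded_integrable[OF AF] As, of 1]) (use b[OF t] in simp)
  have "(\<integral>\<omega>. indicator A \<omega> * ?Z u \<omega> \<partial>Q) = (\<integral>\<omega>. indicator A \<omega> * ?Z t \<omega> \<partial>Q)"
    by (rule UQ.bounded_local_martingale[OF lm Zb t u(1) A(1)])
  then have "0 = (\<integral>\<omega>. indicator A \<omega> * ?Z u \<omega> \<partial>Q) - (\<integral>\<omega>. indicator A \<omega> * ?Z t \<omega> \<partial>Q)" by simp
  also have "\<dots> = (\<integral>\<omega>. indicator A \<omega> * ?Z u \<omega> - indicator A \<omega> * ?Z t \<omega> \<partial>Q)"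
    by (rule Bochner_Integration.integral_diff[symmetric, OF Zi[OF u(3)] Zi[OF t]])
  also have "\<dots> = (\<integral>\<omega>. indicator (?D \<inter> A) \<omega> - indicator A \<omega> * X t \<omega> \<partial>Q)"
  proof (rule integral_cong_AE)
    show "AE \<omega> in Q. indicator A \<omega> * ?Z u \<omega> - indicator A \<omega> * ?Z t \<omega> = indicator (?D \<inter> A) \<omega> - indicator A \<omega> * X t \<omega>"
      using AE_equiv2[OF equiv_Q stopped_terminal_value[OF s C X]]
    proof eventually_elim
      case (elim \<omega>)
      show ?case
      proof (cases "\<omega> \<in> A")
        case True
        then have a: "S \<omega> \<le> ennreal t" "ennreal t < T \<omega>" using A(2) by blast+
        have "?Z u \<omega> - ?Z t \<omega> = indicator ?D \<omega> - X t \<omega>"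
          using os_incr_act[OF t a u(1), of X] elim u(2) by simp
        then show ?thesis using True by (simp add: indicator_inter_arith)
      qed simp
    qed
    show "(\<lambda>\<omega>. indicator A \<omega> * ?Z u \<omega> - indicator A \<omega> * ?Z t \<omega>) \<in> borel_measurable Q"
      using Zi[OF u(3)] Zi[OF t] by measurable
    have "(indicator (?D \<inter> A) :: 'a \<Rightarrow> real) \<in> borel_measurable Q" by (rule borel_measurable_indicator[OF sets.Int[OF Ds As]])
    then show "(\<lambda>\<omega>. indicator (?D \<inter> A) \<omega> - indicator A \<omega> * X t \<omega>) \<in> borel_measurable Q"
      using Xi by measurable
  qed
  also have "\<dots> = (\<integral>\<omega>. indicator (?D \<inter> A) \<omega> \<partial>Q) - (\<integral>\<omega>. indicator A \<omega> * X t \<omega> \<partial>Q)"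
  proof (rule Bochner_Integration.integral_diff[OF _ Xi])
    show "integrable Q (indicator (?D \<inter> A) :: 'a \<Rightarrow> real)"
      by (rule UQ.bounded_integrable[of _ 1]) (use sets.Int[OF Ds As] in \<open>auto simp: indicator_def\<close>)
  qed
  also have "(\<integral>\<omega>. indicator (?D \<inter> A) \<omega> \<partial>Q) = measure Q (?D \<inter> A)" using sets.Int[OF Ds As] by simp
  finally show ?thesis by simp
qed

text \<open>During \<open>act\<close>, tau \<le> t, so 1_B(tau) is known to \<open>G t\<close> and
  can be absorbed into the test set A of \<open>sH_conditional\<close>. \<open>cver_AE_eq_on\<close>
  identifies the martingale at rational times.\<close>

lemma dsplit_generator:
  assumes B: "B \<in> sets (borel::ennreal measure)" and s: "0 \<le> s" and C: "C \<in> F s"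
    and E: "{\<omega>\<in>\<Omega>. \<tau> \<omega> \<in> B \<and> \<omega> \<in> C \<and> ennreal s < T \<omega>} \<in> Ginf"
  shows "dsplit {\<omega>\<in>\<Omega>. \<tau> \<omega> \<in> B \<and> \<omega> \<in> C \<and> ennreal s < T \<omega>}"
proof -
  let ?D = "{\<omega>\<in>C. ennreal s < T \<omega>}" and ?E = "{\<omega>\<in>\<Omega>. \<tau> \<omega> \<in> B \<and> \<omega> \<in> C \<and> ennreal s < T \<omega>}"
  have CO: "C \<subseteq> \<Omega>" using sets.sets_into_space[OF UF.H_sets[OF s C]] unfolding space_M0 .
  have "C \<inter> {\<omega>\<in>\<Omega>. ennreal s < T \<omega>} \<in> F s" by (rule UF.H_Int[OF s C T_F_less[OF s]])
  moreover have "C \<inter> {\<omega>\<in>\<Omega>. ennreal s < T \<omega>} = ?D" using CO by auto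
  ultimately have D: "?D \<in> sets M0" using UF.H_sets[OF s] by metis
  obtain X where X: "UF.cver ?D X" "\<forall>t \<omega>. 0 \<le> t \<longrightarrow> 0 \<le> X t \<omega> \<and> X t \<omega> \<le> 1" using UF.ex_cver[OF D] by blast
  have Xb: "0 \<le> X t \<omega> \<and> X t \<omega> \<le> 1" if "0 \<le> t" for t \<omega> using X(2) that by blast
  have Es: "?E \<in> sets Q" unfolding sets_Q by (rule E)
  obtain Z where Z: "UQ.cver ?E Z" using UQ.ex_cver[OF Es] by blast
  have "AE \<omega> in M0. act q \<omega> \<longrightarrow> Z q \<omega> = indicator B (\<tau> \<omega>) * X q \<omega>" if q: "q \<in> nnrat" for q
  proof -
    have t: "0 \<le> q" using q by simp
    have TB: "{\<omega>\<in>\<Omega>. \<tau> \<omega> \<in> B \<and> \<tau> \<omega> \<le> ennreal q} \<in> G q" (is "?T \<in> _") by (rule \<tau>_le_G[OF t B])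
    have "AE \<omega> in Q. \<omega> \<in> {\<omega>\<in>\<Omega>. act q \<omega>} \<longrightarrow> Z q \<omega> = indicator ?T \<omega> * X q \<omega>"
    proof (rule UQ.cver_AE_eq_on[OF Z t act_G[OF t]])
      have "subalgebra (UQ.HM q) (UF.HM q)"
        unfolding subalgebra_def UF.space_HM UQ.space_HM UF.sets_HM[OF t] UQ.sets_HM[OF t] space_Q space_M0
        using F_G[OF t] by simp
      then have Xq [measurable]: "X q \<in> borel_measurable (UQ.HM q)"
        by (rule measurable_from_subalg[OF _ UF.cver_HM[OF X(1) t]])
      have [measurable]: "?T \<in> sets (UQ.HM q)" using TB unfolding UQ.sets_HM[OF t] .
      show Ym: "(\<lambda>\<omega>. indicator ?T \<omega> * X q \<omega>) \<in> borel_measurable (UQ.HM q)" by measurable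
      show "integrable Q (\<lambda>\<omega>. indicator ?T \<omega> * X q \<omega>)"
        by (rule UQ.bounded_integrable[OF UQ.measurable_HM_P[OF t Ym], of 1]) (use Xb[OF t] in \<open>simp add: indicator_def\<close>)
      fix A assume A: "A \<in> G q" "A \<subseteq> {\<omega>\<in>\<Omega>. act q \<omega>}"
      have AT: "A \<inter> ?T \<in> G q" by (rule UQ.H_Int[OF t A(1) TB])
      have "(\<integral>\<omega>. indicator A \<omega> * (indicator ?T \<omega> * X q \<omega>) \<partial>Q) = (\<integral>\<omega>. indicator (A \<inter> ?T) \<omega> * X q \<omega> \<partial>Q)"
        by (rule Bochner_Integration.integral_cong) (simp_all add: indicator_inter_arith)
      also have "\<dots> = measure Q (?D \<inter> (A \<inter> ?T))"
        by (rule sH_conditional[OF s C X(1) Xb t AT]) (use A(2) in auto)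
      also have "?D \<inter> (A \<inter> ?T) = ?E \<inter> A" using A(2) by auto
      finally show "(\<integral>\<omega>. indicator A \<omega> * (indicator ?T \<omega> * X q \<omega>) \<partial>Q) = measure Q (?E \<inter> A)" .
    qed
    then have "AE \<omega> in M0. \<omega> \<in> {\<omega>\<in>\<Omega>. act q \<omega>} \<longrightarrow> Z q \<omega> = indicator ?T \<omega> * X q \<omega>"
      by (rule AE_equiv[OF equiv_Q])
    then show ?thesis using AE_space
    proof eventually_elim
      case (elim \<omega>)
      then show ?case unfolding space_M0 by (auto simp: indicator_def)
    qed
  qed
  then have ae: "AE \<omega> in M0. \<forall>q\<in>nnrat. act q \<omega> \<longrightarrow> Z q \<omega> = indicator B (\<tau> \<omega>) * X q \<omega>"
    by (intro AE_ball_countable' countable_nnrat)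
  define w where "w p = indicator B (fst p) * X (fst (snd p)) (snd (snd p))" for p :: "ennreal \<times> real \<times> 'a"
  have wm: "w \<in> borel_measurable PM"
  proof -
    have "fst \<in> measurable PM borel" unfolding PM_def by measurable
    moreover have "(indicator B :: ennreal \<Rightarrow> real) \<in> borel_measurable borel" by (rule borel_measurable_indicator[OF B])
    ultimately have "(\<lambda>p. indicator B (fst p) :: real) \<in> borel_measurable PM" by (rule measurable_compose)
    then show ?thesis unfolding w_def by (intro borel_measurable_times PM_process[OF X(1)])
  qed
  have "AE \<omega> in M0. \<forall>t\<ge>0. act t \<omega> \<longrightarrow> Z t \<omega> = w (\<tau> \<omega>, t, \<omega>)"
    using ae AE_space
  proof eventually_elim
    case (elim \<omega>)
    have w0: "\<omega> \<in> space M0" by fact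
    have wQ: "\<omega> \<in> space Q" using w0 unfolding space_M0 space_Q .
    show ?case
    proof (intro allI impI)
      fix t :: real assume t: "0 \<le> t" and a: "act t \<omega>"
      \<comment> \<open>Since t < T there is room for rationals in (t, u) with u < T; all of them
        satisfy \<open>act\<close>, so right-continuity reaches t itself.\<close>
      obtain u where u: "u \<in> nnrat" "t < u" "ennreal u < T \<omega>" using ennreal_rat_between[OF t, of "T \<omega>"] a by blast
      have "Z t \<omega> = indicator B (\<tau> \<omega>) * X t \<omega>"
      proof (rule right_continuous_eq_on[where f="\<lambda>t. Z t \<omega>" and g="\<lambda>t. indicator B (\<tau> \<omega>) * X t \<omega>", OF _ _ t u(2)])
        show "((\<lambda>t. Z t \<omega>) \<longlongrightarrow> Z t \<omega>) (at_right t)" by (rule UQ.cver_right[OF Z t wQ])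
        show "((\<lambda>t. indicator B (\<tau> \<omega>) * X t \<omega>) \<longlongrightarrow> indicator B (\<tau> \<omega>) * X t \<omega>) (at_right t)"
          by (intro tendsto_intros UF.cver_right[OF X(1) t w0])
        fix q assume q: "q \<in> nnrat" "t < q" "q < u"
        have "ennreal t \<le> ennreal q" "ennreal q \<le> ennreal u" using q by (simp_all add: ennreal_leI)
        then have "act q \<omega>" using a u(3) by (meson order_trans le_less_trans)
        then show "Z q \<omega> = indicator B (\<tau> \<omega>) * X q \<omega>" using elim(1) q(1) by blast
      qed
      then show "Z t \<omega> = w (\<tau> \<omega>, t, \<omega>)" unfolding w_def by simp
    qed
  qed
  then show ?thesis unfolding dsplit_def using E Z wm by blast
qed

section \<open>The Dynkin argument up to all events before T\<close>

lemma dsplit_space: "dsplit \<Omega>"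
  unfolding dsplit_def
proof (intro conjI exI)
  show "\<Omega> \<in> Ginf" using Ginf_sa sigma_algebra.axioms(1) algebra.top by blast
  show "UQ.cver \<Omega> (\<lambda>_ _. 1)" using UQ.cver_space unfolding space_Q .
  show "AE \<omega> in M0. \<forall>t\<ge>0. act t \<omega> \<longrightarrow> 1 = (\<lambda>_. 1) (\<tau> \<omega>, t, \<omega>)" by simp
qed simp

lemma dsplit_compl: assumes "dsplit E" shows "dsplit (\<Omega> - E)"
proof -
  obtain X w where X: "E \<in> sets Q" "UQ.cver E X" and w: "w \<in> borel_measurable PM"
    "AE \<omega> in M0. \<forall>t\<ge>0. act t \<omega> \<longrightarrow> X t \<omega> = w (\<tau> \<omega>, t, \<omega>)" using assms by (rule dsplitE)
  have 1: "\<Omega> - E \<in> Ginf" using sets.compl_sets[OF X(1)] unfolding space_Q sets_Q .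
  have 2: "UQ.cver (\<Omega> - E) (\<lambda>t \<omega>. 1 - X t \<omega>)"
    using UQ.cver_diff[OF UQ.cver_space X(2) sets.top X(1) sets.sets_into_space[OF X(1)]] unfolding space_Q .
  have 3: "(\<lambda>p. 1 - w p) \<in> borel_measurable PM" using w(1) by measurable
  have 4: "AE \<omega> in M0. \<forall>t\<ge>0. act t \<omega> \<longrightarrow> 1 - X t \<omega> = (\<lambda>p. 1 - w p) (\<tau> \<omega>, t, \<omega>)"
    using w(2) by eventually_elim simp
  show ?thesis unfolding dsplit_def using 1 2 3 4 by (intro conjI exI)
qed

lemma dsplit_UN:
  fixes A :: "nat \<Rightarrow> 'a set"
  assumes A: "\<And>i. dsplit (A i)" and d: "disjoint_family A" shows "dsplit (\<Union>i. A i)"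
proof -
  have As: "A i \<in> sets Q" for i using A[of i] unfolding dsplit_def sets_Q by blast
  have "\<forall>i. \<exists>Xw. UQ.cver (A i) (fst Xw) \<and> snd Xw \<in> borel_measurable PM \<and>
    (AE \<omega> in M0. \<forall>t\<ge>0. act t \<omega> \<longrightarrow> fst Xw t \<omega> = snd Xw (\<tau> \<omega>, t, \<omega>))"
    using A unfolding dsplit_def by simp
  from choice[OF this] obtain Xw where Xw: "\<forall>i. UQ.cver (A i) (fst (Xw i)) \<and> snd (Xw i) \<in> borel_measurable PM \<and>
    (AE \<omega> in M0. \<forall>t\<ge>0. act t \<omega> \<longrightarrow> fst (Xw i) t \<omega> = snd (Xw i) (\<tau> \<omega>, t, \<omega>))" by blast
  define X where "X i = fst (Xw i)" for i
  define w where "w i = snd (Xw i)" for i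
  have X: "UQ.cver (A i) (X i)" and wm: "w i \<in> borel_measurable PM"
    and ae: "AE \<omega> in M0. \<forall>t\<ge>0. act t \<omega> \<longrightarrow> X i t \<omega> = w i (\<tau> \<omega>, t, \<omega>)" for i
    using Xw unfolding X_def w_def by blast+
  have Us: "(\<Union>i. A i) \<in> sets Q" using As by auto
  obtain Z where Z: "UQ.cver (\<Union>i. A i) Z" using UQ.ex_cver[OF Us] by blast
  \<comment> \<open>\<open>lim\<close> is a Borel operation on all sequences of measurable
    functions, so v is measurable also at points where the sums diverge.\<close>
  define v where "v p = lim (\<lambda>n. \<Sum>i<n. w i p)" for p
  have vm: "v \<in> borel_measurable PM"
    unfolding v_def by (intro borel_measurable_lim_metric borel_measurable_sum wm)
  have ae': "AE \<omega> in M0. \<forall>i. \<forall>t\<ge>0. act t \<omega> \<longrightarrow> X i t \<omega> = w i (\<tau> \<omega>, t, \<omega>)"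
    unfolding AE_all_countable using ae by (rule allI)
  have "AE \<omega> in M0. \<forall>t\<ge>0. (\<lambda>n. \<Sum>i<n. X i t \<omega>) \<longlonglongrightarrow> Z t \<omega>"
    by (rule AE_equiv[OF equiv_Q UQ.cver_sum_converges[OF X As d Z]])
  then have "AE \<omega> in M0. \<forall>t\<ge>0. act t \<omega> \<longrightarrow> Z t \<omega> = v (\<tau> \<omega>, t, \<omega>)"
    using ae'
  proof eventually_elim
    case (elim \<omega>)
    show ?case
    proof (intro allI impI)
      fix t :: real assume t: "0 \<le> t" and a: "act t \<omega>"
      have "X i t \<omega> = w i (\<tau> \<omega>, t, \<omega>)" for i using elim(2) t a by blast
      moreover have "(\<lambda>n. \<Sum>i<n. X i t \<omega>) \<longlonglongrightarrow> Z t \<omega>" using elim(1) t by blast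
      ultimately have "(\<lambda>n. \<Sum>i<n. w i (\<tau> \<omega>, t, \<omega>)) \<longlonglongrightarrow> Z t \<omega>" by simp
      then show "Z t \<omega> = v (\<tau> \<omega>, t, \<omega>)" unfolding v_def by (rule limI[symmetric])
    qed
  qed
  then show ?thesis unfolding dsplit_def using Us Z vm unfolding sets_Q by blast
qed

text \<open>The sets \<open>C\<close> cut by \<open>s < T\<close> with \<open>C\<close> in
  \<open>F s\<close> are, beside \<open>F 0\<close>, the usual generators of the strict past of T;
  here they are joined with events of tau. Using the same s in both places makes the event decided
  before T.\<close>

definition Tgen :: "'a set set" where
  "Tgen = {{\<omega>\<in>\<Omega>. \<tau> \<omega> \<in> B \<and> \<omega> \<in> C \<and> ennreal s < T \<omega>} | B C s. B \<in> sets (borel::ennreal measure) \<and> 0 \<le> s \<and> C \<in> F s}"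

lemma Tgen_Ginf: assumes "A \<in> Tgen" shows "A \<in> Ginf"
proof -
  obtain B C s where A: "A = {\<omega>\<in>\<Omega>. \<tau> \<omega> \<in> B \<and> \<omega> \<in> C \<and> ennreal s < T \<omega>}" and B: "B \<in> sets (borel::ennreal measure)"
    and s: "0 \<le> s" and C: "C \<in> F s" using assms unfolding Tgen_def by blast
  have N: "{\<omega>\<in>\<Omega>. \<tau> \<omega> \<in> B} \<in> Ginf"
  proof -
    interpret sigma_algebra \<Omega> Ginf by (rule Ginf_sa)
    have fin: "{\<omega>\<in>\<Omega>. \<tau> \<omega> \<in> B' \<and> \<tau> \<omega> \<le> ennreal (real n)} \<in> Ginf" if "B' \<in> sets (borel::ennreal measure)" for B' n
      using \<tau>_le_G[of "real n" B'] G_Ginf[of "real n"] that by auto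
    have ex: "(\<exists>n. x \<le> ennreal (real n)) \<longleftrightarrow> x \<noteq> \<top>" for x :: ennreal
    proof (cases x)
      case (real r)
      obtain n where "r \<le> real n" using real_arch_simple by blast
      then show ?thesis using real by (auto intro: ennreal_leI)
    qed (auto simp: top_unique)
    have U: "(\<Union>n. {\<omega>\<in>\<Omega>. \<tau> \<omega> \<in> B' \<and> \<tau> \<omega> \<le> ennreal (real n)}) = {\<omega>\<in>\<Omega>. \<tau> \<omega> \<in> B' \<and> \<tau> \<omega> \<noteq> \<top>}" for B'
      using ex by auto
    have f: "{\<omega>\<in>\<Omega>. \<tau> \<omega> \<in> B' \<and> \<tau> \<omega> \<noteq> \<top>} \<in> Ginf" if "B' \<in> sets (borel::ennreal measure)" for B'
      unfolding U[symmetric] by (intro countable_UN) (use fin[OF that] in blast)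
    \<comment> \<open>The value infinity is not seen by any event tau \<le> n, so it enters through
      a complement.\<close>
    show ?thesis
    proof (cases "\<top> \<in> B")
      case True
      have "\<Omega> - {\<omega>\<in>\<Omega>. \<tau> \<omega> \<in> - B \<and> \<tau> \<omega> \<noteq> \<top>} \<in> Ginf" using f[of "- B"] B by auto
      moreover have "\<Omega> - {\<omega>\<in>\<Omega>. \<tau> \<omega> \<in> - B \<and> \<tau> \<omega> \<noteq> \<top>} = {\<omega>\<in>\<Omega>. \<tau> \<omega> \<in> B}" using True by auto
      ultimately show ?thesis by simp
    next
      case False
      then have "{\<omega>\<in>\<Omega>. \<tau> \<omega> \<in> B \<and> \<tau> \<omega> \<noteq> \<top>} = {\<omega>\<in>\<Omega>. \<tau> \<omega> \<in> B}" by auto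
      then show ?thesis using f[OF B] by simp
    qed
  qed
  have FG: "F s \<subseteq> Ginf" using F_G[OF s] G_Ginf[OF s] by blast
  interpret sigma_algebra \<Omega> Ginf by (rule Ginf_sa)
  have "{\<omega>\<in>\<Omega>. \<tau> \<omega> \<in> B} \<inter> (C \<inter> {\<omega>\<in>\<Omega>. ennreal s < T \<omega>}) \<in> Ginf"
    using N C T_F_less[OF s] FG by blast
  moreover have "{\<omega>\<in>\<Omega>. \<tau> \<omega> \<in> B} \<inter> (C \<inter> {\<omega>\<in>\<Omega>. ennreal s < T \<omega>}) = A" unfolding A by auto
  ultimately show ?thesis by simp
qed

lemma Tgen_Int_stable: "Int_stable Tgen"
  unfolding Int_stable_def
proof (intro ballI)
  fix A A' assume "A \<in> Tgen" "A' \<in> Tgen"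
  then obtain B C s B' C' s' where A: "A = {\<omega>\<in>\<Omega>. \<tau> \<omega> \<in> B \<and> \<omega> \<in> C \<and> ennreal s < T \<omega>}" "B \<in> sets (borel::ennreal measure)" "0 \<le> s" "C \<in> F s"
    and A': "A' = {\<omega>\<in>\<Omega>. \<tau> \<omega> \<in> B' \<and> \<omega> \<in> C' \<and> ennreal s' < T \<omega>}" "B' \<in> sets (borel::ennreal measure)" "0 \<le> s'" "C' \<in> F s'"
    unfolding Tgen_def by blast
  define m where "m = max s s'"
  have m: "0 \<le> m" "s \<le> m" "s' \<le> m" unfolding m_def using A(3) by auto
  have CC: "C \<inter> C' \<in> F m" using UF.H_Int[OF m(1)] F_mono[OF A(3) m(2)] F_mono[OF A'(3) m(3)] A(4) A'(4) by blast
  have mm: "ennreal m < x \<longleftrightarrow> ennreal s < x \<and> ennreal s' < x" for x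
  proof
    assume "ennreal m < x"
    then show "ennreal s < x \<and> ennreal s' < x"
      using le_less_trans[OF ennreal_leI[OF m(2)]] le_less_trans[OF ennreal_leI[OF m(3)]] by blast
  next
    assume "ennreal s < x \<and> ennreal s' < x"
    then show "ennreal m < x" unfolding m_def by (simp add: max_def)
  qed
  have "A \<inter> A' = {\<omega>\<in>\<Omega>. \<tau> \<omega> \<in> B \<inter> B' \<and> \<omega> \<in> C \<inter> C' \<and> ennreal m < T \<omega>}"
    unfolding A(1) A'(1) mm by auto
  then show "A \<inter> A' \<in> Tgen" unfolding Tgen_def using A(2) A'(2) m(1) CC by blast
qed

lemma dsplit_sigma: assumes "E \<in> sigma_sets \<Omega> Tgen" shows "dsplit E"
proof -
  have "Tgen \<subseteq> Pow \<Omega>" unfolding Tgen_def by blast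
  from Tgen_Int_stable this assms show ?thesis
  proof (induction rule: sigma_sets_induct_disjoint)
    case (basic A)
    then obtain B C s where A: "A = {\<omega>\<in>\<Omega>. \<tau> \<omega> \<in> B \<and> \<omega> \<in> C \<and> ennreal s < T \<omega>}" "B \<in> sets (borel::ennreal measure)" "0 \<le> s" "C \<in> F s"
      unfolding Tgen_def by blast
    show ?case unfolding A(1) by (rule dsplit_generator[OF A(2-4)]) (use Tgen_Ginf[OF basic] A(1) in simp)
  next
    case empty
    show ?case using dsplit_compl[OF dsplit_space] by simp
  next
    case (compl A)
    then show ?case by (intro dsplit_compl)
  next
    case (union A)
    then show ?case by (intro dsplit_UN)
  qed
qed

text \<open>Cutting at the index s of \<open>K s\<close> itself turns both kinds of base sets into
  members of \<open>Tgen\<close>.\<close>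

lemma K_before_T:
  assumes s: "0 \<le> s" and A: "A \<in> K s"
  shows "{\<omega>\<in>A. ennreal s < T \<omega>} \<in> sigma_sets \<Omega> Tgen"
proof -
  have "Tgen \<subseteq> Pow \<Omega>" unfolding Tgen_def by blast
  then interpret sigma_algebra \<Omega> "sigma_sets \<Omega> Tgen" by (rule sigma_algebra_sigma_sets)
  have gen: "{\<omega>\<in>\<Omega>. \<tau> \<omega> \<in> B \<and> \<omega> \<in> C \<and> ennreal s < T \<omega>} \<in> sigma_sets \<Omega> Tgen"
    if "B \<in> sets (borel::ennreal measure)" "C \<in> F s" for B C
    by (rule sigma_sets.Basic) (use that s in \<open>auto simp: Tgen_def\<close>)
  have FO: "C \<subseteq> \<Omega>" if "C \<in> F s" for C using F_sub[OF s] that sets.sets_into_space by blast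
  have OF: "\<Omega> \<in> F s" using UF.H_space[OF s] unfolding space_M0 .
  from A show ?thesis
  proof (rule K_induct[OF s])
    fix C assume C: "C \<in> F s"
    have "{\<omega>\<in>\<Omega>. \<tau> \<omega> \<in> UNIV \<and> \<omega> \<in> C \<and> ennreal s < T \<omega>} = {\<omega>\<in>C. ennreal s < T \<omega>}" using FO[OF C] by auto
    then show "{\<omega>\<in>C. ennreal s < T \<omega>} \<in> sigma_sets \<Omega> Tgen" using gen[of UNIV C] C by simp
  next
    fix B :: "ennreal set" assume B: "B \<in> sets borel"
    have "(\<lambda>x. min x (ennreal s)) \<in> borel_measurable (borel :: ennreal measure)" by measurable
    from measurable_sets[OF this B] have B': "(\<lambda>x. min x (ennreal s)) -` B \<in> sets borel" by simp
    have "{\<omega>\<in>\<Omega>. \<tau> \<omega> \<in> (\<lambda>x. min x (ennreal s)) -` B \<and> \<omega> \<in> \<Omega> \<and> ennreal s < T \<omega>} = {\<omega>\<in>{\<omega>\<in>\<Omega>. min (\<tau> \<omega>) (ennreal s) \<in> B}. ennreal s < T \<omega>}" by auto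
    then show "{\<omega>\<in>{\<omega>\<in>\<Omega>. min (\<tau> \<omega>) (ennreal s) \<in> B}. ennreal s < T \<omega>} \<in> sigma_sets \<Omega> Tgen" using gen[OF B' OF] by simp
  next
    fix A assume A: "{\<omega>\<in>A. ennreal s < T \<omega>} \<in> sigma_sets \<Omega> Tgen"
    have "{\<omega>\<in>\<Omega>. \<tau> \<omega> \<in> UNIV \<and> \<omega> \<in> \<Omega> \<and> ennreal s < T \<omega>} - {\<omega>\<in>A. ennreal s < T \<omega>} \<in> sigma_sets \<Omega> Tgen"
      using gen[of UNIV \<Omega>] OF A by (intro Diff) auto
    moreover have "{\<omega>\<in>\<Omega>. \<tau> \<omega> \<in> UNIV \<and> \<omega> \<in> \<Omega> \<and> ennreal s < T \<omega>} - {\<omega>\<in>A. ennreal s < T \<omega>} = {\<omega>\<in>\<Omega> - A. ennreal s < T \<omega>}" by auto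
    ultimately show "{\<omega>\<in>\<Omega> - A. ennreal s < T \<omega>} \<in> sigma_sets \<Omega> Tgen" by simp
  next
    fix A :: "nat \<Rightarrow> 'a set" assume A: "\<And>i. {\<omega>\<in>A i. ennreal s < T \<omega>} \<in> sigma_sets \<Omega> Tgen"
    have "(\<Union>i. {\<omega>\<in>A i. ennreal s < T \<omega>}) \<in> sigma_sets \<Omega> Tgen" by (rule sigma_sets.Union[OF A])
    moreover have "(\<Union>i. {\<omega>\<in>A i. ennreal s < T \<omega>}) = {\<omega>\<in>(\<Union>i. A i). ennreal s < T \<omega>}" by auto
    ultimately show "{\<omega>\<in>(\<Union>i. A i). ennreal s < T \<omega>} \<in> sigma_sets \<Omega> Tgen" by simp
  qed
qed

text \<open>The representative of A is in \<open>K s\<close> for s > q but perhaps not in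
  \<open>K q\<close>. The cut \<open>q < T\<close> is therefore exhausted by
  \<open>q + 1/n < T\<close>, each paired with its own \<open>K (q + 1/n)\<close>; the null set
  between A and its representative is absorbed by \<open>cver_null_modify\<close>.\<close>

lemma dsplit_before_T:
  assumes q: "0 \<le> q" and A: "A \<in> G q"
  shows "dsplit {\<omega>\<in>A. ennreal q < T \<omega>}"
proof -
  obtain A0 where A0: "A0 \<in> Kp q" "nullset ((A - A0) \<union> (A0 - A))"
    using A unfolding G_eq[OF q] modnull_def by blast
  let ?E = "{\<omega>\<in>A0. ennreal q < T \<omega>}" and ?E' = "{\<omega>\<in>A. ennreal q < T \<omega>}"
  have A0O: "A0 \<subseteq> \<Omega>" using A0(1) Kp_sa[OF q] unfolding sigma_algebra_iff2 by blast
  have AO: "A \<subseteq> \<Omega>" using A G_sa[OF q] unfolding sigma_algebra_iff2 by blast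
  have "?E = (\<Union>n::nat. {\<omega>\<in>A0. ennreal (q + 1 / Suc n) < T \<omega>})"
  proof (intro equalityI subsetI)
    fix \<omega> assume w: "\<omega> \<in> ?E"
    then obtain u where u: "u \<in> nnrat" "q < u" "ennreal u < T \<omega>" using ennreal_rat_between[OF q, of "T \<omega>"] by blast
    obtain n :: nat where n: "1 / Suc n < u - q" using nat_approx_posE[of "u - q"] u by auto
    have "ennreal (q + 1 / Suc n) < T \<omega>" by (rule le_less_trans[OF ennreal_leI u(3)]) (use n in simp)
    then show "\<omega> \<in> (\<Union>n::nat. {\<omega>\<in>A0. ennreal (q + 1 / Suc n) < T \<omega>})" using w by blast
  next
    fix \<omega> assume "\<omega> \<in> (\<Union>n::nat. {\<omega>\<in>A0. ennreal (q + 1 / Suc n) < T \<omega>})"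
    then obtain n :: nat where n: "\<omega> \<in> A0" "ennreal (q + 1 / Suc n) < T \<omega>" by blast
    have "ennreal q < T \<omega>" by (rule le_less_trans[OF ennreal_leI n(2)]) simp
    then show "\<omega> \<in> ?E" using n by simp
  qed
  also have "\<dots> \<in> sigma_sets \<Omega> Tgen"
  proof (rule sigma_sets.Union)
    fix n :: nat
    have "A0 \<in> K (q + 1 / Suc n)" using A0(1) unfolding Kp_def by simp
    then show "{\<omega>\<in>A0. ennreal (q + 1 / Suc n) < T \<omega>} \<in> sigma_sets \<Omega> Tgen"
      by (intro K_before_T) (use q in auto)
  qed
  finally have "dsplit ?E" by (rule dsplit_sigma)
  then obtain X w where X: "?E \<in> sets Q" "UQ.cver ?E X" and w: "w \<in> borel_measurable PM"
    "AE \<omega> in M0. \<forall>t\<ge>0. act t \<omega> \<longrightarrow> X t \<omega> = w (\<tau> \<omega>, t, \<omega>)" by (rule dsplitE)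
  have E': "?E' \<in> sets Q"
  proof -
    have "A \<inter> {\<omega>\<in>\<Omega>. ennreal q < T \<omega>} \<in> G q" by (rule UQ.H_Int[OF q A]) (use T_F_less[OF q] F_G[OF q] in blast)
    moreover have "A \<inter> {\<omega>\<in>\<Omega>. ennreal q < T \<omega>} = ?E'" using AO by auto
    ultimately show ?thesis using UQ.H_sets[OF q] by metis
  qed
  have "AE \<omega> in M0. \<omega> \<in> ?E \<longleftrightarrow> \<omega> \<in> ?E'" by (rule AE_M0_nullset[OF A0(2)]) blast
  then have "UQ.cver ?E' X" by (intro UQ.cver_null_modify[OF X(2,1) E'] AE_equiv2[OF equiv_Q])
  then show ?thesis unfolding dsplit_def using E' w unfolding sets_Q by blast
qed

text \<open>The same scheme as before tau, now with horizon T and with G-martingales under Q. The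
  event R \<le> r belongs to \<open>G r\<close>, so vanishing is immediate; the work lies in
  replacing the G-martingales by functions of (tau, t, omega), which \<open>dsplit\<close>
  provides.\<close>

lemma after_time_act:
  assumes R: "os_stopping_time \<Omega> G R"
  shows "after_time \<Omega> R \<in> traced (\<lambda>(t,\<omega>). (\<tau> \<omega>, t, \<omega>)) PM {(t,\<omega>). act t \<omega>}"
proof -
  define E where "E q = {\<omega>\<in>\<Omega> - {\<omega>\<in>\<Omega>. R \<omega> \<le> ennreal q}. ennreal q < T \<omega>}" for q :: real
  have RG: "{\<omega>\<in>\<Omega>. R \<omega> \<le> ennreal q} \<in> G q" if "0 \<le> q" for q
    using R that unfolding os_stopping_time_def by blast
  have Ed: "dsplit (E q)" if q: "q \<in> nnrat" for q
    unfolding E_def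
  proof (rule dsplit_before_T)
    show q0: "0 \<le> q" using q by simp
    show "\<Omega> - {\<omega>\<in>\<Omega>. R \<omega> \<le> ennreal q} \<in> G q"
      using UQ.H_Diff[OF q0 UQ.H_space[OF q0] RG[OF q0]] unfolding space_Q .
  qed
  have "\<forall>q. \<exists>Xw. q \<in> nnrat \<longrightarrow> UQ.cver (E q) (fst Xw) \<and> snd Xw \<in> borel_measurable PM \<and>
    (AE \<omega> in M0. \<forall>t\<ge>0. act t \<omega> \<longrightarrow> fst Xw t \<omega> = snd Xw (\<tau> \<omega>, t, \<omega>))"
    using Ed unfolding dsplit_def by simp
  from choice[OF this] obtain Xw where Xw: "\<forall>q. q \<in> nnrat \<longrightarrow> UQ.cver (E q) (fst (Xw q)) \<and> snd (Xw q) \<in> borel_measurable PM \<and>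
    (AE \<omega> in M0. \<forall>t\<ge>0. act t \<omega> \<longrightarrow> fst (Xw q) t \<omega> = snd (Xw q) (\<tau> \<omega>, t, \<omega>))" by blast
  define X where "X q = fst (Xw q)" for q
  define w where "w q = snd (Xw q)" for q
  have X: "UQ.cver (E q) (X q)" and wm: "w q \<in> borel_measurable PM"
    and ae: "AE \<omega> in M0. \<forall>t\<ge>0. act t \<omega> \<longrightarrow> X q t \<omega> = w q (\<tau> \<omega>, t, \<omega>)" if "q \<in> nnrat" for q
    using Xw that unfolding X_def w_def by blast+
  have E: "E q \<in> sets Q" if "q \<in> nnrat" for q using Ed[OF that] unfolding dsplit_def sets_Q by blast
  define W where "W = {p \<in> space PM. \<forall>q\<in>nnrat. fst (snd p) \<le> q \<longrightarrow> w q p \<le> 0}"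
  have "W \<in> sets PM"
  proof -
    have "fst \<in> borel_measurable (OM F)" by (rule time_measurable_OM[OF F_sa])
    moreover have "snd \<in> measurable PM (OM F)" unfolding PM_def by measurable
    ultimately have [measurable]: "(\<lambda>p. fst (snd p)) \<in> borel_measurable PM"
      using measurable_compose[of snd PM "OM F" fst borel] by blast
    have "W = space PM \<inter> (\<Inter>q\<in>nnrat. {p \<in> space PM. fst (snd p) \<le> q \<longrightarrow> w q p \<le> 0})" unfolding W_def by auto
    also have "\<dots> \<in> sets PM"
    proof (intro sets.Int sets.top sets.countable_INT' image_subsetI)
      show "countable nnrat" by (rule countable_nnrat)
      show "nnrat \<noteq> {}" using infinite_nnrat by auto
      fix q assume q: "q \<in> nnrat"
      note [measurable] = wm[OF q]
      show "{p \<in> space PM. fst (snd p) \<le> q \<longrightarrow> w q p \<le> 0} \<in> sets PM" by measurable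
    qed
    finally show ?thesis .
  qed
  then show ?thesis
  proof (rule tracedI)
    have "AE \<omega> in M0. \<omega> \<in> E q \<longrightarrow> (\<forall>t\<ge>0. 0 < X q t \<omega>)" if "q \<in> nnrat" for q
      by (rule AE_equiv[OF equiv_Q UQ.cver_AE_pos[OF X[OF that] E[OF that]]])
    then have pos: "AE \<omega> in M0. \<forall>q\<in>nnrat. \<omega> \<in> E q \<longrightarrow> (\<forall>t\<ge>0. 0 < X q t \<omega>)"
      by (intro AE_ball_countable' countable_nnrat)
    have zero1: "AE \<omega> in M0. r \<le> q \<longrightarrow> \<omega> \<in> \<Omega> \<longrightarrow> R \<omega> \<le> ennreal r \<longrightarrow> X q r \<omega> = 0"
      if q: "q \<in> nnrat" and r: "r \<in> nnrat" for q r
    proof (cases "r \<le> q")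
      case True
      have r0: "0 \<le> r" using r by simp
      have rq: "ennreal r \<le> ennreal q" using True by (rule ennreal_leI)
      have "E q \<inter> {\<omega>\<in>\<Omega>. R \<omega> \<le> ennreal r} = {}" unfolding E_def using order_trans[OF _ rq] by auto
      then have "AE \<omega> in Q. \<omega> \<in> {\<omega>\<in>\<Omega>. R \<omega> \<le> ennreal r} \<longrightarrow> X q r \<omega> = 0"
        by (intro UQ.cver_AE_disjoint[OF X[OF q] r0 RG[OF r0] _ E[OF q]]) simp
      then have "AE \<omega> in M0. \<omega> \<in> {\<omega>\<in>\<Omega>. R \<omega> \<le> ennreal r} \<longrightarrow> X q r \<omega> = 0" by (rule AE_equiv[OF equiv_Q])
      then show ?thesis by eventually_elim simp
    qed simp
    have zero: "AE \<omega> in M0. \<forall>q\<in>nnrat. \<forall>r\<in>nnrat. r \<le> q \<longrightarrow> \<omega> \<in> \<Omega> \<longrightarrow> R \<omega> \<le> ennreal r \<longrightarrow> X q r \<omega> = 0"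
      by (intro AE_ball_countable' countable_nnrat zero1)
    have Xw: "AE \<omega> in M0. \<forall>q\<in>nnrat. \<forall>t\<ge>0. act t \<omega> \<longrightarrow> X q t \<omega> = w q (\<tau> \<omega>, t, \<omega>)"
      by (intro AE_ball_countable' countable_nnrat ae)
    show "AE \<omega> in M0. \<forall>t\<ge>0. (t,\<omega>) \<in> {(t,\<omega>). act t \<omega>} \<longrightarrow>
      ((t,\<omega>) \<in> after_time \<Omega> R \<longleftrightarrow> (case (t,\<omega>) of (t,\<omega>) \<Rightarrow> (\<tau> \<omega>, t, \<omega>)) \<in> W)"
      using pos zero Xw AE_space
    proof eventually_elim
      case (elim \<omega>)
      have w: "\<omega> \<in> \<Omega>" using elim(4) unfolding space_M0 .
      show ?case
      proof (intro allI impI)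
        fix t :: real assume t: "0 \<le> t" and "(t,\<omega>) \<in> {(t,\<omega>). act t \<omega>}"
        then have a: "act t \<omega>" by simp
        then have tT: "ennreal t < T \<omega>" by simp
        have "R \<omega> \<le> ennreal t \<longleftrightarrow> (\<forall>q\<in>nnrat. t \<le> q \<longrightarrow> X q t \<omega> \<le> 0)"
        proof (rule threshold_iff_vanishing[OF t tT, where X="\<lambda>q s. X q s \<omega>"])
          fix q assume q: "q \<in> nnrat"
          show "((\<lambda>s. X q s \<omega>) \<longlongrightarrow> X q t \<omega>) (at_right t)"
            by (rule UQ.cver_right[OF X[OF q] t]) (simp add: space_Q w)
          assume "ennreal q < R \<omega>" "ennreal q < T \<omega>"
          then have "\<omega> \<in> E q" using w unfolding E_def by simp
          then show "0 < X q t \<omega>" using elim(1) q t by blast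
        qed (use elim(2) w in blast)
        also have "\<dots> \<longleftrightarrow> (\<forall>q\<in>nnrat. t \<le> q \<longrightarrow> w q (\<tau> \<omega>, t, \<omega>) \<le> 0)"
        proof (intro ball_cong refl)
          fix q assume "q \<in> nnrat"
          then have "X q t \<omega> = w q (\<tau> \<omega>, t, \<omega>)" using elim(3) t a by blast
          then show "(t \<le> q \<longrightarrow> X q t \<omega> \<le> 0) = (t \<le> q \<longrightarrow> w q (\<tau> \<omega>, t, \<omega>) \<le> 0)" by simp
        qed
        finally show "(t,\<omega>) \<in> after_time \<Omega> R \<longleftrightarrow> (case (t,\<omega>) of (t,\<omega>) \<Rightarrow> (\<tau> \<omega>, t, \<omega>)) \<in> W"
          unfolding mem_after_time W_def space_PM using t w by simp
      qed
    qed
  qed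
qed

end

section \<open>Gluing\<close>

text \<open>The event S \<le> q is used from the later time s on only. This gap is what lets
  \<open>rect_traced\<close> replace \<open>G q\<close> by \<open>K s\<close>.\<close>

lemma strictly_after_eq_UN:
  fixes S :: "'a \<Rightarrow> ennreal"
  shows "{(t,\<omega>) \<in> {0..} \<times> \<Omega>. S \<omega> < ennreal t} =
    (\<Union>(q,s)\<in>{(q,s). q \<in> nnrat \<and> s \<in> nnrat \<and> q < s}. {s..} \<times> {\<omega>\<in>\<Omega>. S \<omega> \<le> ennreal q})" (is "?L = ?R")
proof (intro equalityI subsetI)
  fix p assume "p \<in> ?L"
  then obtain t \<omega> where p: "p = (t,\<omega>)" and w: "\<omega> \<in> \<Omega>" and t: "0 \<le> t" "S \<omega> < ennreal t" by auto
  define c where "c = enn2real (S \<omega>)"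
  have c: "ennreal c = S \<omega>" "0 \<le> c" unfolding c_def using t(2) by (auto simp: less_top[symmetric] dest: less_trans[OF _ ennreal_less_top])
  then have "c < t" using t by (metis ennreal_less_iff)
  then obtain q where q: "q \<in> \<rat>" "c < q" "q < t" using Rats_dense_in_real by blast
  obtain s where s: "s \<in> \<rat>" "q < s" "s < t" using Rats_dense_in_real[OF q(3)] by blast
  have "S \<omega> \<le> ennreal q" unfolding c(1)[symmetric] using q by (simp add: ennreal_leI)
  then have "(t,\<omega>) \<in> {s..} \<times> {\<omega>\<in>\<Omega>. S \<omega> \<le> ennreal q}" using s w by simp
  moreover have "(q,s) \<in> {(q,s). q \<in> nnrat \<and> s \<in> nnrat \<and> q < s}" using q s c by auto
  ultimately show "p \<in> ?R" unfolding p by blast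
next
  fix p assume "p \<in> ?R"
  then obtain q s t \<omega> where p: "p = (t,\<omega>)" "q \<in> nnrat" "q < s" "s \<le> t" "\<omega> \<in> \<Omega>" "S \<omega> \<le> ennreal q" by auto
  then have "ennreal q < ennreal t" by (simp add: ennreal_less_iff)
  then have "S \<omega> < ennreal t" using p by (meson le_less_trans)
  then show "p \<in> ?L" using p by auto
qed

lemma countable_rational_pairs: "countable {(q,s). q \<in> nnrat \<and> s \<in> nnrat \<and> q < s}"
  by (rule countable_subset[of _ "nnrat \<times> nnrat"]) (auto intro!: countable_SIGMA countable_nnrat)

section \<open>Random intervals in the variables tau, t and omega\<close>

context enlargement begin

abbreviation "\<Phi> \<equiv> \<lambda>(t,\<omega>). (\<tau> \<omega>, t, \<omega>)"

lemma \<Phi>_space: "0 \<le> t \<Longrightarrow> \<omega> \<in> \<Omega> \<Longrightarrow> \<Phi> (t,\<omega>) \<in> space PM"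
  unfolding space_PM by simp

lemma rect_PM:
  assumes "B \<in> sets (borel::ennreal measure)" "D \<in> sets (OM F)" shows "B \<times> D \<in> sets PM"
  unfolding PM_def by (rule pair_measureI[OF assms])

text \<open>Up to a null set B lies in \<open>K s\<close>, because q < s. Sets of \<open>K s\<close>
  are built from tau and \<open>F s\<close>, and rectangles [s, oo) over \<open>F s\<close> are
  F-optional. The description holds on the whole time axis, also before tau.\<close>

lemma rect_traced:
  assumes q: "0 \<le> q" "q < s" and B: "B \<in> G q"
  shows "{s..} \<times> B \<in> traced \<Phi> PM UNIV"
proof -
  interpret UF: usual_conditions M0 F by (rule usual_F)
  have s: "0 \<le> s" using q by simp
  obtain B0 where B0: "B0 \<in> Kp q" "nullset ((B - B0) \<union> (B0 - B))" using B unfolding G_eq[OF q(1)] modnull_def by blast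
  have rect: "{s..} \<times> C \<in> sets (OM F)" if "C \<in> F s" for C
    using UF.rect_optional[OF s that] unfolding space_M0 sets_OM .
  have OF: "\<Omega> \<in> F s" using UF.H_space[OF s] unfolding space_M0 .
  \<comment> \<open>The times before s are left free, so that complements and unions can be taken
    without cutting at each step.\<close>
  define rep where "rep A W \<longleftrightarrow> (\<forall>t\<ge>s. \<forall>\<omega>\<in>\<Omega>. \<omega> \<in> A \<longleftrightarrow> (\<tau> \<omega>, t, \<omega>) \<in> W)" for A W
  have "B0 \<in> K s" using B0(1) q unfolding Kp_def by simp
  then have "\<exists>W. W \<in> sets PM \<and> rep B0 W"
  proof (rule K_induct[OF s])
    fix D assume D: "D \<in> F s"
    have "UNIV \<times> ({s..} \<times> D) \<in> sets PM" by (rule rect_PM[OF _ rect[OF D]]) simp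
    moreover have "rep D (UNIV \<times> ({s..} \<times> D))" by (simp add: rep_def)
    ultimately show "\<exists>W. W \<in> sets PM \<and> rep D W" by blast
  next
    fix B :: "ennreal set" assume B: "B \<in> sets borel"
    have "(\<lambda>x. min x (ennreal s)) \<in> borel_measurable (borel :: ennreal measure)" by measurable
    from measurable_sets[OF this B] have B': "(\<lambda>x. min x (ennreal s)) -` B \<in> sets borel" by simp
    show "\<exists>W. W \<in> sets PM \<and> rep {\<omega>\<in>\<Omega>. min (\<tau> \<omega>) (ennreal s) \<in> B} W"
      by (intro exI conjI, rule rect_PM[OF B' rect[OF OF]]) (auto simp: rep_def)
  next
    fix A assume "\<exists>W. W \<in> sets PM \<and> rep A W"
    then obtain W where W: "W \<in> sets PM" "rep A W" by blast
    show "\<exists>W. W \<in> sets PM \<and> rep (\<Omega> - A) W"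
      by (intro exI conjI, rule sets.compl_sets[OF W(1)]) (use W(2) s in \<open>simp add: rep_def space_PM\<close>)
  next
    fix A :: "nat \<Rightarrow> 'a set" assume "\<And>i. \<exists>W. W \<in> sets PM \<and> rep (A i) W"
    then obtain W where W: "\<And>i. W i \<in> sets PM" "\<And>i. rep (A i) (W i)" by metis
    have "(\<Union>i. W i) \<in> sets PM" by (rule sets.countable_UN'') (simp_all add: W(1))
    moreover have "rep (\<Union>i. A i) (\<Union>i. W i)" using W(2) by (simp add: rep_def)
    ultimately show "\<exists>W. W \<in> sets PM \<and> rep (\<Union>i. A i) W" by blast
  qed
  then obtain W where W: "W \<in> sets PM" "rep B0 W" by blast
  \<comment> \<open>One final cut at s removes the uncontrolled part of W.\<close>
  have "W \<inter> (UNIV \<times> ({s..} \<times> \<Omega>)) \<in> sets PM"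
    by (rule sets.Int[OF W(1) rect_PM[OF _ rect[OF OF]]]) simp
  then show ?thesis
  proof (rule tracedI)
    have "AE \<omega> in M0. \<omega> \<in> B \<longleftrightarrow> \<omega> \<in> B0" by (rule AE_M0_nullset[OF B0(2)]) blast
    then show "AE \<omega> in M0. \<forall>t\<ge>0. (t,\<omega>) \<in> UNIV \<longrightarrow> ((t,\<omega>) \<in> {s..} \<times> B \<longleftrightarrow> \<Phi> (t,\<omega>) \<in> W \<inter> (UNIV \<times> ({s..} \<times> \<Omega>)))"
      using AE_space
    proof eventually_elim
      case (elim \<omega>)
      have w: "\<omega> \<in> \<Omega>" using elim(2) unfolding space_M0 .
      show ?case
      proof (intro allI impI)
        fix t :: real assume "0 \<le> t"
        have "s \<le> t \<Longrightarrow> \<omega> \<in> B \<longleftrightarrow> (\<tau> \<omega>, t, \<omega>) \<in> W" using W(2) w elim(1) unfolding rep_def by blast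
        then show "(t,\<omega>) \<in> {s..} \<times> B \<longleftrightarrow> \<Phi> (t,\<omega>) \<in> W \<inter> (UNIV \<times> ({s..} \<times> \<Omega>))"
          using w by auto
      qed
    qed
  qed
qed

lemma strictly_after_traced:
  assumes S: "os_stopping_time \<Omega> G S"
  shows "{(t,\<omega>) \<in> {0..} \<times> \<Omega>. S \<omega> < ennreal t} \<in> traced \<Phi> PM UNIV"
proof -
  have "{(t,\<omega>) \<in> {0..} \<times> \<Omega>. S \<omega> < ennreal t} \<in> sigma_sets ({0..} \<times> \<Omega>) (traced \<Phi> PM UNIV)"
    unfolding strictly_after_eq_UN
  proof (rule sigma_sets_UNION)
    show "countable ((\<lambda>(q,s). {s..} \<times> {\<omega>\<in>\<Omega>. S \<omega> \<le> ennreal q}) ` {(q,s). q \<in> nnrat \<and> s \<in> nnrat \<and> q < s})"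
      by (rule countable_image[OF countable_rational_pairs])
    fix D assume "D \<in> (\<lambda>(q,s). {s..} \<times> {\<omega>\<in>\<Omega>. S \<omega> \<le> ennreal q}) ` {(q,s). q \<in> nnrat \<and> s \<in> nnrat \<and> q < s}"
    then obtain q s where D: "D = {s..} \<times> {\<omega>\<in>\<Omega>. S \<omega> \<le> ennreal q}" and q: "q \<in> nnrat" "q < s" by auto
    have q0: "0 \<le> q" using q by simp
    have "{\<omega>\<in>\<Omega>. S \<omega> \<le> ennreal q} \<in> G q" using S q0 unfolding os_stopping_time_def by blast
    then show "D \<in> sigma_sets ({0..} \<times> \<Omega>) (traced \<Phi> PM UNIV)"
      unfolding D by (intro sigma_sets.Basic rect_traced[OF q0 q(2)])
  qed
  then show ?thesis using traced_sigma_sets[where \<phi>=\<Phi> and N=PM and A=UNIV, OF \<Phi>_space subset_refl] by blast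
qed

text \<open>Each j gives a representative \<open>W j\<close> that is correct only inside its own
  interval. \<open>V j\<close> expresses S j < t in the variables (tau, t, omega), and
  \<open>U j\<close> expresses t < T j by an F-optional set, so \<open>W j\<close> can be cut down
  to that interval. Every covered point has a valid j, and all valid j agree with R \<le> t.\<close>

lemma after_time_covered:
  fixes S T :: "nat \<Rightarrow> 'a \<Rightarrow> ennreal"
  assumes S: "\<And>j. os_stopping_time \<Omega> G (S j)" and T: "\<And>j. os_stopping_time \<Omega> F (T j)"
    and sH: "\<And>j. \<exists>Q. os_sH_measure M F \<tau> (S j) (T j) Q"
    and cover: "\<And>t \<omega>. 0 \<le> t \<Longrightarrow> \<omega> \<in> \<Omega> \<Longrightarrow> (t,\<omega>) \<in> A \<Longrightarrow> \<tau> \<omega> \<le> ennreal t \<Longrightarrow> \<exists>j. S j \<omega> < ennreal t \<and> ennreal t < T j \<omega>"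
    and R: "os_stopping_time \<Omega> G R"
  shows "after_time \<Omega> R \<in> traced \<Phi> PM {(t,\<omega>). (t,\<omega>) \<in> A \<and> \<tau> \<omega> \<le> ennreal t}"
proof -
  interpret UF: usual_conditions M0 F by (rule usual_F)
  define B where "B j = {(t,\<omega>). \<tau> \<omega> \<le> ennreal t \<and> S j \<omega> \<le> ennreal t \<and> ennreal t < T j \<omega>}" for j
  have "\<exists>W. W \<in> sets PM \<and> agrees \<Phi> (B j) (after_time \<Omega> R) W" for j
  proof -
    obtain Q where Q: "os_sH_measure M F \<tau> (S j) (T j) Q" using sH by blast
    interpret enlargement_sH M F \<tau> "S j" "T j" Q by unfold_locales (rule S T Q)+
    have "after_time \<Omega> R \<in> traced \<Phi> PM (B j)" unfolding B_def by (rule after_time_act[OF R])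
    then show ?thesis unfolding traced_def by (rule CollectD)
  qed
  then obtain W where W: "\<And>j. W j \<in> sets PM" "\<And>j. agrees \<Phi> (B j) (after_time \<Omega> R) (W j)" by metis
  define D where "D j = {(t,\<omega>) \<in> {0..} \<times> \<Omega>. S j \<omega> < ennreal t}" for j
  have "\<exists>V. V \<in> sets PM \<and> agrees \<Phi> UNIV (D j) V" for j
    using strictly_after_traced[OF S[of j]] unfolding traced_def D_def by (rule CollectD)
  then obtain V where V: "\<And>j. V j \<in> sets PM" "\<And>j. agrees \<Phi> UNIV (D j) (V j)" by metis
  define U where "U j = (UNIV :: ennreal set) \<times> (space (OM F) - after_time \<Omega> (T j))" for j
  have U: "U j \<in> sets PM" for j unfolding U_def
  proof (rule rect_PM)
    have "after_time \<Omega> (T j) \<in> sets (OM F)" using UF.after_time_optional T unfolding space_M0 sets_OM by blast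
    then show "space (OM F) - after_time \<Omega> (T j) \<in> sets (OM F)" by (rule sets.compl_sets)
  qed simp
  have "(\<Union>j. W j \<inter> (V j \<inter> U j)) \<in> sets PM" by (intro sets.countable_UN'' sets.Int W V U) simp
  then show ?thesis
  proof (rule tracedI)
    have "AE \<omega> in M0. \<forall>j. \<forall>t\<ge>0. (t,\<omega>) \<in> B j \<longrightarrow> ((t,\<omega>) \<in> after_time \<Omega> R \<longleftrightarrow> \<Phi> (t,\<omega>) \<in> W j)"
      using W(2) unfolding agrees_def AE_all_countable by (rule allI)
    moreover have "AE \<omega> in M0. \<forall>j. \<forall>t\<ge>0. (t,\<omega>) \<in> UNIV \<longrightarrow> ((t,\<omega>) \<in> D j \<longleftrightarrow> \<Phi> (t,\<omega>) \<in> V j)"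
      using V(2) unfolding agrees_def AE_all_countable by (rule allI)
    ultimately show "AE \<omega> in M0. \<forall>t\<ge>0. (t,\<omega>) \<in> {(t,\<omega>). (t,\<omega>) \<in> A \<and> \<tau> \<omega> \<le> ennreal t} \<longrightarrow>
      ((t,\<omega>) \<in> after_time \<Omega> R \<longleftrightarrow> \<Phi> (t,\<omega>) \<in> (\<Union>j. W j \<inter> (V j \<inter> U j)))"
      using AE_space
    proof eventually_elim
      case (elim \<omega>)
      have w: "\<omega> \<in> \<Omega>" using elim(3) unfolding space_M0 .
      show ?case
      proof (intro allI impI)
        fix t :: real assume t: "0 \<le> t" and "(t,\<omega>) \<in> {(t,\<omega>). (t,\<omega>) \<in> A \<and> \<tau> \<omega> \<le> ennreal t}"
        then have a: "(t,\<omega>) \<in> A" "\<tau> \<omega> \<le> ennreal t" by auto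
        have Vj: "\<Phi> (t,\<omega>) \<in> V j \<longleftrightarrow> S j \<omega> < ennreal t" for j
        proof -
          have "(t,\<omega>) \<in> D j \<longleftrightarrow> \<Phi> (t,\<omega>) \<in> V j" using elim(2) t by blast
          then show ?thesis unfolding D_def using t w by simp
        qed
        have Uj: "\<Phi> (t,\<omega>) \<in> U j \<longleftrightarrow> ennreal t < T j \<omega>" for j
          unfolding U_def space_OM using t w by (simp add: mem_after_time not_le)
        have Wj: "\<Phi> (t,\<omega>) \<in> W j \<longleftrightarrow> R \<omega> \<le> ennreal t" if "S j \<omega> < ennreal t" "ennreal t < T j \<omega>" for j
        proof -
          have "(t,\<omega>) \<in> B j" unfolding B_def using a that by simp
          then have "(t,\<omega>) \<in> after_time \<Omega> R \<longleftrightarrow> \<Phi> (t,\<omega>) \<in> W j" using elim(1) t by blast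
          then show ?thesis using t w by (simp add: mem_after_time)
        qed
        have "\<Phi> (t,\<omega>) \<in> (\<Union>j. W j \<inter> (V j \<inter> U j)) \<longleftrightarrow> (\<exists>j. \<Phi> (t,\<omega>) \<in> W j \<and> S j \<omega> < ennreal t \<and> ennreal t < T j \<omega>)"
          unfolding UN_iff Int_iff Vj Uj by simp
        also have "\<dots> \<longleftrightarrow> R \<omega> \<le> ennreal t" using Wj cover[OF t w a] by blast
        finally show "(t,\<omega>) \<in> after_time \<Omega> R \<longleftrightarrow> \<Phi> (t,\<omega>) \<in> (\<Union>j. W j \<inter> (V j \<inter> U j))"
          using t w by (simp add: mem_after_time)
      qed
    qed
  qed
qed

section \<open>The two splitting formulas\<close>

lemma optional_procI:
  assumes "Y \<in> borel_measurable (OM F)" shows "os_optional_proc \<Omega> F Y"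
  unfolding os_optional_proc_def
proof
  fix B :: "real set" assume "B \<in> sets borel"
  from measurable_sets[OF assms this] have "Y -` B \<inter> space (OM F) \<in> os_optional_sets \<Omega> F" unfolding sets_OM .
  moreover have "Y -` B \<inter> space (OM F) = {p \<in> {0..} \<times> \<Omega>. Y p \<in> B}" unfolding space_OM by auto
  ultimately show "{p \<in> {0..} \<times> \<Omega>. Y p \<in> B} \<in> os_optional_sets \<Omega> F" by simp
qed

lemma param_optionalI:
  assumes "(\<lambda>q. Y (fst q) (snd q)) \<in> borel_measurable PM" shows "os_param_optional \<Omega> F Y"
  unfolding os_param_optional_def
proof
  fix B :: "real set" assume "B \<in> sets borel"
  from measurable_sets[OF assms this] have "(\<lambda>q. Y (fst q) (snd q)) -` B \<inter> space PM \<in> sets PM" .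
  moreover have "(\<lambda>q. Y (fst q) (snd q)) -` B \<inter> space PM = {q \<in> UNIV \<times> ({0..} \<times> \<Omega>). Y (fst q) (snd q) \<in> B}"
    unfolding space_PM by auto
  ultimately show "{q \<in> UNIV \<times> ({0..} \<times> \<Omega>). Y (fst q) (snd q) \<in> B} \<in>
        sigma_sets (UNIV \<times> ({0..} \<times> \<Omega>)) {C \<times> D | C D. C \<in> sets (borel :: ennreal measure) \<and> D \<in> os_optional_sets \<Omega> F}"
    unfolding PM_def sets_pair_measure space_OM sets_OM space_borel by simp
qed

lemma os_after_optional: "os_after \<Omega> \<tau> \<in> os_optional_sets \<Omega> G"
proof -
  interpret UG: usual_conditions M0 G by (rule usual_G[OF equiv_M0])
  have "(\<Union>(q,s)\<in>{(q,s). q \<in> nnrat \<and> s \<in> nnrat \<and> q < s}. {s..} \<times> {\<omega>\<in>\<Omega>. \<tau> \<omega> \<le> ennreal q}) \<in> sets (OM G)"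
  proof (rule sets.countable_UN''[OF countable_rational_pairs])
    fix z assume "z \<in> {(q,s). q \<in> nnrat \<and> s \<in> nnrat \<and> q < s}"
    then obtain q s where z: "z = (q,s)" "q \<in> nnrat" "s \<in> nnrat" "q < s" by auto
    have q: "0 \<le> q" and s: "0 \<le> s" using z by auto
    have "{\<omega>\<in>\<Omega>. \<tau> \<omega> \<le> ennreal q} \<in> G q" using \<tau>_le_G[OF q, of UNIV] by simp
    then have "{\<omega>\<in>\<Omega>. \<tau> \<omega> \<le> ennreal q} \<in> G s" using G_mono[OF q, of s] z by auto
    from UG.rect_optional[OF s this]
    show "(case z of (q,s) \<Rightarrow> {s..} \<times> {\<omega>\<in>\<Omega>. \<tau> \<omega> \<le> ennreal q}) \<in> sets (OM G)" unfolding z(1) sets_OM space_M0 by simp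
  qed
  then show ?thesis unfolding os_after_def strictly_after_eq_UN sets_OM .
qed

lemma os_Lo_after:
  fixes S T :: "nat \<Rightarrow> 'a \<Rightarrow> ennreal"
  assumes S: "\<And>j. os_stopping_time \<Omega> G (S j)" and T: "\<And>j. os_stopping_time \<Omega> F (T j)"
    and sH: "\<And>j. \<exists>Q. os_sH_measure M F \<tau> (S j) (T j) Q"
    and cover: "os_after \<Omega> \<tau> \<subseteq> (\<Union>j. os_open_int \<Omega> (S j) (T j))"
  shows "os_Lo M F \<tau> (os_after \<Omega> \<tau>)"
  unfolding os_Lo_def
proof (intro conjI allI impI os_after_optional)
  fix Y assume Y: "os_optional_proc \<Omega> G Y"
  let ?A = "{(t,\<omega>). (t,\<omega>) \<in> os_after \<Omega> \<tau> \<and> \<tau> \<omega> \<le> ennreal t}"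
  have "\<exists>g::_ \<Rightarrow> real. g \<in> borel_measurable PM \<and> (AE \<omega> in M0. \<forall>t\<ge>0. (t,\<omega>) \<in> ?A \<longrightarrow> Y (t,\<omega>) = g (\<Phi> (t,\<omega>)))"
  proof (rule optional_process_traced[OF _ _ Y])
    show "after_time \<Omega> R \<in> traced \<Phi> PM ?A" if "os_stopping_time \<Omega> G R" for R
    proof (rule after_time_covered[OF S T sH _ that])
      fix t \<omega> assume "(t,\<omega>) \<in> os_after \<Omega> \<tau>"
      then show "\<exists>j. S j \<omega> < ennreal t \<and> ennreal t < T j \<omega>" using cover unfolding os_open_int_def by blast
    qed
    show "\<Phi> (t,\<omega>) \<in> space PM" if "0 \<le> t" "\<omega> \<in> \<Omega>" for t \<omega> by (rule \<Phi>_space[OF that])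
  qed
  then obtain g :: "ennreal \<times> real \<times> 'a \<Rightarrow> real" where g: "g \<in> borel_measurable PM"
    "AE \<omega> in M0. \<forall>t\<ge>0. (t,\<omega>) \<in> ?A \<longrightarrow> Y (t,\<omega>) = g (\<Phi> (t,\<omega>))" by blast
  obtain Z where Z: "Z \<in> os_N M F \<tau>" "Z \<in> sets M" "emeasure M Z = 0"
    "\<forall>\<omega>\<in>\<Omega> - Z. \<forall>t\<ge>0. (t,\<omega>) \<in> ?A \<longrightarrow> Y (t,\<omega>) = g (\<Phi> (t,\<omega>))" using AE_M0_E[OF g(2)] by blast
  show "os_splitting M F \<tau> Y (os_after \<Omega> \<tau>)"
    unfolding os_splitting_def
  proof (intro exI conjI)
    \<comment> \<open>Strictly after tau the first branch of the formula never occurs, so Y' may be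
      zero.\<close>
    show "os_optional_proc \<Omega> F (\<lambda>_. 0)" by (rule optional_procI) simp
    show "os_param_optional \<Omega> F (\<lambda>u p. g (u, p))" by (rule param_optionalI) (use g(1) in simp)
    show "\<forall>\<omega>\<in>\<Omega> - Z. \<forall>t\<ge>0. (t,\<omega>) \<in> os_after \<Omega> \<tau> \<longrightarrow>
      Y (t,\<omega>) = (if ennreal t < \<tau> \<omega> then 0 else g (\<tau> \<omega>, t, \<omega>))"
    proof (intro ballI allI impI)
      fix \<omega> t assume w: "\<omega> \<in> \<Omega> - Z" and t: "0 \<le> t" and a: "(t,\<omega>) \<in> os_after \<Omega> \<tau>"
      have le: "\<tau> \<omega> < ennreal t" using a unfolding os_after_def by simp
      then have "(t,\<omega>) \<in> ?A" using a by (simp add: less_imp_le)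
      then have "Y (t,\<omega>) = g (\<tau> \<omega>, t, \<omega>)" using Z(4) w t by simp
      then show "Y (t,\<omega>) = (if ennreal t < \<tau> \<omega> then 0 else g (\<tau> \<omega>, t, \<omega>))" using less_not_sym[OF le] by simp
    qed
  qed (fact Z)+
qed

text \<open>Three regions exhaust all points: h acts before tau, g from tau on at positive times,
  and k at time 0 when tau = 0.\<close>

lemma os_Lo_global:
  fixes S T :: "nat \<Rightarrow> 'a \<Rightarrow> ennreal"
  assumes S: "\<And>j. os_stopping_time \<Omega> G (S j)" and T: "\<And>j. os_stopping_time \<Omega> F (T j)"
    and sH: "\<And>j. \<exists>Q. os_sH_measure M F \<tau> (S j) (T j) Q"
    and cover: "os_from_pos \<Omega> \<tau> \<subseteq> (\<Union>j. os_open_int \<Omega> (S j) (T j))"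
  shows "os_Lo M F \<tau> ({0..} \<times> \<Omega>)"
  unfolding os_Lo_def
proof (intro conjI allI impI)
  show "{0..} \<times> \<Omega> \<in> os_optional_sets \<Omega> G" using sets.top[of "OM G"] unfolding sets_OM space_OM .
  fix Y assume Y: "os_optional_proc \<Omega> G Y"
  let ?A = "{(t,\<omega>). (t,\<omega>) \<in> os_from_pos \<Omega> \<tau> \<and> \<tau> \<omega> \<le> ennreal t}"
  have sp: "p \<in> space (OM F)" if "p = (t,\<omega>)" "0 \<le> t" "\<omega> \<in> \<Omega>" for p t \<omega> unfolding space_OM using that by simp
  have "\<exists>g::_ \<Rightarrow> real. g \<in> borel_measurable PM \<and> (AE \<omega> in M0. \<forall>t\<ge>0. (t,\<omega>) \<in> ?A \<longrightarrow> Y (t,\<omega>) = g (\<Phi> (t,\<omega>)))"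
  proof (rule optional_process_traced[OF _ _ Y])
    show "after_time \<Omega> R \<in> traced \<Phi> PM ?A" if "os_stopping_time \<Omega> G R" for R
    proof (rule after_time_covered[OF S T sH _ that])
      fix t \<omega> assume "(t,\<omega>) \<in> os_from_pos \<Omega> \<tau>"
      then show "\<exists>j. S j \<omega> < ennreal t \<and> ennreal t < T j \<omega>" using cover unfolding os_open_int_def by blast
    qed
    show "\<Phi> (t,\<omega>) \<in> space PM" if "0 \<le> t" "\<omega> \<in> \<Omega>" for t \<omega> by (rule \<Phi>_space[OF that])
  qed
  then obtain g :: "ennreal \<times> real \<times> 'a \<Rightarrow> real" where g: "g \<in> borel_measurable PM"
    "AE \<omega> in M0. \<forall>t\<ge>0. (t,\<omega>) \<in> ?A \<longrightarrow> Y (t,\<omega>) = g (\<Phi> (t,\<omega>))" by blast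
  have "\<exists>h::_ \<Rightarrow> real. h \<in> borel_measurable (OM F) \<and> (AE \<omega> in M0. \<forall>t\<ge>0. (t,\<omega>) \<in> {(t,\<omega>). ennreal t < \<tau> \<omega>} \<longrightarrow> Y (t,\<omega>) = h (t,\<omega>))"
    by (rule optional_process_traced[OF after_time_before _ Y]) (auto simp: space_OM)
  then obtain h :: "real \<times> 'a \<Rightarrow> real" where h: "h \<in> borel_measurable (OM F)"
    "AE \<omega> in M0. \<forall>t\<ge>0. (t,\<omega>) \<in> {(t,\<omega>). ennreal t < \<tau> \<omega>} \<longrightarrow> Y (t,\<omega>) = h (t,\<omega>)" by blast
  have "\<exists>k::_ \<Rightarrow> real. k \<in> borel_measurable (OM F) \<and> (AE \<omega> in M0. \<forall>t\<ge>0. (t,\<omega>) \<in> {(t,\<omega>). t = 0 \<and> \<tau> \<omega> = 0} \<longrightarrow> Y (t,\<omega>) = k (t,\<omega>))"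
    by (rule optional_process_traced[OF after_time_at_zero _ Y]) (auto simp: space_OM)
  then obtain k :: "real \<times> 'a \<Rightarrow> real" where k: "k \<in> borel_measurable (OM F)"
    "AE \<omega> in M0. \<forall>t\<ge>0. (t,\<omega>) \<in> {(t,\<omega>). t = 0 \<and> \<tau> \<omega> = 0} \<longrightarrow> Y (t,\<omega>) = k (t,\<omega>)" by blast
  have "AE \<omega> in M0. \<forall>t\<ge>0. Y (t,\<omega>) = (if ennreal t < \<tau> \<omega> then h (t,\<omega>) else if t = 0 then k (t,\<omega>) else g (\<tau> \<omega>, t, \<omega>))"
    using g(2) h(2) k(2) AE_space
  proof eventually_elim
    case (elim \<omega>)
    have w: "\<omega> \<in> \<Omega>" using elim(4) unfolding space_M0 .
    show ?case
    proof (intro allI impI)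
      fix t :: real assume t: "0 \<le> t"
      consider "ennreal t < \<tau> \<omega>" | "\<tau> \<omega> \<le> ennreal t" "t = 0" | "\<tau> \<omega> \<le> ennreal t" "0 < t" using t by fastforce
      then show "Y (t,\<omega>) = (if ennreal t < \<tau> \<omega> then h (t,\<omega>) else if t = 0 then k (t,\<omega>) else g (\<tau> \<omega>, t, \<omega>))"
      proof cases
        case 1
        then show ?thesis using elim(2) t by simp
      next
        case 2
        then have "\<tau> \<omega> = 0" by simp
        then show ?thesis using elim(3) 2 by simp
      next
        case 3
        then have "(t,\<omega>) \<in> ?A" using w unfolding os_from_pos_def by simp
        then have "Y (t,\<omega>) = g (\<tau> \<omega>, t, \<omega>)" using elim(1) t by simp
        then show ?thesis using 3 leD[OF 3(1)] by simp
      qed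
    qed
  qed
  from AE_M0_E[OF this] obtain Z where Z: "Z \<in> os_N M F \<tau>" "Z \<in> sets M" "emeasure M Z = 0"
    "\<forall>\<omega>\<in>\<Omega> - Z. \<forall>t\<ge>0. Y (t,\<omega>) = (if ennreal t < \<tau> \<omega> then h (t,\<omega>) else if t = 0 then k (t,\<omega>) else g (\<tau> \<omega>, t, \<omega>))" by blast
  show "os_splitting M F \<tau> Y ({0..} \<times> \<Omega>)"
    unfolding os_splitting_def
  proof (intro exI conjI)
    show "os_optional_proc \<Omega> F h" by (rule optional_procI[OF h(1)])
    \<comment> \<open>At t = 0 the second branch means tau = 0, so there Y'' can be k, an F-optional
      function that does not depend on the parameter u.\<close>
    show "os_param_optional \<Omega> F (\<lambda>u p. if fst p = 0 then k p else g (u, p))"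
    proof (rule param_optionalI)
      have sm: "snd \<in> measurable PM (OM F)" unfolding PM_def by measurable
      have [measurable]: "(\<lambda>q. fst (snd q)) \<in> borel_measurable PM"
        by (rule measurable_compose[OF sm time_measurable_OM[OF F_sa]])
      have [measurable]: "(\<lambda>q. k (snd q)) \<in> borel_measurable PM" by (rule measurable_compose[OF sm k(1)])
      note [measurable] = g(1)
      have "(\<lambda>q. if fst (snd q) = 0 then k (snd q) else g q) \<in> borel_measurable PM" by measurable
      then show "(\<lambda>q. if fst (snd q) = 0 then k (snd q) else g (fst q, snd q)) \<in> borel_measurable PM"
        by (simp only: prod.collapse)
    qed
    show "\<forall>\<omega>\<in>\<Omega> - Z. \<forall>t\<ge>0. (t,\<omega>) \<in> {0..} \<times> \<Omega> \<longrightarrow>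
      Y (t,\<omega>) = (if ennreal t < \<tau> \<omega> then h (t,\<omega>) else if fst (t,\<omega>) = 0 then k (t,\<omega>) else g (\<tau> \<omega>, t, \<omega>))"
      using Z(4) by simp
  qed (fact Z)+
qed

end

theorem mainTheorem13:
  fixes M :: "'a measure" and F :: "real \<Rightarrow> 'a set set" and \<tau> :: "'a \<Rightarrow> ennreal"
    and S T :: "nat \<Rightarrow> 'a \<Rightarrow> ennreal"
  assumes "prob_space M"
    and "os_filtration M F"
    and "os_right_continuous F"
    and "os_null_gen M (os_Finf (space M) F) \<subseteq> F 0"
    and "\<tau> \<in> borel_measurable M"
    and "os_N M F \<tau> \<subseteq> sets M"
    and "\<forall>j. os_stopping_time (space M) (os_G M F \<tau>) (S j)"
    and "\<forall>j. os_stopping_time (space M) (os_G M F \<tau>) (T j)"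
    and "\<forall>j. os_stopping_time (space M) F (T j)"
    and "\<forall>j. \<exists>Q'. os_sH_measure M F \<tau> (S j) (T j) Q'"
  shows "(os_after (space M) \<tau> \<subseteq> (\<Union>j. os_open_int (space M) (S j) (T j))
            \<longrightarrow> os_Lo M F \<tau> (os_after (space M) \<tau>))
       \<and> (os_from_pos (space M) \<tau> \<subseteq> (\<Union>j. os_open_int (space M) (S j) (T j))
            \<longrightarrow> os_Lo M F \<tau> ({0..} \<times> space M))"
proof -
  interpret prob_space M by (rule assms(1))
  interpret enlargement M F \<tau> by unfold_locales (rule assms(2-6))+
  have S: "\<And>j. os_stopping_time (space M) (os_G M F \<tau>) (S j)" by (rule spec[OF assms(7)])
  have T: "\<And>j. os_stopping_time (space M) F (T j)" by (rule spec[OF assms(9)])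
  have sH: "\<And>j. \<exists>Q'. os_sH_measure M F \<tau> (S j) (T j) Q'" by (rule spec[OF assms(10)])
  show ?thesis
    by (intro conjI impI) (rule os_Lo_after[OF S T sH], assumption, rule os_Lo_global[OF S T sH], assumption)
qed

end
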